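(* Let $1\le p\le q\le+\infty$, $T>0$, $x_0,x_T\in\mathbb{R}^d$, $U=L^m_q(0,T)$, $\theta\colon\mathbb{R}^d\times\mathbb{R}^m\times[0,T]\to\mathbb{R}$, $f\colon\mathbb{R}^d\times\mathbb{R}^m\times[0,T]\to\mathbb{R}^d$, $g_j\colon\mathbb{R}^d\times[0,T]\to\mathbb{R}$, $j\in J=\{1,\dots,l\}$, and let $(x^*,u^* )$ be a locally optimal solution of the problem $$\min\ \mathcal{I}(x,u)=\int_0^T\theta(x(t),u(t),t)\,dt\quad\text{subject to}\quad\dot x(t)=f(x(t),u(t),t),\ t\in[0,T],$$ $$x(0)=x_0,\ x(T)=x_T,\ u\in U,\quad g_j(x(t),t)\le0\ \ \forall t\in[0,T],\ j\in J\qquad(\ast)$$ in $X=W^d_{1,p}(0,T)\times L^m_q(0,T)$. Suppose that: 1. $\theta$ and $f$ are continuous, differentiable in $x$ and $u$, and the functions $\nabla_x\theta$, $\nabla_u\theta$, $\nabla_xf$ and $\nabla_uf$ are continuous; 2. either $q=+\infty$, or all of the following hold: $\theta$ and $\nabla_x\theta$ satisfy the growth condition of order $(q,1)$; $\nabla_u\theta$ satisfies the growth condition of order $(q-1,q')$; $f$ and $\nabla_xf$ satisfy the growth condition of order $(q/p,p)$; and $\nabla_uf$ satisfies the growth condition of order $(q/s,s)$ with $s=qp/(q-p)$ in the case $q>p$, while $\nabla_uf$ does not depend on $u$ in the case $q=p$; 3. $g_j$, $j\in J$, are continuous, differentiable in $x$, and the functions $\nabla_xg_j$, $j\in J$, are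 continuous. Suppose finally that the linearised system $$\dot h(t)=A(t)h(t)+B(t)v(t),\quad A(t)=\nabla_xf(x^*(t),u^*(t),t),\quad B(t)=\nabla_uf(x^*(t),u^*(t),t)$$ is completely controllable using $L^q$-controls in time $T$, $A(\cdot)\in L^{d\times d}_\infty(0,T)$, and there exists $v\in L^m_q(0,T)$ such that the corresponding solution $h$ of the linearised system with $h(0)=0$ satisfies $h(T)=0$, and for any $j\in J$ one has $\langle\nabla_xg_j(x^*(t),t),h(t)\rangle<0$ for all $t\in[0,T]$ with $g_j(x^*(t),t)=0$. Then the penalty function $\Phi_\lambda(x,u)=\mathcal{I}(x,u)+\lambda\sup_{t\in[0,T]}\max\{g_1(x(t),t),\dots,g_l(x(t),t),0\}$ for problem $(\ast)$ is locally exact at $(x^*,u^* )$, i.e. there exists $\lambda^*(x^*,u^* )\ge0$ such that for every $\lambda\ge\lambda^*(x^*,u^* )$ the pair $(x^*,u^* )$ is a locally optimal solution (in $X$) of the problem of minimising $\Phi_\lambda(x,u)$ over all $(x,u)\in X$ with $u\in U$, $x(0)=x_0$, $x(T)=x_T$ and $\dot x(t)=f(x(t),u(t),t)$ for a.e. $t\in(0,T)$.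
   Context: Spaces: $L^m_q(0,T)$ is the product of $m$ copies of $L^q(0,T)$ with norm $\|u\|_q=(\int_0^T|u(t)|^q\,dt)^{1/q}$ (ess sup of the Euclidean norm if $q=+\infty$). $W^d_{1,p}(0,T)$ is the space of absolutely continuous $x\colon[0,T]\to\mathbb{R}^d$ with $\dot x\in L^d_p(0,T)$, norm $\|x\|_{1,p}=\|x\|_p+\|\dot x\|_p$. $X$ carries the sum norm, with respect to which local optimality is understood. $r'$ is the conjugate exponent of $r$. Growth condition: $g\colon\mathbb{R}^d\times\mathbb{R}^m\times[0,T]\to\mathbb{R}^k$ satisfies the growth condition of order $(l,s)$, $0\le l<+\infty$, $1\le s\le+\infty$, if for any $R>0$ there exist $C_R>0$ and an a.e. nonnegative $\omega_R\in L^s(0,T)$ with $|g(x,u,t)|\le C_R|u|^l+\omega_R(t)$ for a.e. $t\in[0,T]$ and all $(x,u)$ with $|x|\le R$. Complete controllability: the linear system $\dot x(t)=A(t)x(t)+B(t)u(t)$ is completely controllable using $L^q$-controls in time $T$ if for any $\xi_0,\xi_T\in\mathbb{R}^d$ one can find $u\in L^m_q(0,T)$ such that there exists an absolutely continuous solution $x$ on $[0,T]$ with $x(0)=\xi_0$ and $x(T)=\xi_T$. *)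

theory Defs
  imports "HOL-Analysis.Analysis" "HOL-Probability.Essential_Supremum"
begin

text \<open>
  Exponents range over \<open>[1, \<infinity>]\<close> and are extended reals.  Elements of the function spaces are
  represented by functions on \<open>real\<close>, of which only the restriction to \<open>{0..T}\<close> matters.
\<close>

definition Lp_space :: "ereal \<Rightarrow> real \<Rightarrow> (real \<Rightarrow> 'a::euclidean_space) set" where
  "Lp_space q T =
    {u. u \<in> borel_measurable (lebesgue_on {0..T}) \<and>
        (if q = \<infinity> then esssup (lebesgue_on {0..T}) (\<lambda>t. ereal (norm (u t))) < \<infinity>
         else integrable (lebesgue_on {0..T}) (\<lambda>t. norm (u t) powr real_of_ereal q))}"

definition Lp_norm :: "ereal \<Rightarrow> real \<Rightarrow> (real \<Rightarrow> 'a::euclidean_space) \<Rightarrow> real" where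
  "Lp_norm q T u =
    (if q = \<infinity> then real_of_ereal (esssup (lebesgue_on {0..T}) (\<lambda>t. ereal (norm (u t))))
     else (LINT t|lebesgue_on {0..T}. norm (u t) powr real_of_ereal q) powr (1 / real_of_ereal q))"

definition conj_exponent :: "ereal \<Rightarrow> ereal" where
  "conj_exponent q =
    (if q = 1 then \<infinity> else if q = \<infinity> then 1
     else ereal (real_of_ereal q / (real_of_ereal q - 1)))"

text \<open>
  Absolute continuity of functions; the library constant \<open>absolutely_continuous\<close> is about measures.
\<close>

definition abs_continuous_on :: "real \<Rightarrow> (real \<Rightarrow> 'a::real_normed_vector) \<Rightarrow> bool" where
  "abs_continuous_on T x \<longleftrightarrow>
    (\<forall>\<epsilon>>0. \<exists>\<delta>>0. \<forall>n (a :: nat \<Rightarrow> real) b.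
      (\<forall>i<n. 0 \<le> a i \<and> a i \<le> b i \<and> b i \<le> T) \<and>
      disjoint_family_on (\<lambda>i. {a i<..<b i}) {..<n} \<and>
      (\<Sum>i<n. b i - a i) < \<delta> \<longrightarrow>
      (\<Sum>i<n. norm (x (b i) - x (a i))) < \<epsilon>)"

text \<open>
  The derivative of an absolutely continuous function exists almost everywhere on \<open>{0..T}\<close>; the
  values of \<open>vector_derivative\<close> on the exceptional null set are irrelevant.
\<close>

abbreviation time_deriv :: "real \<Rightarrow> (real \<Rightarrow> 'a::real_normed_vector) \<Rightarrow> real \<Rightarrow> 'a" where
  "time_deriv T x t \<equiv> vector_derivative x (at t within {0..T})"

definition W1p_space :: "ereal \<Rightarrow> real \<Rightarrow> (real \<Rightarrow> 'a::euclidean_space) set" where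
  "W1p_space p T = {x. abs_continuous_on T x \<and> time_deriv T x \<in> Lp_space p T}"

definition W1p_norm :: "ereal \<Rightarrow> real \<Rightarrow> (real \<Rightarrow> 'a::euclidean_space) \<Rightarrow> real" where
  "W1p_norm p T x = Lp_norm p T x + Lp_norm p T (time_deriv T x)"

definition X_space ::
  "ereal \<Rightarrow> ereal \<Rightarrow> real \<Rightarrow> ((real \<Rightarrow> real^'d) \<times> (real \<Rightarrow> real^'m)) set" where
  "X_space p q T = W1p_space p T \<times> Lp_space q T"

definition X_dist ::
  "ereal \<Rightarrow> ereal \<Rightarrow> real \<Rightarrow> (real \<Rightarrow> real^'d) \<times> (real \<Rightarrow> real^'m)
    \<Rightarrow> (real \<Rightarrow> real^'d) \<times> (real \<Rightarrow> real^'m) \<Rightarrow> real" where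
  "X_dist p q T = (\<lambda>(x, u) (y, v).
    W1p_norm p T (\<lambda>t. x t - y t) + Lp_norm q T (\<lambda>t. u t - v t))"

definition locally_optimal ::
  "ereal \<Rightarrow> ereal \<Rightarrow> real \<Rightarrow> ((real \<Rightarrow> real^'d) \<times> (real \<Rightarrow> real^'m) \<Rightarrow> real)
    \<Rightarrow> ((real \<Rightarrow> real^'d) \<times> (real \<Rightarrow> real^'m)) set
    \<Rightarrow> (real \<Rightarrow> real^'d) \<times> (real \<Rightarrow> real^'m) \<Rightarrow> bool" where
  "locally_optimal p q T F M z \<longleftrightarrow>
    z \<in> M \<and> (\<exists>r>0. \<forall>w\<in>M. X_dist p q T w z < r \<longrightarrow> F z \<le> F w)"

text \<open>The power of a nonnegative number with the convention \<open>0\<^sup>0 = 1\<close>; note \<open>0 powr 0 = 0\<close>.\<close>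

definition rpow :: "real \<Rightarrow> real \<Rightarrow> real" where
  "rpow a l = (if l = 0 then 1 else a powr l)"

definition growth_condition ::
  "real \<Rightarrow> real \<Rightarrow> ereal \<Rightarrow> (real^'d \<Rightarrow> real^'m \<Rightarrow> real \<Rightarrow> 'k::euclidean_space) \<Rightarrow> bool" where
  "growth_condition T l s g \<longleftrightarrow>
    (\<forall>R>0. \<exists>C>0. \<exists>\<omega>\<in>Lp_space s T.
      (AE t in lebesgue_on {0..T}. 0 \<le> (\<omega> t :: real)) \<and>
      (AE t in lebesgue_on {0..T}. \<forall>x u. norm x \<le> R \<longrightarrow>
        norm (g x u t) \<le> C * rpow (norm u) l + \<omega> t))"

definition gradient :: "('a::real_inner \<Rightarrow> real) \<Rightarrow> 'a \<Rightarrow> 'a" where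
  "gradient \<phi> x = (THE D. GDERIV \<phi> x :> D)"

lemma gradient_eqI:
  assumes "GDERIV \<phi> x :> D"
  shows "gradient \<phi> x = D"
  unfolding gradient_def
proof (rule the_equality, fact assms)
  fix D' assume "GDERIV \<phi> x :> D'"
  with assms have "(\<lambda>h. inner h D') = (\<lambda>h. inner h D)"
    unfolding gderiv_def by (rule has_derivative_unique[rotated])
  then have "inner (D' - D) (D' - D) = 0"
    by (metis inner_diff_right right_minus_eq)
  then show "D' = D" by simp
qed

lemma gradient_works:
  fixes \<phi> :: "'a::euclidean_space \<Rightarrow> real"
  assumes "\<phi> differentiable (at x)"
  shows "GDERIV \<phi> x :> gradient \<phi> x"
proof -
  obtain \<phi>' where d: "(\<phi> has_derivative \<phi>') (at x)"
    using assms by (auto simp: differentiable_def)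
  define D where "D = (\<Sum>b\<in>Basis. \<phi>' b *\<^sub>R b)"
  interpret bounded_linear \<phi>' using d by (rule has_derivative_bounded_linear)
  have "\<phi>' = (\<lambda>h. inner h D)"
  proof
    fix h
    have "\<phi>' h = \<phi>' (\<Sum>b\<in>Basis. inner h b *\<^sub>R b)" by (simp add: euclidean_representation)
    also have "\<dots> = inner h D"
      by (simp add: D_def sum scaleR inner_sum_right mult.commute)
    finally show "\<phi>' h = inner h D" .
  qed
  with d have "GDERIV \<phi> x :> D" by (simp add: gderiv_def)
  then show ?thesis using gradient_eqI by metis
qed

definition grad_x ::
  "(real^'d \<Rightarrow> real^'m \<Rightarrow> real \<Rightarrow> real) \<Rightarrow> real^'d \<Rightarrow> real^'m \<Rightarrow> real \<Rightarrow> real^'d" where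
  "grad_x \<theta> x u t = gradient (\<lambda>y. \<theta> y u t) x"

definition grad_u ::
  "(real^'d \<Rightarrow> real^'m \<Rightarrow> real \<Rightarrow> real) \<Rightarrow> real^'d \<Rightarrow> real^'m \<Rightarrow> real \<Rightarrow> real^'m" where
  "grad_u \<theta> x u t = gradient (\<lambda>v. \<theta> x v t) u"

definition jac_x ::
  "(real^'d \<Rightarrow> real^'m \<Rightarrow> real \<Rightarrow> real^'d) \<Rightarrow> real^'d \<Rightarrow> real^'m \<Rightarrow> real \<Rightarrow> real^'d^'d" where
  "jac_x f x u t = jacobian (\<lambda>y. f y u t) (at x)"

definition jac_u ::
  "(real^'d \<Rightarrow> real^'m \<Rightarrow> real \<Rightarrow> real^'d) \<Rightarrow> real^'d \<Rightarrow> real^'m \<Rightarrow> real \<Rightarrow> real^'m^'d" where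
  "jac_u f x u t = jacobian (\<lambda>v. f x v t) (at u)"

definition continuous_data ::
  "real \<Rightarrow> (real^'d \<Rightarrow> real^'m \<Rightarrow> real \<Rightarrow> 'k::topological_space) \<Rightarrow> bool" where
  "continuous_data T g \<longleftrightarrow> continuous_on (UNIV \<times> UNIV \<times> {0..T}) (\<lambda>(x, u, t). g x u t)"

definition differentiable_xu ::
  "real \<Rightarrow> (real^'d \<Rightarrow> real^'m \<Rightarrow> real \<Rightarrow> 'k::real_normed_vector) \<Rightarrow> bool" where
  "differentiable_xu T g \<longleftrightarrow>
    (\<forall>x u. \<forall>t\<in>{0..T}. (\<lambda>y. g y u t) differentiable (at x) \<and> (\<lambda>v. g x v t) differentiable (at u))"

definition linear_solution ::
  "real \<Rightarrow> (real \<Rightarrow> real^'d^'d) \<Rightarrow> (real \<Rightarrow> real^'m^'d) \<Rightarrow> (real \<Rightarrow> real^'m)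
    \<Rightarrow> (real \<Rightarrow> real^'d) \<Rightarrow> bool" where
  "linear_solution T A B v h \<longleftrightarrow>
    abs_continuous_on T h \<and>
    (AE t in lebesgue_on {0..T}.
      (h has_vector_derivative A t *v h t + B t *v v t) (at t within {0..T}))"

definition completely_controllable ::
  "ereal \<Rightarrow> real \<Rightarrow> (real \<Rightarrow> real^'d^'d) \<Rightarrow> (real \<Rightarrow> real^'m^'d) \<Rightarrow> bool" where
  "completely_controllable q T A B \<longleftrightarrow>
    (\<forall>\<xi>0 \<xi>T. \<exists>u\<in>Lp_space q T. \<exists>x. linear_solution T A B u x \<and> x 0 = \<xi>0 \<and> x T = \<xi>T)"

definition cost ::
  "real \<Rightarrow> (real^'d \<Rightarrow> real^'m \<Rightarrow> real \<Rightarrow> real)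
    \<Rightarrow> (real \<Rightarrow> real^'d) \<times> (real \<Rightarrow> real^'m) \<Rightarrow> real" where
  "cost T \<theta> = (\<lambda>(x, u). LINT t|lebesgue_on {0..T}. \<theta> (x t) (u t) t)"

text \<open>The trajectories satisfying all constraints except the state constraints.\<close>

definition trajectories ::
  "ereal \<Rightarrow> ereal \<Rightarrow> real \<Rightarrow> (real^'d \<Rightarrow> real^'m \<Rightarrow> real \<Rightarrow> real^'d) \<Rightarrow> real^'d \<Rightarrow> real^'d
    \<Rightarrow> ((real \<Rightarrow> real^'d) \<times> (real \<Rightarrow> real^'m)) set" where
  "trajectories p q T f x0 xT =
    {(x, u) \<in> X_space p q T. x 0 = x0 \<and> x T = xT \<and>
      (AE t in lebesgue_on {0..T}.
        (x has_vector_derivative f (x t) (u t) t) (at t within {0..T}))}"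

definition state_feasible ::
  "real \<Rightarrow> nat \<Rightarrow> (nat \<Rightarrow> real^'d \<Rightarrow> real \<Rightarrow> real)
    \<Rightarrow> ((real \<Rightarrow> real^'d) \<times> (real \<Rightarrow> real^'m)) set" where
  "state_feasible T l g = {(x, u). \<forall>t\<in>{0..T}. \<forall>j\<in>{1..l}. g j (x t) t \<le> 0}"

definition penalty_function ::
  "real \<Rightarrow> (real^'d \<Rightarrow> real^'m \<Rightarrow> real \<Rightarrow> real) \<Rightarrow> nat \<Rightarrow> (nat \<Rightarrow> real^'d \<Rightarrow> real \<Rightarrow> real)
    \<Rightarrow> real \<Rightarrow> (real \<Rightarrow> real^'d) \<times> (real \<Rightarrow> real^'m) \<Rightarrow> real" where
  "penalty_function T \<theta> l g c = (\<lambda>(x, u). cost T \<theta> (x, u) +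
    c * (SUP t\<in>{0..T}. Max (insert 0 ((\<lambda>j. g j (x t) t) ` {1..l}))))"

end

theory Submission
  imports Defs
begin

text \<open>
  Let \<open>(x, u)\<close> be a trajectory near the optimal one that violates the state constraints by at most
  \<open>\<phi>\<close>.  A step of length \<open>\<epsilon>\<close> proportional to \<open>\<phi>\<close> along the direction \<open>h\<close> of the linearised system
  restores the state constraints to first order, and complete controllability allows one to correct
  the step so that the nonlinear equation and the end-point condition hold exactly.  The result
  is a feasible trajectory whose cost exceeds that of \<open>(x, u)\<close> by \<open>O(\<phi>)\<close>; comparing it with the optimal
  one gives exactness of the penalty.

  The correction is a fixed point of a contraction in the space of continuous functions: the growth
  conditions and dominated convergence imply that the linearisation error is Lipschitz with an
  arbitrarily small constant as a map into \<open>L\<^sup>1\<close>, which is all that the integral equation needs.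
\<close>

section \<open>Absolutely continuous functions\<close>

text \<open>The nearby control is close to \<open>u_opt\<close> only in the norm of L^q, so for
  finite q their difference has no uniform pointwise bound, and derivatives along the nearby pair
  cannot be compared with \<open>A\<close> and \<open>B\<close> uniformly in time. Hence the
  linearisation is kept at the optimal pair for every nearby trajectory, and the controls that are
  added are combinations of finitely many fixed ones: the direction \<open>v\<close> and one
  steering control per coordinate. All of them lie below one fixed envelope \<open>V\<close> in L^q,
  and this is what allows dominated convergence for the linearisation error divided by the size of
  the variation. Two kinds of smallness occur. The deviation of the new state from a step along
  \<open>h\<close>, and the change of the cost, must be bounded linearly in the step length, the
  former with a factor \<kappa> prescribed by the constraints. That the new trajectory stays in the
  neighbourhood in which the optimal one is minimal needs no rate; there plain continuity of the
  superposition operator into L^p suffices.\<close>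

lemma AE_lebesgue_on_iff_negligible:
  fixes S :: "'a::euclidean_space set"
  assumes "S \<in> sets lebesgue"
  shows "(AE t in lebesgue_on S. P t) \<longleftrightarrow> negligible {t \<in> S. \<not> P t}"
proof -
  have "(AE t in lebesgue_on S. P t) \<longleftrightarrow> (AE t in lebesgue. t \<in> S \<longrightarrow> P t)"
    using assms by (intro AE_restrict_space_iff) auto
  also have "\<dots> \<longleftrightarrow> negligible {t \<in> S. \<not> P t}"
  proof
    assume "AE t in lebesgue. t \<in> S \<longrightarrow> P t"
    then obtain N where "{t \<in> space lebesgue. \<not> (t \<in> S \<longrightarrow> P t)} \<subseteq> N"
      "emeasure lebesgue N = 0" "N \<in> sets lebesgue"
      by (rule AE_E)
    moreover from this have "negligible N" by (simp add: negligible_iff_null_sets null_setsI)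
    ultimately show "negligible {t \<in> S. \<not> P t}"
      by (auto intro: negligible_subset[of N])
  next
    assume "negligible {t \<in> S. \<not> P t}"
    then have "AE t in lebesgue. t \<notin> {t \<in> S. \<not> P t}"
      by (intro AE_not_in) (simp add: negligible_iff_null_sets)
    then show "AE t in lebesgue. t \<in> S \<longrightarrow> P t" by eventually_elim auto
  qed
  finally show ?thesis .
qed

text \<open>The definition enumerates intervals by an initial segment of the naturals, while the
  members of a tagged division are pairs of a tag and an interval. An enumeration of the finite
  index set transports the estimate, with the same \<open>\<delta>\<close> for all families.\<close>

lemma abs_continuous_on_finite_family:
  assumes "abs_continuous_on T x" "0 < (\<epsilon>::real)"
  shows "\<exists>\<delta>>0. \<forall>(I :: 'i set) a b. finite I \<longrightarrow> (\<forall>i\<in>I. 0 \<le> a i \<and> a i \<le> b i \<and> b i \<le> T) \<longrightarrow>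
      disjoint_family_on (\<lambda>i. {a i<..<b i}) I \<longrightarrow> (\<Sum>i\<in>I. b i - a i) < \<delta> \<longrightarrow>
      (\<Sum>i\<in>I. norm (x (b i) - x (a i))) < \<epsilon>"
proof -
  obtain \<delta> where \<delta>: "\<delta> > 0" and *: "\<And>n (a::nat\<Rightarrow>real) b. (\<forall>i<n. 0 \<le> a i \<and> a i \<le> b i \<and> b i \<le> T) \<Longrightarrow>
      disjoint_family_on (\<lambda>i. {a i<..<b i}) {..<n} \<Longrightarrow>
      (\<Sum>i<n. b i - a i) < \<delta> \<Longrightarrow> (\<Sum>i<n. norm (x (b i) - x (a i))) < \<epsilon>"
    using assms(1)[unfolded abs_continuous_on_def, THEN spec, THEN mp, OF assms(2)] by blast
  show ?thesis
  proof (intro exI[of _ \<delta>] conjI allI impI)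
    fix I :: "'i set" and a b
    assume I: "finite I" "\<forall>i\<in>I. 0 \<le> a i \<and> a i \<le> b i \<and> b i \<le> T"
      "disjoint_family_on (\<lambda>i. {a i<..<b i}) I" "(\<Sum>i\<in>I. b i - a i) < \<delta>"
    obtain k where k: "bij_betw k {..<card I} I"
      using I(1) ex_bij_betw_nat_finite[of I] by (auto simp: atLeast0LessThan)
    have sum: "(\<Sum>i\<in>I. g i) = (\<Sum>i<card I. g (k i))" for g :: "'i \<Rightarrow> real"
      using k by (rule sum.reindex_bij_betw[symmetric])
    have kI: "k i \<in> I" if "i < card I" for i
      using k that by (auto simp: bij_betw_def)
    have "k i \<noteq> k j" if "i < card I" "j < card I" "i \<noteq> j" for i j
      using k that by (auto simp: bij_betw_def inj_on_def)
    then have "disjoint_family_on (\<lambda>i. {a (k i)<..<b (k i)}) {..<card I}"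
      using I(3) kI unfolding disjoint_family_on_def by blast
    from *[OF _ this] show "(\<Sum>i\<in>I. norm (x (b i) - x (a i))) < \<epsilon>"
      using I(2,4) kI by (simp add: sum)
  qed fact
qed

lemma abs_continuous_imp_continuous:
  assumes "abs_continuous_on T x"
  shows "continuous_on {0..T} x"
  unfolding continuous_on_iff
proof (intro ballI allI impI)
  fix s and e :: real assume s: "s \<in> {0..T}" and "0 < e"
  obtain \<delta> where d: "0 < \<delta>"
    "\<forall>(I :: nat set) a b. finite I \<longrightarrow> (\<forall>i\<in>I. 0 \<le> a i \<and> a i \<le> b i \<and> b i \<le> T) \<longrightarrow>
      disjoint_family_on (\<lambda>i. {a i<..<b i}) I \<longrightarrow> (\<Sum>i\<in>I. b i - a i) < \<delta> \<longrightarrow>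
      (\<Sum>i\<in>I. norm (x (b i) - x (a i))) < e"
    using abs_continuous_on_finite_family[OF assms \<open>0 < e\<close>, where 'i = nat] by blast
  show "\<exists>d>0. \<forall>x'\<in>{0..T}. dist x' s < d \<longrightarrow> dist (x x') (x s) < e"
  proof (intro exI[of _ \<delta>] conjI ballI impI)
    fix t assume t: "t \<in> {0..T}" "dist t s < \<delta>"
    show "dist (x t) (x s) < e"
      using d(2)[THEN spec, of "{0}", THEN spec, of "\<lambda>_. min s t", THEN spec, of "\<lambda>_. max s t"] s t
      by (cases "s \<le> t") (auto simp: disjoint_family_on_def dist_norm norm_minus_commute)
  qed fact
qed

text \<open>Sums, differences, multiples and functions agreeing on the interval all have increments
  dominated by those of two absolutely continuous functions; this is their common proof.\<close>

lemma abs_continuous_on_bound: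
  assumes x: "abs_continuous_on T x" and y: "abs_continuous_on T y" and c: "0 \<le> (c::real)"
    and le: "\<And>s t. s \<in> {0..T} \<Longrightarrow> t \<in> {0..T} \<Longrightarrow> norm (z t - z s) \<le> c * (norm (x t - x s) + norm (y t - y s))"
  shows "abs_continuous_on T z"
  unfolding abs_continuous_on_def
proof (intro allI impI)
  fix e :: real assume "0 < e"
  \<comment> \<open>The summand 1 in \<open>c + 1\<close> admits \<open>c = 0\<close> and makes the
    final inequality strict.\<close>
  define e' where "e' = e / (2 * (c + 1))"
  have "2 * (c + 1) \<noteq> 0" using c by simp
  then have "e' * (2 * (c + 1)) = e"
    unfolding e'_def by (rule nonzero_eq_divide_eq[THEN iffD1, OF _ refl])
  then have "(c + 1) * (e' + e') = e" by (simp add: algebra_simps)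
  moreover have "0 < e'" using c \<open>0 < e\<close> by (simp add: e'_def)
  ultimately have e': "0 < e'" "(c + 1) * (e' + e') = e" by blast+
  obtain d1 where d1: "0 < d1" "\<forall>n (a::nat\<Rightarrow>real) b. (\<forall>i<n. 0 \<le> a i \<and> a i \<le> b i \<and> b i \<le> T) \<and>
      disjoint_family_on (\<lambda>i. {a i<..<b i}) {..<n} \<and> (\<Sum>i<n. b i - a i) < d1 \<longrightarrow>
      (\<Sum>i<n. norm (x (b i) - x (a i))) < e'"
    using x[unfolded abs_continuous_on_def, THEN spec, THEN mp, OF e'(1)] by blast
  obtain d2 where d2: "0 < d2" "\<forall>n (a::nat\<Rightarrow>real) b. (\<forall>i<n. 0 \<le> a i \<and> a i \<le> b i \<and> b i \<le> T) \<and>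
      disjoint_family_on (\<lambda>i. {a i<..<b i}) {..<n} \<and> (\<Sum>i<n. b i - a i) < d2 \<longrightarrow>
      (\<Sum>i<n. norm (y (b i) - y (a i))) < e'"
    using y[unfolded abs_continuous_on_def, THEN spec, THEN mp, OF e'(1)] by blast
  show "\<exists>\<delta>>0. \<forall>n (a::nat\<Rightarrow>real) b. (\<forall>i<n. 0 \<le> a i \<and> a i \<le> b i \<and> b i \<le> T) \<and>
      disjoint_family_on (\<lambda>i. {a i<..<b i}) {..<n} \<and> (\<Sum>i<n. b i - a i) < \<delta> \<longrightarrow>
      (\<Sum>i<n. norm (z (b i) - z (a i))) < e"
  proof (intro exI[of _ "min d1 d2"] conjI allI impI)
    fix n and a b :: "nat \<Rightarrow> real"
    assume *: "(\<forall>i<n. 0 \<le> a i \<and> a i \<le> b i \<and> b i \<le> T) \<and>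
      disjoint_family_on (\<lambda>i. {a i<..<b i}) {..<n} \<and> (\<Sum>i<n. b i - a i) < min d1 d2"
    let ?X = "\<Sum>i<n. norm (x (b i) - x (a i))" and ?Y = "\<Sum>i<n. norm (y (b i) - y (a i))"
    have XY: "?X < e'" "?Y < e'" using d1(2) d2(2) * by simp_all
    have "(\<Sum>i<n. norm (z (b i) - z (a i))) \<le> (\<Sum>i<n. c * (norm (x (b i) - x (a i)) + norm (y (b i) - y (a i))))"
      using * by (intro sum_mono le) (auto intro: order_trans)
    also have "\<dots> = c * (?X + ?Y)" by (simp only: sum_distrib_left[symmetric] sum.distrib)
    also have "\<dots> \<le> c * (e' + e')" using XY c by (intro mult_left_mono) auto
    also have "\<dots> < e" using e' by (simp add: algebra_simps)
    finally show "(\<Sum>i<n. norm (z (b i) - z (a i))) < e" .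
  qed (use d1(1) d2(1) in auto)
qed

lemma abs_continuous_on_add:
  assumes "abs_continuous_on T x" "abs_continuous_on T y"
  shows "abs_continuous_on T (\<lambda>t. x t + y t)"
  by (rule abs_continuous_on_bound[OF assms zero_le_one]) (simp add: add_diff_add norm_triangle_ineq)

lemma abs_continuous_on_diff:
  assumes "abs_continuous_on T x" "abs_continuous_on T y"
  shows "abs_continuous_on T (\<lambda>t. x t - y t)"
proof (rule abs_continuous_on_bound[OF assms zero_le_one])
  fix s t
  have "(x t - y t) - (x s - y s) = (x t - x s) - (y t - y s)" by simp
  then show "norm ((x t - y t) - (x s - y s)) \<le> 1 * (norm (x t - x s) + norm (y t - y s))"
    by (metis mult_1 norm_triangle_ineq4)
qed

lemma abs_continuous_on_scaleR:
  assumes "abs_continuous_on T x"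
  shows "abs_continuous_on T (\<lambda>t. c *\<^sub>R x t)"
  by (rule abs_continuous_on_bound[OF assms assms, of "\<bar>c\<bar>"])
    (auto simp: distrib_left simp flip: scaleR_diff_right)

lemma abs_continuous_on_cong:
  assumes "abs_continuous_on T x" "\<And>t. t \<in> {0..T} \<Longrightarrow> x t = y t"
  shows "abs_continuous_on T y"
  by (rule abs_continuous_on_bound[OF assms(1,1) zero_le_one]) (simp add: assms(2)[symmetric])

lemma has_vector_derivative_linear_approx:
  fixes x :: "real \<Rightarrow> 'a::real_normed_vector"
  assumes "(x has_vector_derivative D) (at t within S)" "0 < (e::real)"
  obtains d where "0 < d"
    "\<And>s. s \<in> S \<Longrightarrow> \<bar>s - t\<bar> < d \<Longrightarrow> norm (x s - x t - (s - t) *\<^sub>R D) \<le> e * \<bar>s - t\<bar>"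
  using assms(1)[unfolded has_vector_derivative_def has_derivative_within_alt, THEN conjunct2,
      THEN spec, THEN mp, OF assms(2)] by auto

text \<open>
  The fundamental theorem of calculus for absolutely continuous functions, in the gauge integral:
  a point outside the exceptional null set \<open>N\<close> gets the gauge from the definition of the derivative,
  and a point of \<open>N\<close> gets an open set of small measure around \<open>N\<close>, on which absolute continuity makes
  the increments of \<open>x\<close> small.
\<close>

lemma abs_continuous_has_integral:
  fixes x F :: "real \<Rightarrow> 'a::euclidean_space"
  assumes "0 \<le> T" and ac: "abs_continuous_on T x"
    and der: "AE t in lebesgue_on {0..T}. (x has_vector_derivative F t) (at t within {0..T})"
  shows "(F has_integral x T - x 0) {0..T}"
proof -
  define N where "N = {t \<in> {0..T}. \<not> (x has_vector_derivative F t) (at t within {0..T})}"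
  have N: "negligible N"
    using der by (simp add: AE_lebesgue_on_iff_negligible N_def)
  \<comment> \<open>On \<open>N\<close> the values of \<open>F\<close> are arbitrary and may be
    large. With value 0 there, a tag in \<open>N\<close> contributes nothing but the increment of
    \<open>x\<close>.\<close>
  define G where "G t = (if t \<in> N then 0 else F t)" for t
  have "(G has_integral x T - x 0) (cbox 0 T)"
    unfolding has_integral
  proof (intro allI impI)
    fix e :: real assume "0 < e"
    \<comment> \<open>Tags outside \<open>N\<close> contribute at most \<open>e' * T\<close>, less
      than half of \<open>e\<close>; the other half is reserved for the tags in
      \<open>N\<close>.\<close>
    define e' where "e' = e / (4 * (T + 1))"
    have e': "0 < e'" "e' * T < e / 2"
      using \<open>0 < e\<close> \<open>0 \<le> T\<close> by (auto simp: e'_def field_simps intro: add_pos_nonneg)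
    obtain \<delta> where \<delta>: "0 < \<delta>"
      "\<forall>(I :: (real \<times> real set) set) a b. finite I \<longrightarrow>
        (\<forall>i\<in>I. 0 \<le> a i \<and> a i \<le> b i \<and> b i \<le> T) \<longrightarrow>
        disjoint_family_on (\<lambda>i. {a i<..<b i}) I \<longrightarrow> (\<Sum>i\<in>I. b i - a i) < \<delta> \<longrightarrow>
        (\<Sum>i\<in>I. norm (x (b i) - x (a i))) < e / 2"
      using abs_continuous_on_finite_family[OF ac half_gt_zero[OF \<open>0 < e\<close>],
            where 'i = "real \<times> real set"] by blast
    have "N \<in> sets lebesgue" using N by (simp add: negligible_imp_sets)
    then obtain U where U: "open U" "N \<subseteq> U" "U - N \<in> lmeasurable" "emeasure lebesgue (U - N) < ennreal \<delta>"
      using sets_lebesgue_outer_open[OF _ \<delta>(1)] by blast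
    have Um: "U \<in> lmeasurable" "measure lebesgue U < \<delta>"
    proof -
      have "U = (U - N) \<union> N" using U(2) by auto
      moreover have "(U - N) \<union> N \<in> lmeasurable"
        using U(3) N by (intro fmeasurable.Un) (auto simp: negligible_imp_measurable)
      moreover have "measure lebesgue ((U - N) \<union> N) = measure lebesgue (U - N)"
        using U(3) N by (intro measure_Un_null_set) (auto simp: negligible_iff_null_sets)
      moreover have "measure lebesgue (U - N) < \<delta>"
        using U(4) U(3) \<delta>(1) by (metis emeasure_eq_measure2 ennreal_less_iff measure_nonneg)
      ultimately show "U \<in> lmeasurable" "measure lebesgue U < \<delta>" by simp_all
    qed
    have "\<forall>t\<in>{0..T} - N. \<exists>d. 0 < d \<and>
      (\<forall>s\<in>{0..T}. \<bar>s - t\<bar> < d \<longrightarrow> norm (x s - x t - (s - t) *\<^sub>R F t) \<le> e' * \<bar>s - t\<bar>)"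
    proof
      fix t assume "t \<in> {0..T} - N"
      then have "(x has_vector_derivative F t) (at t within {0..T})" by (auto simp: N_def)
      then show "\<exists>d. 0 < d \<and> (\<forall>s\<in>{0..T}. \<bar>s - t\<bar> < d \<longrightarrow>
        norm (x s - x t - (s - t) *\<^sub>R F t) \<le> e' * \<bar>s - t\<bar>)"
        by (rule has_vector_derivative_linear_approx[OF _ e'(1)]) blast
    qed
    from bchoice[OF this] obtain d where "\<forall>t\<in>{0..T} - N. 0 < d t \<and>
      (\<forall>s\<in>{0..T}. \<bar>s - t\<bar> < d t \<longrightarrow> norm (x s - x t - (s - t) *\<^sub>R F t) \<le> e' * \<bar>s - t\<bar>)" by blast
    then have d: "\<And>t. t \<in> {0..T} - N \<Longrightarrow> 0 < d t"
      "\<And>t s. t \<in> {0..T} - N \<Longrightarrow> s \<in> {0..T} \<Longrightarrow> \<bar>s - t\<bar> < d t \<Longrightarrow>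
        norm (x s - x t - (s - t) *\<^sub>R F t) \<le> e' * \<bar>s - t\<bar>"
      by blast+
    define \<gamma> where "\<gamma> t = (if t \<in> N then U else if t \<in> {0..T} then ball t (d t) else ball t 1)" for t
    show "\<exists>\<gamma>. gauge \<gamma> \<and> (\<forall>p. p tagged_division_of cbox 0 T \<and> \<gamma> fine p \<longrightarrow>
      norm ((\<Sum>(t, K)\<in>p. measure lborel K *\<^sub>R G t) - (x T - x 0)) < e)"
    proof (intro exI[of _ \<gamma>] conjI allI impI)
      show "gauge \<gamma>"
        using U(1,2) d(1) by (auto simp: gauge_def \<gamma>_def)
      fix p assume p: "p tagged_division_of cbox 0 T \<and> \<gamma> fine p"
      then have p1: "p tagged_division_of {0..T}" by simp
      note pD = tagged_division_ofD[OF p1]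
      define lo hi where "lo i = Inf (snd i)" and "hi i = Sup (snd i)" for i :: "real \<times> real set"
      have iv: "snd i = {lo i..hi i} \<and> lo i \<le> fst i \<and> fst i \<le> hi i \<and> 0 \<le> lo i \<and> hi i \<le> T
          \<and> fst i \<in> {0..T} \<and> lo i \<in> {0..T} \<and> hi i \<in> {0..T}"
        if ip: "i \<in> p" for i
      proof -
        obtain t K where i: "i = (t, K)" by force
        obtain a b where "K = cbox a b" using pD(4)[of t K] ip i by blast
        then have K: "K = {a..b}" by simp
        have "t \<in> K" "K \<subseteq> {0..T}" using pD(2,3) ip i by auto
        with K have "a \<le> t" "t \<le> b" "0 \<le> a" "b \<le> T" by auto
        with K i show ?thesis by (auto simp: lo_def hi_def)
      qed
      have ct: "measure lborel (snd i) = hi i - lo i" if "i \<in> p" for i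
        using iv[OF that] by auto
      let ?pN = "{i \<in> p. fst i \<in> N}"
      have disj: "disjoint_family_on (\<lambda>i. {lo i<..<hi i}) p"
        unfolding disjoint_family_on_def
      proof (intro ballI impI)
        fix i j assume ij: "i \<in> p" "j \<in> p" "i \<noteq> j"
        have "interior (snd i) \<inter> interior (snd j) = {}"
          using pD(5)[of "fst i" "snd i" "fst j" "snd j"] ij by (auto simp: prod_eq_iff)
        moreover have "interior (snd i) = {lo i<..<hi i}" if "i \<in> p" for i
          using conjunct1[OF iv[OF that]] interior_atLeastAtMost_real by metis
        ultimately show "{lo i<..<hi i} \<inter> {lo j<..<hi j} = {}"
          using ij by simp
      qed
      have smallN: "(\<Sum>i\<in>?pN. norm (x (hi i) - x (lo i))) < e / 2"
      proof (rule \<delta>(2)[rule_format])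
        show "finite ?pN" using pD(1) by auto
        show dj: "disjoint_family_on (\<lambda>i. {lo i<..<hi i}) ?pN"
          using disj by (rule disjoint_family_on_mono[rotated]) auto
        have "(\<Sum>i\<in>?pN. hi i - lo i) = (\<Sum>i\<in>?pN. measure lebesgue {lo i<..<hi i})"
        proof (intro sum.cong refl)
          fix i assume "i \<in> ?pN"
          then have "lo i \<le> hi i" using iv[of i] by auto
          then show "hi i - lo i = measure lebesgue {lo i<..<hi i}" by simp
        qed
        also have "\<dots> = measure lebesgue (\<Union>i\<in>?pN. {lo i<..<hi i})"
          using pD(1) dj
        proof (intro measure_finite_Union[symmetric])
          show "emeasure lebesgue {lo i<..<hi i} \<noteq> \<infinity>" for i
            by (cases "lo i \<le> hi i") auto
        qed auto
        also have "\<dots> \<le> measure lebesgue U"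
        proof (rule measure_mono_fmeasurable)
          have "{lo i<..<hi i} \<subseteq> U" if i: "i \<in> ?pN" for i
          proof -
            have "snd i \<subseteq> \<gamma> (fst i)" using p i by (auto simp: fine_def split_beta)
            then have "snd i \<subseteq> U" using i by (simp add: \<gamma>_def)
            moreover have "snd i = {lo i..hi i}" using iv[of i] i by auto
            ultimately show ?thesis using greaterThanLessThan_subseteq_atLeastAtMost_iff by fastforce
          qed
          then show "(\<Union>i\<in>?pN. {lo i<..<hi i}) \<subseteq> U" by blast
          show "U \<in> lmeasurable" by fact
          show "(\<Union>i\<in>?pN. {lo i<..<hi i}) \<in> sets lebesgue"
            using pD(1) by (intro sets.finite_UN) auto
        qed
        finally show "(\<Sum>i\<in>?pN. hi i - lo i) < \<delta>" using Um by simp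
        show "0 \<le> lo i \<and> lo i \<le> hi i \<and> hi i \<le> T" if "i \<in> ?pN" for i
          using iv[of i] that by auto
      qed
      have bound: "norm (measure lborel (snd i) *\<^sub>R G (fst i) - (x (hi i) - x (lo i)))
          \<le> e' * measure lborel (snd i) + (if fst i \<in> N then norm (x (hi i) - x (lo i)) else 0)" if i: "i \<in> p" for i
      proof (cases "fst i \<in> N")
        case True then show ?thesis
          using e' by (simp add: G_def content_pos_le norm_minus_commute)
      next
        case False
        define t a b where "t = fst i" and "a = lo i" and "b = hi i"
        have t: "t \<in> {0..T} - N" using iv[OF i] False by (auto simp: t_def)
        have ab: "a \<le> t" "t \<le> b" "a \<in> {0..T}" "b \<in> {0..T}" and sn: "snd i = {a..b}"
          using iv[OF i] by (auto simp: a_def b_def t_def)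
        have "snd i \<subseteq> \<gamma> t" using p i by (auto simp: fine_def split_beta t_def)
        then have "snd i \<subseteq> ball t (d t)" using t by (simp add: \<gamma>_def)
        then moreover have "a \<in> snd i" "b \<in> snd i" using sn ab by auto
        ultimately have "a \<in> ball t (d t)" "b \<in> ball t (d t)" by blast+
        then have close: "\<bar>a - t\<bar> < d t" "\<bar>b - t\<bar> < d t"
          by (auto simp: dist_real_def abs_minus_commute)
        \<comment> \<open>The interval is split at its tag, and each half is compared with the
          derivative at the tag. The two errors add up to \<open>e'\<close> times the length,
          because the tag lies between the endpoints.\<close>
        have "measure lborel (snd i) *\<^sub>R G (fst i) - (x b - x a)
          = (x a - x t - (a - t) *\<^sub>R F t) - (x b - x t - (b - t) *\<^sub>R F t)"
          using False ab sn by (simp add: G_def t_def[symmetric] algebra_simps)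
        also have "norm \<dots> \<le> e' * \<bar>a - t\<bar> + e' * \<bar>b - t\<bar>"
          using d(2)[OF t ab(3) close(1)] d(2)[OF t ab(4) close(2)]
          by (meson add_mono norm_triangle_ineq4 order_trans)
        also have "\<dots> = e' * measure lborel (snd i)"
          using ab sn by (simp add: algebra_simps)
        finally show ?thesis using False by (simp add: a_def b_def)
      qed
      have "(\<Sum>(t, K)\<in>p. measure lborel K *\<^sub>R G t) - (x T - x 0)
        = (\<Sum>i\<in>p. measure lborel (snd i) *\<^sub>R G (fst i) - (x (hi i) - x (lo i)))"
        using additive_tagged_division_1[OF \<open>0 \<le> T\<close> p1, of x]
        by (simp add: sum_subtractf split_def lo_def hi_def)
      also have "norm \<dots> \<le> (\<Sum>i\<in>p. e' * measure lborel (snd i) + (if fst i \<in> N then norm (x (hi i) - x (lo i)) else 0))"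
        using bound by (intro sum_norm_le)
      also have "\<dots> = e' * (\<Sum>i\<in>p. measure lborel (snd i)) + (\<Sum>i\<in>?pN. norm (x (hi i) - x (lo i)))"
        using pD(1) by (simp add: sum.distrib sum_distrib_left sum.inter_filter)
      also have "(\<Sum>i\<in>p. measure lborel (snd i)) = T"
        using additive_content_tagged_division[of p 0 T] p \<open>0 \<le> T\<close> by (simp add: split_def)
      finally show "norm ((\<Sum>(t, K)\<in>p. measure lborel K *\<^sub>R G t) - (x T - x 0)) < e"
        using smallN e' by linarith
    qed
  qed
  then have "(G has_integral x T - x 0) {0..T}" by simp
  then show ?thesis
    by (rule has_integral_spike[OF N, rotated]) (auto simp: G_def)
qed

lemma abs_continuous_on_mono:
  assumes "abs_continuous_on T x" "s \<le> T"
  shows "abs_continuous_on s x"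
  unfolding abs_continuous_on_def
proof (intro allI impI)
  fix e :: real assume "0 < e"
  from assms(1)[unfolded abs_continuous_on_def, THEN spec, THEN mp, OF this]
  obtain \<delta> where \<delta>: "0 < \<delta>" "\<forall>n (a::nat\<Rightarrow>real) b. (\<forall>i<n. 0 \<le> a i \<and> a i \<le> b i \<and> b i \<le> T) \<and>
      disjoint_family_on (\<lambda>i. {a i<..<b i}) {..<n} \<and> (\<Sum>i<n. b i - a i) < \<delta> \<longrightarrow>
      (\<Sum>i<n. norm (x (b i) - x (a i))) < e"
    by blast
  show "\<exists>\<delta>>0. \<forall>n (a::nat\<Rightarrow>real) b. (\<forall>i<n. 0 \<le> a i \<and> a i \<le> b i \<and> b i \<le> s) \<and>
      disjoint_family_on (\<lambda>i. {a i<..<b i}) {..<n} \<and> (\<Sum>i<n. b i - a i) < \<delta> \<longrightarrow>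
      (\<Sum>i<n. norm (x (b i) - x (a i))) < e"
  proof (intro exI[of _ \<delta>] conjI allI impI)
    fix n and a b :: "nat \<Rightarrow> real"
    assume *: "(\<forall>i<n. 0 \<le> a i \<and> a i \<le> b i \<and> b i \<le> s) \<and>
      disjoint_family_on (\<lambda>i. {a i<..<b i}) {..<n} \<and> (\<Sum>i<n. b i - a i) < \<delta>"
    then show "(\<Sum>i<n. norm (x (b i) - x (a i))) < e"
      using assms(2) by (intro \<delta>(2)[THEN spec, THEN spec, THEN spec, THEN mp]) force
  qed fact
qed

lemma abs_continuous_has_integral_upto:
  fixes x F :: "real \<Rightarrow> 'a::euclidean_space"
  assumes "0 \<le> s" "s \<le> T" and ac: "abs_continuous_on T x"
    and der: "AE t in lebesgue_on {0..T}. (x has_vector_derivative F t) (at t within {0..T})"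
  shows "(F has_integral x s - x 0) {0..s}"
proof (rule abs_continuous_has_integral)
  show "abs_continuous_on s x" using ac assms(2) by (rule abs_continuous_on_mono)
  have "negligible {t \<in> {0..T}. \<not> (x has_vector_derivative F t) (at t within {0..T})}"
    using der by (simp add: AE_lebesgue_on_iff_negligible)
  then have "negligible {t \<in> {0..s}. \<not> (x has_vector_derivative F t) (at t within {0..s})}"
  proof (rule negligible_subset)
    have "(x has_vector_derivative F t) (at t within {0..s})"
      if "(x has_vector_derivative F t) (at t within {0..T})" for t
      using that by (rule has_vector_derivative_within_subset) (use assms in auto)
    then show "{t \<in> {0..s}. \<not> (x has_vector_derivative F t) (at t within {0..s})}
      \<subseteq> {t \<in> {0..T}. \<not> (x has_vector_derivative F t) (at t within {0..T})}"
      using assms(2) by auto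
  qed
  then show "AE t in lebesgue_on {0..s}. (x has_vector_derivative F t) (at t within {0..s})"
    by (simp add: AE_lebesgue_on_iff_negligible)
qed fact

text \<open>
  Lebesgue's differentiation theorem on the line: the Vitali covering theorem extracts disjoint
  intervals with large difference quotients, and the Henstock lemma bounds their total length.
\<close>

lemma integral_has_vector_derivative_AE:
  fixes F :: "real \<Rightarrow> 'a::euclidean_space"
  assumes int: "F integrable_on {0..T}"
  shows "AE t in lebesgue_on {0..T}.
    ((\<lambda>s. integral {0..s} F) has_vector_derivative F t) (at t within {0..T})"
proof -
  define I where "I s = integral {0..s} F" for s
  have I: "integral {a..b} F = I b - I a" if "0 \<le> a" "a \<le> b" "b \<le> T" for a b
  proof -
    have "F integrable_on {0..b}" using int by (rule integrable_on_subinterval) (use that in auto)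
    then have "integral {0..a} F + integral {a..b} F = integral {0..b} F"
      using that by (intro Henstock_Kurzweil_Integration.integral_combine) auto
    then show ?thesis by (simp add: I_def algebra_simps)
  qed
  define bad where "bad c t s \<longleftrightarrow> s \<noteq> t \<and> s \<in> {0..T} \<and> c * \<bar>s - t\<bar> < norm (I s - I t - (s - t) *\<^sub>R F t)" for c t s
  define E where "E c = {t \<in> {0..T}. \<forall>d>0. \<exists>s. \<bar>s - t\<bar> < d \<and> bad c t s}" for c
  have neg: "negligible (E c)" if "0 < c" for c
    unfolding negligible_outer_le
  proof (intro allI impI)
    fix e :: real assume "0 < e"
    \<comment> \<open>The tolerance is \<open>e * c\<close> because every interval of the cover will
      contribute more than \<open>c\<close> times its length to the Henstock sum, so that the total
      length stays below \<open>e\<close>.\<close>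
    obtain \<gamma> where "gauge \<gamma>"
      and \<gamma>: "\<And>p. p tagged_partial_division_of cbox 0 T \<Longrightarrow> \<gamma> fine p \<Longrightarrow>
        (\<Sum>(x, k)\<in>p. norm (measure lborel k *\<^sub>R F x - integral k F)) < e * c"
      using Henstock_lemma[of F 0 T "e * c"] int \<open>0 < e\<close> \<open>0 < c\<close> by auto
    \<comment> \<open>The interval between a tag and a point with a bad difference quotient, which
      may lie on either side. It is written as a ball because the covering theorem speaks of balls;
      the tag is an endpoint, not the centre.\<close>
    define J where "J i = cball ((fst i + snd i) / 2) (\<bar>snd i - fst i\<bar> / 2)" for i :: "real \<times> real"
    have J: "J i = {min (fst i) (snd i)..max (fst i) (snd i)}" for i
      by (auto simp: J_def cball_eq_atLeastAtMost min_def max_def field_simps)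
    define K where "K = {(t, s). t \<in> E c \<and> bad c t s \<and> J (t, s) \<subseteq> \<gamma> t}"
    have K: "fst i \<in> {0..T}" "snd i \<in> {0..T}" "fst i \<noteq> snd i" "J i \<subseteq> \<gamma> (fst i)"
      "c * measure lborel (J i) < norm (measure lborel (J i) *\<^sub>R F (fst i) - integral (J i) F)" if "i \<in> K" for i
    proof -
      obtain t s where i: "i = (t, s)" by force
      show *: "fst i \<in> {0..T}" "snd i \<in> {0..T}" "fst i \<noteq> snd i" "J i \<subseteq> \<gamma> (fst i)"
        using that unfolding K_def i by (auto simp: E_def bad_def)
      have b: "c * \<bar>s - t\<bar> < norm (I s - I t - (s - t) *\<^sub>R F t)"
        using that by (auto simp: K_def bad_def i)
      show "c * measure lborel (J i) < norm (measure lborel (J i) *\<^sub>R F (fst i) - integral (J i) F)"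
      proof (cases "t \<le> s")
        case True
        then have "integral (J i) F = I s - I t"
          using * by (simp add: J i I)
        with True b show ?thesis
          by (simp add: J i norm_minus_commute)
      next
        case False
        then have "integral (J i) F = I t - I s"
          using * by (simp add: J i I)
        moreover have "norm ((t - s) *\<^sub>R F t - (I t - I s)) = norm (I s - I t - (s - t) *\<^sub>R F t)"
          by (rule arg_cong[of _ _ norm]) (simp add: algebra_simps)
        ultimately show ?thesis using False b by (simp add: J i del: scaleR_minus_left)
      qed
    qed
    \<comment> \<open>A point of \<open>E c\<close> has bad partners arbitrarily near, hence
      intervals that are short enough for the Vitali cover and at the same time inside the gauge at
      the tag.\<close>
    have cov: "\<exists>i. i \<in> K \<and> t \<in> cball ((fst i + snd i) / 2) (\<bar>snd i - fst i\<bar> / 2) \<and> \<bar>snd i - fst i\<bar> / 2 < d"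
      if t: "t \<in> E c" and "0 < d" for t d
    proof -
      obtain r where r: "0 < r" "ball t r \<subseteq> \<gamma> t"
        using \<open>gauge \<gamma>\<close> by (meson gauge_def openE)
      obtain s where s: "\<bar>s - t\<bar> < min r d" "bad c t s"
      proof -
        have "\<forall>d>0. \<exists>s. \<bar>s - t\<bar> < d \<and> bad c t s" using t by (simp add: E_def)
        moreover have "0 < min r d" using r(1) \<open>0 < d\<close> by simp
        ultimately show ?thesis using that by blast
      qed
      have "J (t, s) \<subseteq> ball t r"
        using s(1) by (auto simp: J dist_real_def)
      then have "(t, s) \<in> K" using r s t by (auto simp: K_def)
      moreover have "t \<in> J (t, s)" by (simp add: J)
      ultimately show ?thesis using s(1) by (intro exI[of _ "(t, s)"]) (auto simp: J_def)
    qed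
    have pos: "0 < \<bar>snd i - fst i\<bar> / 2" if "i \<in> K" for i
      using K(3)[OF that] by simp
    obtain C where C: "countable C" "C \<subseteq> K"
      "pairwise (\<lambda>i j. disjnt (J i) (J j)) C" "negligible (E c - (\<Union>i\<in>C. J i))"
      by (rule Vitali_covering_theorem_cballs[of K "\<lambda>i. \<bar>snd i - fst i\<bar> / 2" "E c" "\<lambda>i. (fst i + snd i) / 2",
            OF pos cov, folded J_def])
    \<comment> \<open>The Henstock lemma is about finite partial divisions, so the bound is proved
      for finite subfamilies; being uniform, it passes to the countable union.\<close>
    have fin: "measure lebesgue (\<Union>i\<in>C'. J i) \<le> e" if C': "C' \<subseteq> C" "finite C'" for C'
    proof -
      let ?g = "\<lambda>i. (fst i, J i)"
      have disj: "J i \<inter> J j = {}" if "i \<in> C'" "j \<in> C'" "i \<noteq> j" for i j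
        using C(3) C' that by (auto simp: pairwise_def disjnt_def)
      have ne: "J i \<noteq> {}" for i by (simp add: J_def)
      have inj: "inj_on ?g C'"
        using disj ne by (auto simp: inj_on_def) blast
      have CK: "i \<in> K" if "i \<in> C'" for i using C(2) C'(1) that by auto
      have fi: "fst i \<in> J i" for i by (auto simp: J)
      have "?g ` C' tagged_partial_division_of cbox 0 T"
        unfolding tagged_partial_division_of_def
      proof (intro conjI allI impI)
        fix x k assume "(x, k) \<in> ?g ` C'"
        then obtain i where i: "i \<in> C'" "x = fst i" "k = J i" by auto
        show "x \<in> k" using i fi by simp
        show "k \<subseteq> cbox 0 T" using K(1,2)[OF CK[OF i(1)]] i by (auto simp: J)
        show "\<exists>a b. k = cbox a b" using i by (auto simp: J simp flip: box_real)
      next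
        fix x1 k1 x2 k2 assume "(x1, k1) \<in> ?g ` C' \<and> (x2, k2) \<in> ?g ` C' \<and> (x1, k1) \<noteq> (x2, k2)"
        then obtain i j where "i \<in> C'" "k1 = J i" "j \<in> C'" "k2 = J j" "i \<noteq> j" by auto
        then have "k1 \<inter> k2 = {}" using disj by auto
        then show "interior k1 \<inter> interior k2 = {}" using interior_subset by blast
      qed (use C' in auto)
      moreover have "\<gamma> fine ?g ` C'" using K(4) CK by (auto simp: fine_def)
      ultimately have "(\<Sum>(x, k)\<in>?g ` C'. norm (measure lborel k *\<^sub>R F x - integral k F)) < e * c"
        by (rule \<gamma>)
      then have lt: "(\<Sum>i\<in>C'. norm (measure lborel (J i) *\<^sub>R F (fst i) - integral (J i) F)) < e * c"
        by (simp add: sum.reindex[OF inj])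
      have "c * measure lebesgue (\<Union>i\<in>C'. J i) \<le> c * (\<Sum>i\<in>C'. measure lebesgue (J i))"
        using \<open>0 < c\<close> C'(2) by (intro mult_left_mono measure_UNION_le) (auto simp: J)
      also have "\<dots> = (\<Sum>i\<in>C'. c * measure lborel (J i))"
        by (simp add: sum_distrib_left J)
      also have "\<dots> \<le> (\<Sum>i\<in>C'. norm (measure lborel (J i) *\<^sub>R F (fst i) - integral (J i) F))"
        using K(5) CK by (intro sum_mono less_imp_le) auto
      finally have "c * measure lebesgue (\<Union>i\<in>C'. J i) < c * e" using lt by (simp add: mult.commute)
      then show ?thesis using \<open>0 < c\<close> by simp
    qed
    have lm: "J i \<in> lmeasurable" for i by (simp add: J)
    have U: "(\<Union>i\<in>C. J i) \<in> lmeasurable" "measure lebesgue (\<Union>i\<in>C. J i) \<le> e"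
      using fmeasurable_UN_bound[OF C(1) lm fin] measure_UN_bound[OF C(1) lm fin] by auto
    show "\<exists>S. E c \<subseteq> S \<and> S \<in> lmeasurable \<and> measure lebesgue S \<le> e"
    proof (intro exI conjI)
      let ?N = "E c - (\<Union>i\<in>C. J i)"
      show "E c \<subseteq> (\<Union>i\<in>C. J i) \<union> ?N" by blast
      show "(\<Union>i\<in>C. J i) \<union> ?N \<in> lmeasurable"
        using U(1) C(4) by (intro fmeasurable.Un) (auto simp: negligible_imp_measurable)
      have "measure lebesgue ((\<Union>i\<in>C. J i) \<union> ?N) = measure lebesgue (\<Union>i\<in>C. J i)"
        using U(1) C(4) by (intro measure_Un_null_set) (auto simp: negligible_iff_null_sets)
      then show "measure lebesgue ((\<Union>i\<in>C. J i) \<union> ?N) \<le> e" using U(2) by simp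
    qed
  qed
  have "{t \<in> {0..T}. \<not> (I has_vector_derivative F t) (at t within {0..T})} \<subseteq> (\<Union>n. E (1 / Suc n))"
  proof
    fix t assume t: "t \<in> {t \<in> {0..T}. \<not> (I has_vector_derivative F t) (at t within {0..T})}"
    then obtain e where e: "0 < e" "\<forall>d>0. \<exists>s\<in>{0..T}. \<bar>s - t\<bar> < d \<and> \<not> norm (I s - I t - (s - t) *\<^sub>R F t) \<le> e * \<bar>s - t\<bar>"
      unfolding has_vector_derivative_def has_derivative_within_alt
      by (auto simp: bounded_linear_scaleR_left)
    obtain n where n: "1 / Suc n < e" using e(1) nat_approx_posE by blast
    have "t \<in> E (1 / Suc n)"
      unfolding E_def
    proof (intro CollectI conjI allI impI)
      fix d :: real assume "0 < d"
      then obtain s where s: "s \<in> {0..T}" "\<bar>s - t\<bar> < d" "\<not> norm (I s - I t - (s - t) *\<^sub>R F t) \<le> e * \<bar>s - t\<bar>"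
        using e(2) by blast
      have "1 / Suc n * \<bar>s - t\<bar> \<le> e * \<bar>s - t\<bar>" using n by (intro mult_right_mono) auto
      moreover have "s \<noteq> t" using s(3) by auto
      ultimately show "\<exists>s. \<bar>s - t\<bar> < d \<and> bad (1 / Suc n) t s"
        using s unfolding bad_def by (intro exI[of _ s]) auto
    qed (use t in auto)
    then show "t \<in> (\<Union>n. E (1 / Suc n))" by blast
  qed
  moreover have "negligible (\<Union>n. E (1 / Suc n))"
    by (intro negligible_countable_Union) (auto intro!: neg)
  ultimately have "negligible {t \<in> {0..T}. \<not> (I has_vector_derivative F t) (at t within {0..T})}"
    using negligible_subset by blast
  then show ?thesis by (simp add: AE_lebesgue_on_iff_negligible I_def[abs_def])
qed

text \<open>The norm of \<open>F\<close> is at most \<open>n\<close> plus its excess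
  \<open>m n\<close> over \<open>n\<close>. By dominated convergence some excess has integral below
  \<open>e / 2\<close>, and the bounded part contributes at most \<open>n\<close> times the total
  length of the intervals.\<close>

lemma abs_continuous_on_integral:
  fixes F :: "real \<Rightarrow> 'a::euclidean_space"
  assumes int: "integrable (lebesgue_on {0..T}) F"
  shows "abs_continuous_on T (\<lambda>t. integral {0..t} F)"
  unfolding abs_continuous_on_def
proof (intro allI impI)
  fix e :: real assume "0 < e"
  define m where "m n t = max 0 (norm (F t) - real n)" for n t
  have [measurable]: "F \<in> borel_measurable (lebesgue_on {0..T})" using int by auto
  have meas: "(\<lambda>t. m n t) \<in> borel_measurable (lebesgue_on {0..T})" for n
    unfolding m_def by measurable
  have lim: "(\<lambda>n. m n t) \<longlonglongrightarrow> 0" for t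
  proof (rule tendsto_eventually)
    obtain N :: nat where "norm (F t) \<le> real N" using real_arch_simple by blast
    then show "\<forall>\<^sub>F n in sequentially. m n t = 0"
      by (intro eventually_sequentiallyI[of N]) (auto simp: m_def)
  qed
  have "(\<lambda>n. LINT t|lebesgue_on {0..T}. m n t) \<longlonglongrightarrow> (LINT t|lebesgue_on {0..T}. 0)"
    using int meas lim
    by (intro integral_dominated_convergence[where w = "\<lambda>t. norm (F t)"]) (auto simp: m_def)
  then have "\<forall>\<^sub>F n in sequentially. (LINT t|lebesgue_on {0..T}. m n t) < e / 2"
    using \<open>0 < e\<close> by (intro order_tendstoD(2)) auto
  then obtain n where n: "(LINT t|lebesgue_on {0..T}. m n t) < e / 2"
    by (auto simp: eventually_sequentially)
  have mint: "integrable (lebesgue_on {0..T}) (m n)"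
    by (rule Bochner_Integration.integrable_bound[OF int meas]) (auto simp: m_def)
  then have mint': "m n integrable_on {0..T}" by (intro integrable_on_lebesgue_on) auto
  have n': "integral {0..T} (m n) < e / 2"
    using n lebesgue_integral_eq_integral[OF mint] by simp
  have Fint: "F integrable_on {0..T}" using int by (intro integrable_on_lebesgue_on) auto
  have incr: "norm (integral {0..b} F - integral {0..a} F) \<le> integral {a..b} (m n) + real n * (b - a)"
    if "0 \<le> a" "a \<le> b" "b \<le> T" for a b
  proof -
    have "F integrable_on {0..b}" using Fint by (rule integrable_on_subinterval) (use that in auto)
    then have "integral {0..a} F + integral {a..b} F = integral {0..b} F"
      using that by (intro Henstock_Kurzweil_Integration.integral_combine) auto
    then have "norm (integral {0..b} F - integral {0..a} F) = norm (integral {a..b} F)"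
      by (metis add_diff_cancel_left')
    also have "\<dots> \<le> integral {a..b} (\<lambda>t. m n t + real n)"
    proof (rule integral_norm_bound_integral)
      show "F integrable_on {a..b}" using Fint by (rule integrable_on_subinterval) (use that in auto)
      have "m n integrable_on {a..b}" using mint' by (rule integrable_on_subinterval) (use that in auto)
      then show "(\<lambda>t. m n t + real n) integrable_on {a..b}" by (intro integrable_add integrable_const_ivl)
    qed (auto simp: m_def)
    also have "\<dots> = integral {a..b} (m n) + real n * (b - a)"
    proof -
      have "m n integrable_on {a..b}" using mint' by (rule integrable_on_subinterval) (use that in auto)
      then show ?thesis using that by (subst integral_add) (auto simp: integrable_const_ivl)
    qed
    finally show ?thesis .
  qed
  show "\<exists>\<delta>>0. \<forall>k (a :: nat \<Rightarrow> real) b. (\<forall>i<k. 0 \<le> a i \<and> a i \<le> b i \<and> b i \<le> T) \<and>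
      disjoint_family_on (\<lambda>i. {a i<..<b i}) {..<k} \<and> (\<Sum>i<k. b i - a i) < \<delta> \<longrightarrow>
      (\<Sum>i<k. norm (integral {0..b i} F - integral {0..a i} F)) < e"
  \<comment> \<open>With this \<delta> the bounded part contributes at most \<open>e / 2\<close>;
    the summand 1 covers \<open>n = 0\<close>.\<close>
  proof (intro exI[of _ "e / (2 * (real n + 1))"] conjI allI impI)
    fix k and a b :: "nat \<Rightarrow> real"
    assume *: "(\<forall>i<k. 0 \<le> a i \<and> a i \<le> b i \<and> b i \<le> T) \<and>
      disjoint_family_on (\<lambda>i. {a i<..<b i}) {..<k} \<and> (\<Sum>i<k. b i - a i) < e / (2 * (real n + 1))"
    \<comment> \<open>Open intervals are used because only they are disjoint; the closed ones may
      share endpoints. Hence at each time at most one summand is nonzero.\<close>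
    let ?h = "\<lambda>i t. if t \<in> {a i<..<b i} then m n t else 0"
    have sub: "{a i<..<b i} \<subseteq> {0..T}" if "i < k" for i
      using * that by (auto intro: order_trans less_imp_le)
    have h: "?h i integrable_on {0..T}" "integral {a i..b i} (m n) = integral {0..T} (?h i)" if "i < k" for i
    proof -
      have "m n integrable_on {a i..b i}" using mint' by (rule integrable_on_subinterval) (use * that in auto)
      then have "m n integrable_on {a i<..<b i}" by (simp add: integrable_on_Icc_iff_Ioo)
      then show "?h i integrable_on {0..T}"
        unfolding integrable_restrict_Int Int_absorb2[OF sub[OF that]] .
      show "integral {a i..b i} (m n) = integral {0..T} (?h i)"
        unfolding Henstock_Kurzweil_Integration.integral_restrict_Int Int_absorb2[OF sub[OF that]]
        by (rule integral_open_interval_real)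
    qed
    have le: "(\<Sum>i<k. ?h i t) \<le> m n t" for t
    proof (cases "\<exists>i<k. t \<in> {a i<..<b i}")
      case True
      then obtain j where j: "j < k" "t \<in> {a j<..<b j}" by blast
      have eq: "i = j" if "i < k" "t \<in> {a i<..<b i}" for i
      proof (rule ccontr)
        assume "i \<noteq> j"
        then have "{a i<..<b i} \<inter> {a j<..<b j} = {}"
          using disjoint_family_onD[of "\<lambda>i. {a i<..<b i}" "{..<k}" i j] * j that by auto
        then show False using j(2) that(2) by blast
      qed
      have "(\<Sum>i<k. ?h i t) = (\<Sum>i<k. if i = j then m n t else 0)"
      proof (intro sum.cong refl if_cong)
        show "t \<in> {a i<..<b i} \<longleftrightarrow> i = j" if "i \<in> {..<k}" for i
          using eq[of i] that j by blast
      qed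
      then show ?thesis using j(1) by simp
    next
      case False
      then have "(\<Sum>i<k. ?h i t) = 0" by (intro sum.neutral) auto
      then show ?thesis by (simp add: m_def)
    qed
    have "(\<Sum>i<k. norm (integral {0..b i} F - integral {0..a i} F))
      \<le> (\<Sum>i<k. integral {a i..b i} (m n) + real n * (b i - a i))"
      using * incr by (intro sum_mono) auto
    also have "\<dots> = (\<Sum>i<k. integral {0..T} (?h i)) + real n * (\<Sum>i<k. b i - a i)"
      using h(2) by (simp add: sum.distrib sum_distrib_left)
    also have "(\<Sum>i<k. integral {0..T} (?h i)) = integral {0..T} (\<lambda>t. \<Sum>i<k. ?h i t)"
      using h(1) by (intro integral_sum[symmetric]) auto
    also have "\<dots> \<le> integral {0..T} (m n)"
      using h(1) mint' le by (intro integral_le integrable_sum) auto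
    also have "\<dots> < e / 2" by (rule n')
    also have "real n * (\<Sum>i<k. b i - a i) \<le> real n * (e / (2 * (real n + 1)))"
      using * by (intro mult_left_mono) auto
    also have "\<dots> \<le> e / 2" using \<open>0 < e\<close> by (simp add: field_simps)
    finally show "(\<Sum>i<k. norm (integral {0..b i} F - integral {0..a i} F)) < e" by simp
  qed (use \<open>0 < e\<close> in simp)
qed

section \<open>The spaces of controls\<close>

lemma Lp_space_measurable [measurable_dest]:
  "u \<in> Lp_space q T \<Longrightarrow> u \<in> borel_measurable (lebesgue_on {0..T})"
  by (simp add: Lp_space_def)

lemma exponent_cases:
  assumes "1 \<le> (q::ereal)"
  obtains (fin) r where "q = ereal r" "1 \<le> r" | (inf) "q = \<infinity>"
  using assms by (cases q) auto

lemma Lp_space_ereal_iff: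
  "u \<in> Lp_space (ereal r) T \<longleftrightarrow> u \<in> borel_measurable (lebesgue_on {0..T}) \<and>
    integrable (lebesgue_on {0..T}) (\<lambda>t. norm (u t) powr r)"
  by (simp add: Lp_space_def)

lemma Lp_space_infinity_iff:
  fixes u :: "real \<Rightarrow> 'a::euclidean_space"
  shows "u \<in> Lp_space \<infinity> T \<longleftrightarrow> u \<in> borel_measurable (lebesgue_on {0..T}) \<and>
    (\<exists>M\<ge>0. AE t in lebesgue_on {0..T}. norm (u t) \<le> M)"
proof (intro iffI conjI)
  let ?L = "lebesgue_on {0..T}"
  assume u: "u \<in> Lp_space \<infinity> T"
  then show [measurable]: "u \<in> borel_measurable ?L" by (simp add: Lp_space_def)
  have "esssup ?L (\<lambda>t. ereal (norm (u t))) < \<infinity>" using u by (simp add: Lp_space_def)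
  then obtain M where M: "esssup ?L (\<lambda>t. ereal (norm (u t))) \<le> ereal M"
    by (cases "esssup ?L (\<lambda>t. ereal (norm (u t)))") auto
  \<comment> \<open>\<open>T\<close> is not assumed positive here, and over a null interval the
    essential supremum carries no sign information; the maximum with 0 yields a nonnegative bound in
    every case.\<close>
  have "AE t in ?L. norm (u t) \<le> max 0 M"
    using esssup_AE[of "\<lambda>t. ereal (norm (u t))" ?L]
  proof eventually_elim
    case (elim t)
    then have "ereal (norm (u t)) \<le> ereal M" using M by (rule order_trans)
    then show ?case by simp
  qed
  then show "\<exists>M\<ge>0. AE t in ?L. norm (u t) \<le> M" by (intro exI[of _ "max 0 M"]) auto
next
  let ?L = "lebesgue_on {0..T}"
  assume u: "u \<in> borel_measurable ?L \<and> (\<exists>M\<ge>0. AE t in ?L. norm (u t) \<le> M)"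
  then have [measurable]: "u \<in> borel_measurable ?L" by simp
  obtain M where "AE t in ?L. norm (u t) \<le> M" using u by blast
  then have "esssup ?L (\<lambda>t. ereal (norm (u t))) \<le> ereal M" by (intro esssup_I) auto
  then have "esssup ?L (\<lambda>t. ereal (norm (u t))) < \<infinity>"
    by (rule order.strict_trans1) simp
  then show "u \<in> Lp_space \<infinity> T" by (simp add: Lp_space_def)
qed

lemma lebesgue_on_Icc_nonnull: "0 < T \<Longrightarrow> emeasure (lebesgue_on {0..T}) (space (lebesgue_on {0..T::real})) \<noteq> 0"
  by (simp add: emeasure_restrict_space)

text \<open>Positivity of \<open>T\<close> makes the interval non-null, so the constant 0 has
  essential supremum 0 and monotonicity applies. For a function that is not measurable the essential
  supremum is \<infinity> by convention.\<close>

lemma esssup_norm_nonneg: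
  fixes u :: "real \<Rightarrow> 'a::euclidean_space"
  assumes "0 < T"
  shows "0 \<le> esssup (lebesgue_on {0..T}) (\<lambda>t. ereal (norm (u t)))"
proof (cases "(\<lambda>t. ereal (norm (u t))) \<in> borel_measurable (lebesgue_on {0..T})")
  case True
  have "esssup (lebesgue_on {0..T}) (\<lambda>t. 0::ereal) \<le> esssup (lebesgue_on {0..T}) (\<lambda>t. ereal (norm (u t)))"
    by (intro esssup_mono) auto
  then show ?thesis using esssup_const[OF lebesgue_on_Icc_nonnull[OF assms], of "0::ereal"] by simp
qed (simp add: esssup_non_measurable top_ereal_def)

lemma Lp_norm_nonneg: "0 < T \<Longrightarrow> 0 \<le> Lp_norm q T u"
  using esssup_norm_nonneg[of T u] by (auto simp: Lp_norm_def real_of_ereal_pos)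

lemma AE_norm_le_Lp_norm_infinity:
  fixes u :: "real \<Rightarrow> 'a::euclidean_space"
  assumes "0 < T" "u \<in> Lp_space \<infinity> T"
  shows "AE t in lebesgue_on {0..T}. norm (u t) \<le> Lp_norm \<infinity> T u"
proof -
  let ?e = "esssup (lebesgue_on {0..T}) (\<lambda>t. ereal (norm (u t)))"
  have "?e < \<infinity>" using assms(2) by (simp add: Lp_space_def)
  with esssup_norm_nonneg[OF assms(1), of u] have "?e = ereal (Lp_norm \<infinity> T u)"
    by (cases ?e) (auto simp: Lp_norm_def)
  with esssup_AE[of "\<lambda>t. ereal (norm (u t))" "lebesgue_on {0..T}"] show ?thesis by simp
qed

lemma Lp_norm_infinity_le:
  fixes u :: "real \<Rightarrow> 'a::euclidean_space"
  assumes "0 < T" "u \<in> borel_measurable (lebesgue_on {0..T})" "AE t in lebesgue_on {0..T}. norm (u t) \<le> M"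
  shows "Lp_norm \<infinity> T u \<le> M"
proof -
  let ?e = "esssup (lebesgue_on {0..T}) (\<lambda>t. ereal (norm (u t)))"
  have "?e \<le> ereal M" using assms by (intro esssup_I) auto
  with esssup_norm_nonneg[OF assms(1), of u] show ?thesis
    by (cases ?e) (auto simp: Lp_norm_def)
qed

text \<open>Norm bounds are exchanged for bounds on the integral of the power, so that the outer
  root never has to be estimated.\<close>

lemma Lp_norm_ereal_le_iff:
  assumes "1 \<le> r" "0 \<le> \<rho>"
  shows "Lp_norm (ereal r) T u \<le> \<rho> \<longleftrightarrow> (LINT t|lebesgue_on {0..T}. norm (u t) powr r) \<le> \<rho> powr r"
    (is "_ \<longleftrightarrow> ?I \<le> _")
proof -
  have "0 \<le> ?I" by (intro integral_nonneg_AE) auto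
  moreover have "?I powr (1 / r) \<le> \<rho> \<longleftrightarrow> ?I \<le> \<rho> powr r"
  proof
    assume "?I powr (1 / r) \<le> \<rho>"
    then have "(?I powr (1 / r)) powr r \<le> \<rho> powr r" using assms by (intro powr_mono2) auto
    then show "?I \<le> \<rho> powr r" using assms \<open>0 \<le> ?I\<close> by (simp add: powr_powr)
  next
    assume "?I \<le> \<rho> powr r"
    then have "?I powr (1 / r) \<le> (\<rho> powr r) powr (1 / r)" using assms \<open>0 \<le> ?I\<close> by (intro powr_mono2) auto
    then show "?I powr (1 / r) \<le> \<rho>" using assms by (simp add: powr_powr)
  qed
  ultimately show ?thesis by (simp add: Lp_norm_def)
qed

text \<open>The sum is at most twice the larger term. The crude factor serves all exponents
  \<open>r \<ge> 0\<close> at once.\<close>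

lemma powr_add_le:
  fixes a b r :: real
  assumes "0 \<le> a" "0 \<le> b" "0 \<le> r"
  shows "(a + b) powr r \<le> 2 powr r * (a powr r + b powr r)"
proof -
  have "(a + b) powr r \<le> (2 * max a b) powr r" using assms by (intro powr_mono2) auto
  also have "\<dots> = 2 powr r * max a b powr r" by (rule powr_mult)
  also have "\<dots> \<le> 2 powr r * (a powr r + b powr r)" by (intro mult_left_mono) (auto simp: max_def)
  finally show ?thesis .
qed

text \<open>Sums, differences, multiples, norms and envelopes are all dominated by a multiple of the
  sum of two norms, so membership in L^q is always deduced from this one criterion. The three
  functions may take values in different spaces, as envelopes are real-valued.\<close>

lemma Lp_space_bound:
  fixes u :: "real \<Rightarrow> 'a::euclidean_space" and v :: "real \<Rightarrow> 'b::euclidean_space"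
    and w :: "real \<Rightarrow> 'c::euclidean_space"
  assumes q: "1 \<le> q" and u: "u \<in> Lp_space q T" and v: "v \<in> Lp_space q T"
    and w: "w \<in> borel_measurable (lebesgue_on {0..T})" and "0 \<le> c"
    and le: "AE t in lebesgue_on {0..T}. norm (w t) \<le> c * (norm (u t) + norm (v t))"
  shows "w \<in> Lp_space q T"
  using q
proof (cases rule: exponent_cases)
  case (fin r)
  have "AE t in lebesgue_on {0..T}. norm (w t) powr r \<le>
    (c powr r * 2 powr r) * (norm (u t) powr r + norm (v t) powr r)"
    using le
  proof eventually_elim
    case (elim t)
    have "norm (w t) powr r \<le> (c * (norm (u t) + norm (v t))) powr r"
      using elim fin by (intro powr_mono2) auto
    also have "\<dots> = c powr r * (norm (u t) + norm (v t)) powr r"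
      by (rule powr_mult)
    also have "\<dots> \<le> c powr r * (2 powr r * (norm (u t) powr r + norm (v t) powr r))"
      using fin by (intro mult_left_mono powr_add_le) auto
    finally show ?case by (simp add: mult.assoc)
  qed
  then have ae: "AE t in lebesgue_on {0..T}. norm (norm (w t) powr r) \<le>
    norm ((c powr r * 2 powr r) * (norm (u t) powr r + norm (v t) powr r))"
    by (auto elim!: eventually_mono)
  have int: "integrable (lebesgue_on {0..T}) (\<lambda>t. (c powr r * 2 powr r) * (norm (u t) powr r + norm (v t) powr r))"
    using u v fin by (auto simp: Lp_space_ereal_iff)
  have "(\<lambda>t. norm (w t) powr r) \<in> borel_measurable (lebesgue_on {0..T})"
    using w by measurable
  from int this ae have "integrable (lebesgue_on {0..T}) (\<lambda>t. norm (w t) powr r)"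
    by (rule Bochner_Integration.integrable_bound)
  then show ?thesis using w fin by (simp add: Lp_space_ereal_iff)
next
  case inf
  obtain M N where *: "0 \<le> M" "AE t in lebesgue_on {0..T}. norm (u t) \<le> M"
    "0 \<le> N" "AE t in lebesgue_on {0..T}. norm (v t) \<le> N"
    using u v inf by (auto simp: Lp_space_infinity_iff)
  have "AE t in lebesgue_on {0..T}. norm (w t) \<le> c * (M + N)"
    using le *(2,4)
  proof eventually_elim
    case (elim t)
    then have "c * (norm (u t) + norm (v t)) \<le> c * (M + N)" using \<open>0 \<le> c\<close> by (intro mult_left_mono) auto
    with elim show ?case by simp
  qed
  then show ?thesis using * w inf \<open>0 \<le> c\<close>
    by (auto simp: Lp_space_infinity_iff intro!: exI[of _ "c * (M + N)"])
qed

text \<open>A quantitative companion that stands in for the triangle inequality. The factor 4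
  instead of 2 comes from the elementary bound for powers of sums; only linearity in
  \<open>\<delta>\<close> matters later.\<close>

lemma Lp_norm_bound:
  fixes u :: "real \<Rightarrow> 'a::euclidean_space" and v :: "real \<Rightarrow> 'b::euclidean_space"
    and w :: "real \<Rightarrow> 'c::euclidean_space"
  assumes q: "1 \<le> q" and "0 < T" and u: "u \<in> Lp_space q T" and v: "v \<in> Lp_space q T"
    and w: "w \<in> borel_measurable (lebesgue_on {0..T})" and "0 \<le> c" "0 \<le> \<delta>"
    and le: "AE t in lebesgue_on {0..T}. norm (w t) \<le> c * (norm (u t) + norm (v t))"
    and small: "Lp_norm q T u \<le> \<delta>" "Lp_norm q T v \<le> \<delta>"
  shows "Lp_norm q T w \<le> 4 * c * \<delta>"
  using q
proof (cases rule: exponent_cases)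
  case (fin r)
  have wL: "w \<in> Lp_space q T" using q u v w \<open>0 \<le> c\<close> le by (rule Lp_space_bound)
  have "AE t in lebesgue_on {0..T}. norm (w t) powr r \<le>
    (2 * c) powr r * (norm (u t) powr r + norm (v t) powr r)"
    using le
  proof eventually_elim
    case (elim t)
    have "norm (w t) powr r \<le> (c * (norm (u t) + norm (v t))) powr r"
      using elim fin by (intro powr_mono2) auto
    also have "\<dots> = c powr r * (norm (u t) + norm (v t)) powr r"
      by (rule powr_mult)
    also have "\<dots> \<le> c powr r * (2 powr r * (norm (u t) powr r + norm (v t) powr r))"
      using fin by (intro mult_left_mono powr_add_le) auto
    finally show ?case using \<open>0 \<le> c\<close> by (simp add: powr_mult mult_ac)
  qed
  moreover have "integrable (lebesgue_on {0..T}) (\<lambda>t. norm (w t) powr r)"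
    using wL fin by (simp add: Lp_space_ereal_iff)
  moreover have "integrable (lebesgue_on {0..T}) (\<lambda>t. norm (u t) powr r)"
    "integrable (lebesgue_on {0..T}) (\<lambda>t. norm (v t) powr r)"
    using u v fin by (auto simp: Lp_space_ereal_iff)
  ultimately have "(LINT t|lebesgue_on {0..T}. norm (w t) powr r) \<le>
    (LINT t|lebesgue_on {0..T}. (2 * c) powr r * (norm (u t) powr r + norm (v t) powr r))"
    by (intro integral_mono_AE) auto
  also have "\<dots> = (2 * c) powr r * ((LINT t|lebesgue_on {0..T}. norm (u t) powr r)
      + (LINT t|lebesgue_on {0..T}. norm (v t) powr r))"
    using u v fin by (simp add: Lp_space_ereal_iff)
  also have "\<dots> \<le> (2 * c) powr r * (\<delta> powr r + \<delta> powr r)"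
    using small fin \<open>0 \<le> \<delta>\<close> by (intro mult_left_mono add_mono) (auto simp: Lp_norm_ereal_le_iff)
  also have "\<dots> \<le> (2 * c) powr r * ((2 * \<delta>) powr r)"
  proof (intro mult_left_mono)
    have "2 powr 1 \<le> 2 powr r" using fin by (intro powr_mono) auto
    then have "2 * \<delta> powr r \<le> 2 powr r * \<delta> powr r" by (intro mult_right_mono) auto
    then show "\<delta> powr r + \<delta> powr r \<le> (2 * \<delta>) powr r" using \<open>0 \<le> \<delta>\<close> by (simp add: powr_mult)
  qed auto
  also have "\<dots> = (4 * c * \<delta>) powr r"
    by (simp flip: powr_mult) (simp add: mult.assoc)
  finally show ?thesis using fin \<open>0 \<le> \<delta>\<close> \<open>0 \<le> c\<close> by (simp add: Lp_norm_ereal_le_iff)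
next
  case inf
  have "AE t in lebesgue_on {0..T}. norm (w t) \<le> 4 * c * \<delta>"
    using le AE_norm_le_Lp_norm_infinity[OF \<open>0 < T\<close> u[unfolded inf]]
      AE_norm_le_Lp_norm_infinity[OF \<open>0 < T\<close> v[unfolded inf]]
  proof eventually_elim
    case (elim t)
    then have "c * (norm (u t) + norm (v t)) \<le> c * (\<delta> + \<delta>)"
      using \<open>0 \<le> c\<close> small inf by (intro mult_left_mono) auto
    also have "\<dots> \<le> 4 * c * \<delta>" using \<open>0 \<le> c\<close> \<open>0 \<le> \<delta>\<close> by (simp add: mult_nonneg_nonneg algebra_simps)
    finally show ?case using elim by simp
  qed
  then show ?thesis using \<open>0 < T\<close> w inf by (auto intro!: Lp_norm_infinity_le)
qed

section \<open>Comparison of L^q with L^1 and with pointwise convergence\<close>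

lemma powr_le_one_plus_powr:
  fixes a s r :: real
  assumes "0 \<le> a" "0 \<le> s" "s \<le> r"
  shows "a powr s \<le> 1 + a powr r"
proof (cases "a \<le> 1")
  case True
  then have "a powr s \<le> 1" using assms powr_mono2[of s a 1] by simp
  then show ?thesis by (simp add: add_increasing2)
next
  case False
  then have "a powr s \<le> a powr r" using assms by (intro powr_mono) auto
  then show ?thesis by simp
qed

lemma Lp_space_imp_integrable:
  fixes u :: "real \<Rightarrow> 'a::euclidean_space"
  assumes "1 \<le> q" "u \<in> Lp_space q T"
  shows "integrable (lebesgue_on {0..T}) u"
  using assms(1)
proof (cases rule: exponent_cases)
  case (fin r)
  have "integrable (lebesgue_on {0..T}) (\<lambda>t. 1 + norm (u t) powr r)"
    using assms(2) fin by (auto simp: Lp_space_ereal_iff)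
  then show ?thesis
  proof (rule Bochner_Integration.integrable_bound)
    have "norm (u t) \<le> norm (1 + norm (u t) powr r)" for t
      using powr_le_one_plus_powr[of "norm (u t)" 1 r] fin by simp
    then show "AE t in lebesgue_on {0..T}. norm (u t) \<le> norm (1 + norm (u t) powr r)" by simp
  qed (use assms(2) in measurable)
next
  case inf
  then obtain M where "AE t in lebesgue_on {0..T}. norm (u t) \<le> M"
    using assms(2) by (auto simp: Lp_space_infinity_iff)
  then have ae: "AE t in lebesgue_on {0..T}. norm (u t) \<le> norm M" by (auto elim!: eventually_mono)
  have "integrable (lebesgue_on {0..T}) (\<lambda>_. M)" "u \<in> borel_measurable (lebesgue_on {0..T})"
    using assms(2) by auto
  from this ae show ?thesis by (rule Bochner_Integration.integrable_bound)
qed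

text \<open>Where the norm of \<open>u t\<close> is at most \<open>\<rho>\<close> the integrand is
  bounded by \<open>\<rho>\<close>; elsewhere |u| = |u|^(1-r) |u|^r is at most
  \<open>\<rho>\<close>^(1-r) |u|^r since 1-r \<le> 0. The two parts integrate to at most
  \<open>\<rho> * T\<close> and \<open>\<rho>\<close>. The constant does not depend on the
  exponent.\<close>

lemma integral_norm_le_Lp_norm:
  fixes u :: "real \<Rightarrow> 'a::euclidean_space"
  assumes "1 \<le> q" "0 < T" "u \<in> Lp_space q T" "0 < \<rho>" "Lp_norm q T u \<le> \<rho>"
  shows "(LINT t|lebesgue_on {0..T}. norm (u t)) \<le> \<rho> * (T + 1)"
proof -
  have int: "integrable (lebesgue_on {0..T}) (\<lambda>t. norm (u t))"
    using Lp_space_imp_integrable[OF assms(1,3)] by simp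
  show ?thesis
    using assms(1)
  proof (cases rule: exponent_cases)
    case (fin r)
    have ir: "integrable (lebesgue_on {0..T}) (\<lambda>t. norm (u t) powr r)"
      using assms fin by (auto simp: Lp_space_ereal_iff)
    have "norm (u t) \<le> \<rho> + \<rho> powr (1 - r) * norm (u t) powr r" for t
    proof (cases "norm (u t) \<le> \<rho>")
      case False
      then have "norm (u t) powr (1 - r) \<le> \<rho> powr (1 - r)"
        using fin \<open>0 < \<rho>\<close> by (intro powr_mono2') auto
      then have "norm (u t) powr (1 - r) * norm (u t) powr r \<le> \<rho> powr (1 - r) * norm (u t) powr r"
        by (intro mult_right_mono) auto
      then show ?thesis using \<open>0 < \<rho>\<close> False by (simp flip: powr_add)
    qed (auto intro: add_increasing2)
    then have "(LINT t|lebesgue_on {0..T}. norm (u t)) \<le>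
      (LINT t|lebesgue_on {0..T}. \<rho> + \<rho> powr (1 - r) * norm (u t) powr r)"
      using int ir by (intro integral_mono) auto
    also have "\<dots> = \<rho> * T + \<rho> powr (1 - r) * (LINT t|lebesgue_on {0..T}. norm (u t) powr r)"
      using ir \<open>0 < T\<close> by (simp add: measure_restrict_space)
    also have "\<dots> \<le> \<rho> * T + \<rho> powr (1 - r) * \<rho> powr r"
      using assms fin by (intro add_left_mono mult_left_mono) (auto simp: Lp_norm_ereal_le_iff)
    also have "\<dots> = \<rho> * (T + 1)" using \<open>0 < \<rho>\<close> by (simp add: algebra_simps flip: powr_add)
    finally show ?thesis .
  next
    case inf
    have "(LINT t|lebesgue_on {0..T}. norm (u t)) \<le> (LINT t|lebesgue_on {0..T}. \<rho>)"
      using int AE_norm_le_Lp_norm_infinity[OF assms(2) assms(3)[unfolded inf]] assms(5) inf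
      by (intro integral_mono_AE) auto
    also have "\<dots> \<le> \<rho> * (T + 1)"
      using \<open>0 < T\<close> \<open>0 < \<rho>\<close> by (simp add: measure_restrict_space algebra_simps)
    finally show ?thesis .
  qed
qed

text \<open>The argument behind the completeness of L^q. For finite exponent r the series of r-th
  powers has a finite integral, hence converges almost everywhere: its terms tend to 0, and the r-th
  root of its sum dominates each of them. For q = \<infinity> the constant 1 dominates.\<close>

lemma Lp_space_fast_convergence:
  fixes d :: "nat \<Rightarrow> real \<Rightarrow> 'a::euclidean_space"
  assumes q: "1 \<le> q" and T: "0 < T" and d: "\<And>n. d n \<in> Lp_space q T"
    and small: "\<And>n. Lp_norm q T (d n) \<le> (1 / 2) ^ n"
  obtains S :: "real \<Rightarrow> real" where "S \<in> Lp_space q T" "\<forall>t. 0 \<le> S t"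
    "AE t in lebesgue_on {0..T}. (\<forall>n. norm (d n t) \<le> S t) \<and> (\<lambda>n. d n t) \<longlonglongrightarrow> 0"
  using q
proof (cases rule: exponent_cases)
  case (fin r)
  let ?L = "lebesgue_on {0..T}"
  have [measurable]: "d n \<in> borel_measurable ?L" for n using d by (rule Lp_space_measurable)
  have int: "integrable ?L (\<lambda>t. norm (d n t) powr r)" for n
    using d[of n] fin by (simp add: Lp_space_ereal_iff)
  define Z where "Z t = (\<Sum>n. ennreal (norm (d n t) powr r))" for t
  have [measurable]: "Z \<in> borel_measurable ?L" unfolding Z_def by measurable
  have "(\<integral>\<^sup>+t. Z t \<partial>?L) = (\<Sum>n. \<integral>\<^sup>+t. ennreal (norm (d n t) powr r) \<partial>?L)"
    unfolding Z_def by (rule nn_integral_suminf) measurable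
  also have "\<dots> = (\<Sum>n. ennreal (LINT t|?L. norm (d n t) powr r))"
    using int by (intro suminf_cong nn_integral_eq_integral) auto
  also have "\<dots> \<le> (\<Sum>n. ennreal ((1 / 2) ^ n))"
  proof (intro suminf_le ennreal_leI)
    fix n
    have "(LINT t|?L. norm (d n t) powr r) \<le> ((1 / 2) ^ n) powr r"
      using small[of n] fin by (simp add: Lp_norm_ereal_le_iff)
    also have "\<dots> \<le> ((1 / 2) ^ n) powr 1"
      using fin by (intro powr_mono') (auto simp: power_le_one)
    finally show "(LINT t|?L. norm (d n t) powr r) \<le> (1 / 2) ^ n" by simp
  qed auto
  also have "\<dots> = ennreal (\<Sum>n. (1 / 2) ^ n)"
    by (intro suminf_ennreal2) (auto intro: summable_geometric)
  finally have Zint: "(\<integral>\<^sup>+t. Z t \<partial>?L) < \<infinity>"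
    by (rule order.strict_trans1) simp
  then have Zfin: "AE t in ?L. Z t \<noteq> \<infinity>"
    by (intro nn_integral_PInf_AE) auto
  \<comment> \<open>Where the series diverges, \<open>enn2real\<close> returns 0 and
    \<open>S\<close> dominates nothing; this happens only on a null set.\<close>
  define S where "S t = enn2real (Z t) powr (1 / r)" for t
  have S0: "\<forall>t. 0 \<le> S t" by (simp add: S_def)
  have Sr: "\<bar>S t\<bar> powr r = enn2real (Z t)" for t
    using fin by (simp add: S_def powr_powr)
  have "integrable ?L (\<lambda>t. enn2real (Z t))"
  proof (rule integrableI_bounded)
    have "(\<integral>\<^sup>+t. ennreal (norm (enn2real (Z t))) \<partial>?L) = (\<integral>\<^sup>+t. Z t \<partial>?L)"
    proof (rule nn_integral_cong_AE)
      show "AE t in ?L. ennreal (norm (enn2real (Z t))) = Z t"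
        using Zfin by eventually_elim (auto simp: ennreal_enn2real_if)
    qed
    then show "(\<integral>\<^sup>+t. ennreal (norm (enn2real (Z t))) \<partial>?L) < \<infinity>" using Zint by simp
  qed measurable
  moreover have "S \<in> borel_measurable ?L" unfolding S_def by measurable
  ultimately have SL: "S \<in> Lp_space q T" using fin by (simp add: Lp_space_ereal_iff Sr)
  have "AE t in ?L. (\<forall>n. norm (d n t) \<le> S t) \<and> (\<lambda>n. d n t) \<longlonglongrightarrow> 0"
    using Zfin
  proof eventually_elim
    case (elim t)
    have sm: "summable (\<lambda>n. norm (d n t) powr r)"
      using elim by (intro summable_suminf_not_top) (auto simp: Z_def)
    then have Z: "enn2real (Z t) = (\<Sum>n. norm (d n t) powr r)"
      unfolding Z_def by (subst suminf_ennreal2) (auto intro!: enn2real_ennreal suminf_nonneg)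
    have root: "(norm (d n t) powr r) powr (1 / r) = norm (d n t)" for n
      using fin by (simp add: powr_powr)
    have "norm (d n t) \<le> S t" for n
    proof -
      have "norm (d n t) powr r = (\<Sum>i\<in>{n}. norm (d i t) powr r)" by simp
      also have "\<dots> \<le> enn2real (Z t)" unfolding Z using sm by (intro sum_le_suminf) auto
      finally have "(norm (d n t) powr r) powr (1 / r) \<le> enn2real (Z t) powr (1 / r)"
        using fin by (intro powr_mono2) auto
      then show ?thesis by (simp add: root S_def)
    qed
    moreover have "(\<lambda>n. (norm (d n t) powr r) powr (1 / r)) \<longlonglongrightarrow> 0 powr (1 / r)"
      using summable_LIMSEQ_zero[OF sm] fin
      by (intro tendsto_powr2) auto
    then have "(\<lambda>n. norm (d n t)) \<longlonglongrightarrow> 0" by (simp add: root)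
    ultimately show ?case by (simp add: tendsto_norm_zero_iff)
  qed
  with SL S0 show ?thesis by (rule that)
next
  case inf
  let ?L = "lebesgue_on {0..T}"
  have "AE t in ?L. norm (d n t) \<le> (1 / 2) ^ n" for n
    using AE_norm_le_Lp_norm_infinity[OF T d[of n, unfolded inf]] small[of n] inf
    by (auto elim!: eventually_mono)
  then have "AE t in ?L. \<forall>n. norm (d n t) \<le> (1 / 2) ^ n" by (simp add: AE_all_countable)
  then have "AE t in ?L. (\<forall>n. norm (d n t) \<le> 1) \<and> (\<lambda>n. d n t) \<longlonglongrightarrow> 0"
  proof eventually_elim
    case (elim t)
    have "norm (d n t) \<le> 1" for n
    proof -
      have "(1 / 2 :: real) ^ n \<le> 1" by (intro power_le_one) auto
      then show ?thesis using elim by (meson order_trans)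
    qed
    moreover have "(\<lambda>n. d n t) \<longlonglongrightarrow> 0"
    proof (rule Lim_null_comparison)
      show "\<forall>\<^sub>F n in sequentially. norm (d n t) \<le> (1 / 2) ^ n" using elim by simp
    qed (auto intro: LIMSEQ_power_zero)
    ultimately show ?case by blast
  qed
  moreover have "(\<lambda>_. 1::real) \<in> Lp_space q T" using inf by (auto simp: Lp_space_infinity_iff intro!: exI[of _ 1])
  ultimately show ?thesis by (intro that[of "\<lambda>_. 1"]) auto
qed

text \<open>
  Dominated convergence in \<open>\<epsilon>\<close>-\<open>\<delta>\<close> form: quantities \<open>r\<close> depending on a control \<open>u\<close> (and on further
  data constrained to within \<open>\<rho>\<close> of a reference) are small in mean, uniformly in \<open>u\<close>, once \<open>u\<close> is close
  to \<open>u\<^sub>0\<close> in the \<open>q\<close>-norm.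
\<close>

lemma Lp_uniformly_small:
  fixes u0 :: "real \<Rightarrow> 'a::euclidean_space"
    and P :: "real \<Rightarrow> (real \<Rightarrow> 'a) \<Rightarrow> (real \<Rightarrow> real) \<Rightarrow> bool"
  assumes q: "1 \<le> q" and T: "0 < T" and u0: "u0 \<in> Lp_space q T" and \<delta>: "0 < (\<delta>::real)"
    and P: "\<And>\<rho> u r. P \<rho> u r \<Longrightarrow> 0 < \<rho> \<and> u \<in> Lp_space q T \<and> Lp_norm q T (\<lambda>t. u t - u0 t) \<le> \<rho> \<and>
      r \<in> borel_measurable (lebesgue_on {0..T})"
    and dom: "\<And>W :: real \<Rightarrow> real. W \<in> Lp_space q T \<Longrightarrow> \<exists>\<omega>. integrable (lebesgue_on {0..T}) \<omega> \<and>
      (\<forall>\<rho> u r. P \<rho> u r \<longrightarrow> \<rho> \<le> 1 \<longrightarrow> (AE t in lebesgue_on {0..T}. norm (u t) \<le> W t) \<longrightarrow>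
        (AE t in lebesgue_on {0..T}. \<bar>r t\<bar> \<le> \<omega> t))"
    and lim: "\<And>\<rho> u r. (\<And>n. P (\<rho> n) (u n) (r n)) \<Longrightarrow> \<rho> \<longlonglongrightarrow> 0 \<Longrightarrow>
      (AE t in lebesgue_on {0..T}. (\<lambda>n. u n t) \<longlonglongrightarrow> u0 t) \<Longrightarrow>
      (AE t in lebesgue_on {0..T}. (\<lambda>n. r n t) \<longlonglongrightarrow> 0)"
  shows "\<exists>\<rho>0>0. \<forall>\<rho> u r. \<rho> \<le> \<rho>0 \<longrightarrow> P \<rho> u r \<longrightarrow> integrable (lebesgue_on {0..T}) r \<and>
    (LINT t|lebesgue_on {0..T}. \<bar>r t\<bar>) \<le> \<delta>"
proof (rule ccontr)
  let ?L = "lebesgue_on {0..T}"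
  assume neg: "\<not> ?thesis"
  \<comment> \<open>A single control is its own envelope: with \<open>W\<close> the norm of
    \<open>u\<close>, the domination hypothesis already gives integrability.\<close>
  have integ: "integrable ?L r" if Pr: "P \<rho> u r" "\<rho> \<le> 1" for \<rho> u r
  proof -
    have u: "u \<in> Lp_space q T" and [measurable]: "r \<in> borel_measurable ?L" using P[OF Pr(1)] by auto
    have [measurable]: "u \<in> borel_measurable ?L" using u by (rule Lp_space_measurable)
    have "(\<lambda>t. norm (u t)) \<in> Lp_space q T"
      by (rule Lp_space_bound[OF q u u, of _ 1]) auto
    from dom[OF this] obtain \<omega> where \<omega>: "integrable ?L \<omega>"
      "\<forall>\<rho> u' r. P \<rho> u' r \<longrightarrow> \<rho> \<le> 1 \<longrightarrow> (AE t in ?L. norm (u' t) \<le> norm (u t)) \<longrightarrow> (AE t in ?L. \<bar>r t\<bar> \<le> \<omega> t)"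
      by auto
    have \<omega>2: "AE t in ?L. \<bar>r t\<bar> \<le> \<omega> t"
      using \<omega>(2)[THEN spec, THEN spec, THEN spec, THEN mp, OF Pr(1)] Pr(2) by simp
    have "AE t in ?L. norm (r t) \<le> norm (\<omega> t)" using \<omega>2 by (auto elim!: eventually_mono)
    with \<omega>(1) _ show ?thesis by (rule Bochner_Integration.integrable_bound) measurable
  qed
  \<comment> \<open>Failure at every radius (1/2)^n produces controls approaching \<open>u0\<close>
    geometrically. The geometric rate is what provides a common envelope in L^q and pointwise
    convergence without passing to a subsequence.\<close>
  have "\<exists>\<rho> u r. \<rho> \<le> (1 / 2) ^ n \<and> P \<rho> u r \<and> \<delta> < (LINT t|?L. \<bar>r t\<bar>)" for n
  proof -
    have "(0::real) < (1 / 2) ^ n" by simp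
    then obtain \<rho> u r where *: "\<rho> \<le> (1 / 2) ^ n" "P \<rho> u r"
      "\<not> (integrable ?L r \<and> (LINT t|?L. \<bar>r t\<bar>) \<le> \<delta>)"
      using neg by blast
    moreover have "(1 / 2 :: real) ^ n \<le> 1" by (intro power_le_one) auto
    ultimately show ?thesis using integ[of \<rho> u r] by (intro exI[of _ \<rho>] exI[of _ u] exI[of _ r]) auto
  qed
  then obtain \<rho> u r where *: "\<And>n. \<rho> n \<le> (1 / 2) ^ n" "\<And>n. P (\<rho> n) (u n) (r n)"
    "\<And>n::nat. \<delta> < (LINT t|?L. \<bar>r n t\<bar>)"
    by metis
  have uL: "u n \<in> Lp_space q T" for n using P[OF *(2)[of n]] by simp
  have [measurable]: "r n \<in> borel_measurable ?L" for n using P[OF *(2)[of n]] by simp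
  have [measurable]: "u n \<in> borel_measurable ?L" for n using uL by (rule Lp_space_measurable)
  have [measurable]: "u0 \<in> borel_measurable ?L" using u0 by (rule Lp_space_measurable)
  have dL: "(\<lambda>t. u n t - u0 t) \<in> Lp_space q T" for n
    by (rule Lp_space_bound[OF q uL[of n] u0, of _ 1]) (auto simp: norm_triangle_ineq4)
  have dn: "Lp_norm q T (\<lambda>t. u n t - u0 t) \<le> (1 / 2) ^ n" for n
    using P[OF *(2)[of n]] *(1)[of n] by linarith
  obtain S where S: "S \<in> Lp_space q T" "\<forall>t. 0 \<le> S t"
    "AE t in ?L. (\<forall>n. norm (u n t - u0 t) \<le> S t) \<and> (\<lambda>n. u n t - u0 t) \<longlonglongrightarrow> 0"
    by (rule Lp_space_fast_convergence[OF q T dL dn])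
  have [measurable]: "S \<in> borel_measurable ?L" using S(1) by (rule Lp_space_measurable)
  define W where "W t = norm (u0 t) + S t" for t
  have "W \<in> Lp_space q T"
    by (rule Lp_space_bound[OF q u0 S(1), of _ 1]) (auto simp: W_def[abs_def] S(2))
  from dom[OF this] obtain \<omega> where \<omega>: "integrable ?L \<omega>"
    "\<forall>\<rho> u r. P \<rho> u r \<longrightarrow> \<rho> \<le> 1 \<longrightarrow> (AE t in ?L. norm (u t) \<le> W t) \<longrightarrow> (AE t in ?L. \<bar>r t\<bar> \<le> \<omega> t)"
    by auto
  have rdom: "AE t in ?L. \<bar>r n t\<bar> \<le> \<omega> t" for n
  proof (rule \<omega>(2)[rule_format, OF *(2)])
    have "(1 / 2 :: real) ^ n \<le> 1" by (intro power_le_one) auto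
    then show "\<rho> n \<le> 1" using *(1)[of n] by simp
    show "AE t in ?L. norm (u n t) \<le> W t"
      using S(3)
    proof eventually_elim
      case (elim t)
      have "norm (u n t) \<le> norm (u0 t) + norm (u n t - u0 t)"
        by (metis add.commute diff_add_cancel norm_triangle_ineq)
      also have "\<dots> \<le> W t" using elim by (simp add: W_def)
      finally show ?case .
    qed
  qed
  have "\<rho> \<longlonglongrightarrow> 0"
  proof (rule tendsto_sandwich[of "\<lambda>_. 0" \<rho> _ "\<lambda>n. (1 / 2) ^ n"])
    show "\<forall>\<^sub>F n in sequentially. 0 \<le> \<rho> n" using P *(2) by (auto intro!: always_eventually less_imp_le)
  qed (use *(1) in \<open>auto intro: LIMSEQ_power_zero\<close>)
  moreover have "AE t in ?L. (\<lambda>n. u n t) \<longlonglongrightarrow> u0 t"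
    using S(3) by eventually_elim (simp add: LIM_zero_cancel)
  ultimately have "AE t in ?L. (\<lambda>n. r n t) \<longlonglongrightarrow> 0" by (rule lim[OF *(2)])
  then have "(\<lambda>n. LINT t|?L. \<bar>r n t\<bar>) \<longlonglongrightarrow> (LINT t|?L. 0)"
    using \<omega>(1) rdom
    by (intro integral_dominated_convergence[where w = \<omega>])
      (auto simp: tendsto_rabs_zero elim!: eventually_mono)
  then have "\<forall>\<^sub>F n in sequentially. (LINT t|?L. \<bar>r n t\<bar>) < \<delta>"
    using \<delta> by (intro order_tendstoD(2)) auto
  then obtain n where "(LINT t|?L. \<bar>r n t\<bar>) < \<delta>" by (auto simp: eventually_sequentially)
  with *(3)[of n] show False by simp
qed

section \<open>Superposition operators\<close>

lemma continuous_data_measurable: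
  fixes G :: "real^'d \<Rightarrow> real^'m \<Rightarrow> real \<Rightarrow> 'k::euclidean_space"
  assumes G: "continuous_data T G" and T: "0 \<le> T"
    and x: "x \<in> borel_measurable (lebesgue_on {0..T})" and u: "u \<in> borel_measurable (lebesgue_on {0..T})"
  shows "(\<lambda>t. G (x t) (u t) t) \<in> borel_measurable (lebesgue_on {0..T})"
proof -
  \<comment> \<open>\<open>G\<close> is continuous only for times in the interval. Clamping the time
    extends it continuously to all arguments, so that it becomes a Borel function that can be
    composed with \<open>x\<close> and \<open>u\<close>.\<close>
  define c where "c t = max 0 (min T t)" for t
  have c: "c t \<in> {0..T}" "t \<in> {0..T} \<Longrightarrow> c t = t" for t using T by (auto simp: c_def)
  have c': "continuous_on UNIV (\<lambda>z::(real^'d) \<times> (real^'m) \<times> real. (fst z, fst (snd z), c (snd (snd z))))"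
    unfolding c_def by (intro continuous_intros)
  have "range (\<lambda>z::(real^'d) \<times> (real^'m) \<times> real. (fst z, fst (snd z), c (snd (snd z)))) \<subseteq> UNIV \<times> UNIV \<times> {0..T}"
    using c(1) by auto
  from continuous_on_compose2[OF G[unfolded continuous_data_def] c' this]
  have "continuous_on UNIV (\<lambda>z. G (fst z) (fst (snd z)) (c (snd (snd z))))"
    by (simp add: case_prod_beta)
  then have m: "(\<lambda>z. G (fst z) (fst (snd z)) (c (snd (snd z)))) \<in> borel_measurable borel"
    by (rule borel_measurable_continuous_onI)
  have "(\<lambda>t. t) \<in> borel_measurable (lebesgue_on {0..T})"
    by (intro continuous_imp_measurable_on_sets_lebesgue continuous_on_id) auto
  then have "(\<lambda>t. (x t, u t, t)) \<in> borel_measurable (lebesgue_on {0..T})"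
    using x u by (intro borel_measurable_Pair)
  from measurable_compose[OF this m]
  have "(\<lambda>t. G (x t) (u t) (c t)) \<in> borel_measurable (lebesgue_on {0..T})" by simp
  then show ?thesis
    by (rule measurable_cong[THEN iffD1, rotated]) (use c in auto)
qed

lemma continuous_data_at:
  assumes "continuous_data T G" "t \<in> {0..T}" "0 < (e::real)"
  obtains d where "0 < d"
    "\<forall>x u. norm (x - x0) \<le> d \<longrightarrow> norm (u - u0) \<le> d \<longrightarrow> dist (G x u t) (G x0 u0 t) \<le> e"
proof -
  have "continuous_on (UNIV \<times> UNIV) (\<lambda>z. (fst z, snd z, t))" by (intro continuous_intros)
  moreover have "(\<lambda>z. (fst z, snd z, t)) ` (UNIV \<times> UNIV) \<subseteq> UNIV \<times> UNIV \<times> {0..T}"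
    using assms(2) by auto
  ultimately have "continuous_on (UNIV \<times> UNIV) (\<lambda>z. G (fst z) (snd z) t)"
    using continuous_on_compose2[OF assms(1)[unfolded continuous_data_def], of "UNIV \<times> UNIV" "\<lambda>z. (fst z, snd z, t)"]
    by (simp add: case_prod_beta)
  then have "\<exists>d>0. \<forall>z. dist z (x0, u0) < d \<longrightarrow> dist (G (fst z) (snd z) t) (G x0 u0 t) < e"
    using assms(3) unfolding continuous_on_iff by fastforce
  then obtain d where d: "0 < d" "\<And>z. dist z (x0, u0) < d \<Longrightarrow> dist (G (fst z) (snd z) t) (G x0 u0 t) < e"
    by blast
  show thesis
  proof (rule that[of "d / 3"], use d(1) in simp, intro allI impI)
    fix x u assume *: "norm (x - x0) \<le> d / 3" "norm (u - u0) \<le> d / 3"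
    have "dist (x, u) (x0, u0) \<le> dist x x0 + dist u u0"
      by (simp add: dist_Pair_Pair sqrt_sum_squares_le_sum)
    also have "\<dots> < d" using * d(1) by (simp add: dist_norm)
    finally show "dist (G x u t) (G x0 u0 t) \<le> e" using d(2)[of "(x, u)"] by simp
  qed
qed

text \<open>The form in which growth conditions enter the estimates: one integrable bound valid
  along a whole envelope \<open>W\<close> of controls, as dominated convergence requires. It also
  makes sense for q = \<infinity>, so that both alternatives of the growth hypothesis are treated
  together.\<close>

definition dominated_data ::
  "ereal \<Rightarrow> real \<Rightarrow> (real^'d \<Rightarrow> real^'m \<Rightarrow> real \<Rightarrow> 'k::real_normed_vector) \<Rightarrow> bool" where
  "dominated_data q T G \<longleftrightarrow> (\<forall>R. \<forall>W::real \<Rightarrow> real. W \<in> Lp_space q T \<longrightarrow>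
    (\<exists>\<omega>. integrable (lebesgue_on {0..T}) \<omega> \<and> (AE t in lebesgue_on {0..T}.
      \<forall>x u. norm x \<le> R \<longrightarrow> norm u \<le> W t \<longrightarrow> norm (G x u t) \<le> \<omega> t)))"

text \<open>The version for the derivative in \<open>u\<close>, which is always multiplied by a control.\<close>

definition dominated_control_data ::
  "ereal \<Rightarrow> real \<Rightarrow> (real^'d \<Rightarrow> real^'m \<Rightarrow> real \<Rightarrow> 'k::real_normed_vector) \<Rightarrow> bool" where
  "dominated_control_data q T G \<longleftrightarrow> (\<forall>R. \<forall>W::real \<Rightarrow> real. W \<in> Lp_space q T \<longrightarrow>
    (\<exists>\<omega>. integrable (lebesgue_on {0..T}) \<omega> \<and> (AE t in lebesgue_on {0..T}.
      \<forall>x u. norm x \<le> R \<longrightarrow> norm u \<le> W t \<longrightarrow> W t * norm (G x u t) \<le> \<omega> t)))"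

text \<open>The mean value inequality for \<open>f\<close> minus the linear map \<open>pr a\<close>.
  The hypothesis bounds the product of the derivative error with the increment rather than the
  derivative error alone, because in the control variable only such products are dominated by an
  integrable function.\<close>

lemma linearization_error_bound:
  fixes f :: "'a::real_normed_vector \<Rightarrow> 'b::real_normed_vector" and D :: "'a \<Rightarrow> 'c::real_normed_vector"
  assumes pr: "bounded_bilinear pr" "\<And>a h. norm (pr a h) \<le> K * norm a * norm h" and "0 \<le> K" "0 \<le> c"
    and der: "\<And>\<xi>. \<xi> \<in> closed_segment x y \<Longrightarrow> (f has_derivative pr (D \<xi>)) (at \<xi>)"
    and bd: "\<And>\<xi>. \<xi> \<in> closed_segment x y \<Longrightarrow> norm (D \<xi> - a) * norm (x - y) \<le> c"
  shows "norm (f x - f y - pr a (x - y)) \<le> K * c"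
proof (cases "x = y")
  case True
  then show ?thesis
    using \<open>0 \<le> K\<close> \<open>0 \<le> c\<close> by (simp add: bounded_bilinear.zero_right[OF pr(1)])
next
  case False
  interpret pr: bounded_bilinear pr by fact
  define g where "g \<xi> = f \<xi> - pr a \<xi>" for \<xi>
  have "norm (g x - g y) \<le> (K * c / norm (x - y)) * norm (x - y)"
  proof (rule differentiable_bound[of "closed_segment x y" _ "\<lambda>\<xi>. pr (D \<xi> - a)"])
    fix \<xi> assume \<xi>: "\<xi> \<in> closed_segment x y"
    have "(g has_derivative (\<lambda>h. pr (D \<xi>) h - pr a h)) (at \<xi>)"
      unfolding g_def using der[OF \<xi>] by (intro has_derivative_diff pr.bounded_linear_right bounded_linear_imp_has_derivative)
    moreover have "pr (D \<xi> - a) = (\<lambda>h. pr (D \<xi>) h - pr a h)" by (simp add: fun_eq_iff pr.diff_left)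
    ultimately show "(g has_derivative pr (D \<xi> - a)) (at \<xi> within closed_segment x y)"
      by (simp only: has_derivative_at_withinI)
    show "onorm (pr (D \<xi> - a)) \<le> K * c / norm (x - y)"
    proof (rule onorm_bound)
      show "0 \<le> K * c / norm (x - y)" using \<open>0 \<le> K\<close> \<open>0 \<le> c\<close> by simp
      fix h :: 'a
      have "norm (D \<xi> - a) \<le> c / norm (x - y)" using bd[OF \<xi>] False by (simp add: pos_le_divide_eq)
      then have "K * norm (D \<xi> - a) * norm h \<le> K * (c / norm (x - y)) * norm h"
        using \<open>0 \<le> K\<close> by (intro mult_right_mono mult_left_mono) auto
      then show "norm (pr (D \<xi> - a) h) \<le> K * c / norm (x - y) * norm h"
        using pr(2)[of "D \<xi> - a" h] by simp
    qed
  qed auto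
  then show ?thesis using False by (simp add: g_def pr.diff_right algebra_simps)
qed

lemma norm_segment_le:
  fixes z :: "'a::real_normed_vector"
  assumes "z \<in> closed_segment x y" "norm (x - a) \<le> r" "norm (y - a) \<le> r"
  shows "norm (z - a) \<le> r"
proof -
  have "closed_segment x y \<subseteq> cball a r"
    using assms by (intro closed_segment_subset) (auto simp: dist_norm norm_minus_commute)
  then show ?thesis using assms(1) by (auto simp: dist_norm norm_minus_commute)
qed

lemma norm_le_of_near:
  fixes x y :: "'a::real_normed_vector"
  assumes "norm (x - y) \<le> r" "norm y \<le> s"
  shows "norm x \<le> s + r"
  using norm_triangle_ineq[of "x - y" y] assms by simp

text \<open>
  The controls \<open>u1\<close>, \<open>u2\<close> vary by multiples of a fixed \<open>V\<close> in \<open>L\<^sup>q\<close> around a control \<open>u\<close> which is only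
  close to the reference \<open>ur\<close> in norm; the bound \<open>\<sigma>\<close> measures the distance of the two pairs.
\<close>

definition control_variation ::
  "ereal \<Rightarrow> real \<Rightarrow> (real \<Rightarrow> real^'d) \<Rightarrow> (real \<Rightarrow> real^'m) \<Rightarrow> (real \<Rightarrow> real) \<Rightarrow> real \<Rightarrow> (real \<Rightarrow> real^'m)
    \<Rightarrow> (real \<Rightarrow> real^'d) \<Rightarrow> (real \<Rightarrow> real^'d) \<Rightarrow> (real \<Rightarrow> real^'m) \<Rightarrow> (real \<Rightarrow> real^'m) \<Rightarrow> real \<Rightarrow> bool" where
  "control_variation q T xr ur V \<rho> u x1 x2 u1 u2 \<sigma> \<longleftrightarrow> 0 < \<rho> \<and> 0 < \<sigma> \<and> u \<in> Lp_space q T \<and>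
    Lp_norm q T (\<lambda>t. u t - ur t) \<le> \<rho> \<and>
    x1 \<in> borel_measurable (lebesgue_on {0..T}) \<and> x2 \<in> borel_measurable (lebesgue_on {0..T}) \<and>
    u1 \<in> borel_measurable (lebesgue_on {0..T}) \<and> u2 \<in> borel_measurable (lebesgue_on {0..T}) \<and>
    (\<forall>t\<in>{0..T}. norm (x1 t - xr t) \<le> \<rho> \<and> norm (x2 t - xr t) \<le> \<rho> \<and>
      norm (u1 t - u t) \<le> \<rho> * V t \<and> norm (u2 t - u t) \<le> \<rho> * V t \<and>
      norm (x1 t - x2 t) \<le> \<sigma> \<and> norm (u1 t - u2 t) \<le> \<sigma> * V t)"

lemma control_variationI:
  assumes "0 < \<rho>" "0 < \<sigma>" "u \<in> Lp_space q T" "Lp_norm q T (\<lambda>t. u t - ur t) \<le> \<rho>"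
    "x1 \<in> borel_measurable (lebesgue_on {0..T})" "x2 \<in> borel_measurable (lebesgue_on {0..T})"
    "u1 \<in> borel_measurable (lebesgue_on {0..T})" "u2 \<in> borel_measurable (lebesgue_on {0..T})"
    "\<And>t. t \<in> {0..T} \<Longrightarrow> norm (x1 t - xr t) \<le> \<rho> \<and> norm (x2 t - xr t) \<le> \<rho> \<and>
      norm (u1 t - u t) \<le> \<rho> * V t \<and> norm (u2 t - u t) \<le> \<rho> * V t \<and>
      norm (x1 t - x2 t) \<le> \<sigma> \<and> norm (u1 t - u2 t) \<le> \<sigma> * V t"
  shows "control_variation q T xr ur V \<rho> u x1 x2 u1 u2 \<sigma>"
  using assms by (simp add: control_variation_def)

section \<open>Linearisation errors and their Lipschitz constants in L^1\<close>

text \<open>The products \<open>px\<close> and \<open>pu\<close> abstract the way a derivative acts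
  on an increment: matrix-vector multiplication for the dynamics, the inner product for the
  integrand of the cost. One development thus serves both.\<close>

locale smooth_data =
  fixes T :: real
    and F :: "real^'d \<Rightarrow> real^'m \<Rightarrow> real \<Rightarrow> 'k::euclidean_space"
    and Fx :: "real^'d \<Rightarrow> real^'m \<Rightarrow> real \<Rightarrow> 'a::euclidean_space"
    and Fu :: "real^'d \<Rightarrow> real^'m \<Rightarrow> real \<Rightarrow> 'b::euclidean_space"
    and px :: "'a \<Rightarrow> real^'d \<Rightarrow> 'k" and pu :: "'b \<Rightarrow> real^'m \<Rightarrow> 'k"
  assumes T: "0 < T"
    and F: "continuous_data T F" and Fx: "continuous_data T Fx" and Fu: "continuous_data T Fu"
    and px: "bounded_bilinear px" and pu: "bounded_bilinear pu"
    and derx: "\<And>x u t. t \<in> {0..T} \<Longrightarrow> ((\<lambda>y. F y u t) has_derivative px (Fx x u t)) (at x)"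
    and deru: "\<And>x u t. t \<in> {0..T} \<Longrightarrow> ((\<lambda>v. F x v t) has_derivative pu (Fu x u t)) (at u)"
begin

text \<open>The linearisation is taken at a fixed reference pair, not at either of the two compared
  pairs. The error is therefore additive: two errors with a common second pair differ by the error
  between their first pairs.\<close>

definition lin_error ::
  "real^'d \<Rightarrow> real^'m \<Rightarrow> real \<Rightarrow> real^'d \<Rightarrow> real^'d \<Rightarrow> real^'m \<Rightarrow> real^'m \<Rightarrow> 'k" where
  "lin_error xr ur t x1 x2 u1 u2 = F x1 u1 t - F x2 u2 t
    - px (Fx xr ur t) (x1 - x2) - pu (Fu xr ur t) (u1 - u2)"

text \<open>Only partial derivatives are given, so the change is made in one variable at a time,
  through the intermediate pair \<open>(x2, u1)\<close>, and the mean value inequality is applied on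
  each leg.\<close>

lemma lin_error_bound:
  obtains K where "0 < K" "\<forall>a h. norm (px a h) \<le> K * norm a * norm h"
    "\<forall>b h. norm (pu b h) \<le> K * norm b * norm h"
    "\<forall>t\<in>{0..T}. \<forall>xr ur x1 x2 u1 u2 c1 c2. 0 \<le> c1 \<longrightarrow> 0 \<le> c2 \<longrightarrow>
      (\<forall>\<xi>\<in>closed_segment x1 x2. norm (Fx \<xi> u1 t - Fx xr ur t) * norm (x1 - x2) \<le> c1) \<longrightarrow>
      (\<forall>\<eta>\<in>closed_segment u1 u2. norm (Fu x2 \<eta> t - Fu xr ur t) * norm (u1 - u2) \<le> c2) \<longrightarrow>
      norm (lin_error xr ur t x1 x2 u1 u2) \<le> K * (c1 + c2)"
proof -
  obtain K1 where K1: "0 < K1" "\<And>a h. norm (px a h) \<le> norm a * norm h * K1"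
    using bounded_bilinear.pos_bounded[OF px] by blast
  obtain K2 where K2: "0 < K2" "\<And>a h. norm (pu a h) \<le> norm a * norm h * K2"
    using bounded_bilinear.pos_bounded[OF pu] by blast
  define K where "K = K1 + K2"
  have K: "0 < K" using K1 K2 by (simp add: K_def)
  have px_le: "norm (px a h) \<le> K * norm a * norm h" for a h
  proof -
    have "norm (px a h) \<le> K1 * (norm a * norm h)" using K1(2)[of a h] by (simp add: mult_ac)
    also have "\<dots> \<le> K * (norm a * norm h)" using K2(1) by (intro mult_right_mono) (auto simp: K_def)
    finally show ?thesis by (simp add: mult_ac)
  qed
  have pu_le: "norm (pu a h) \<le> K * norm a * norm h" for a h
  proof -
    have "norm (pu a h) \<le> K2 * (norm a * norm h)" using K2(2)[of a h] by (simp add: mult_ac)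
    also have "\<dots> \<le> K * (norm a * norm h)" using K1(1) by (intro mult_right_mono) (auto simp: K_def)
    finally show ?thesis by (simp add: mult_ac)
  qed
  show thesis
  proof (rule that[of K])
    show "\<forall>t\<in>{0..T}. \<forall>xr ur x1 x2 u1 u2 c1 c2. 0 \<le> c1 \<longrightarrow> 0 \<le> c2 \<longrightarrow>
      (\<forall>\<xi>\<in>closed_segment x1 x2. norm (Fx \<xi> u1 t - Fx xr ur t) * norm (x1 - x2) \<le> c1) \<longrightarrow>
      (\<forall>\<eta>\<in>closed_segment u1 u2. norm (Fu x2 \<eta> t - Fu xr ur t) * norm (u1 - u2) \<le> c2) \<longrightarrow>
      norm (lin_error xr ur t x1 x2 u1 u2) \<le> K * (c1 + c2)"
    proof (intro ballI allI impI)
      fix t xr ur x1 x2 u1 u2 and c1 c2 :: real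
      assume t: "t \<in> {0..T}" and c: "0 \<le> c1" "0 \<le> c2"
        and b: "\<forall>\<xi>\<in>closed_segment x1 x2. norm (Fx \<xi> u1 t - Fx xr ur t) * norm (x1 - x2) \<le> c1"
          "\<forall>\<eta>\<in>closed_segment u1 u2. norm (Fu x2 \<eta> t - Fu xr ur t) * norm (u1 - u2) \<le> c2"
      have "norm (F x1 u1 t - F x2 u1 t - px (Fx xr ur t) (x1 - x2)) \<le> K * c1"
        using b(1) by (intro linearization_error_bound[OF px px_le _ _ derx[OF t]]) (use K c in auto)
      moreover have "norm (F x2 u1 t - F x2 u2 t - pu (Fu xr ur t) (u1 - u2)) \<le> K * c2"
        using b(2) by (intro linearization_error_bound[OF pu pu_le _ _ deru[OF t]]) (use K c in auto)
      moreover have eq: "lin_error xr ur t x1 x2 u1 u2 = (F x1 u1 t - F x2 u1 t - px (Fx xr ur t) (x1 - x2))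
          + (F x2 u1 t - F x2 u2 t - pu (Fu xr ur t) (u1 - u2))"
        by (simp add: lin_error_def)
      ultimately show "norm (lin_error xr ur t x1 x2 u1 u2) \<le> K * (c1 + c2)"
        unfolding eq distrib_left by (intro norm_triangle_le add_mono)
    qed
  qed (use K px_le pu_le in auto)
qed

text \<open>Dominated convergence for the error divided by \<open>\<sigma>\<close>. States vary by
  at most \<open>\<sigma>\<close> and controls by at most \<open>\<sigma> * V t\<close>, so the
  quotient is bounded by the variation of \<open>Fx\<close> plus \<open>V t\<close> times the
  variation of \<open>Fu\<close>. It tends to 0 because the derivatives at intermediate points tend
  to those at the reference.\<close>

lemma lin_error_small_Lipschitz:
  fixes xr :: "real \<Rightarrow> real^'d" and ur :: "real \<Rightarrow> real^'m" and V :: "real \<Rightarrow> real"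
  assumes q: "1 \<le> q" and xr: "continuous_on {0..T} xr" and ur: "ur \<in> Lp_space q T"
    and V: "V \<in> Lp_space q T" "\<And>t. 0 \<le> V t"
    and domx: "dominated_data q T Fx" and domu: "dominated_control_data q T Fu"
    and \<delta>: "0 < (\<delta>::real)"
  shows "\<exists>\<rho>0>0. \<forall>\<rho> u x1 x2 u1 u2 \<sigma>. \<rho> \<le> \<rho>0 \<longrightarrow> control_variation q T xr ur V \<rho> u x1 x2 u1 u2 \<sigma> \<longrightarrow>
    integrable (lebesgue_on {0..T}) (\<lambda>t. lin_error (xr t) (ur t) t (x1 t) (x2 t) (u1 t) (u2 t)) \<and>
    (LINT t|lebesgue_on {0..T}. norm (lin_error (xr t) (ur t) t (x1 t) (x2 t) (u1 t) (u2 t))) \<le> \<delta> * \<sigma>"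
proof -
  let ?L = "lebesgue_on {0..T}" and ?C = "control_variation q T xr ur V"
  define N where "N x1 x2 u1 u2 t = lin_error (xr t) (ur t) t (x1 t) (x2 t) (u1 t) (u2 t)" for x1 x2 u1 u2 t
  \<comment> \<open>The states, the two controls and \<open>\<sigma>\<close> are hidden behind the
    quotient \<open>r\<close>, since the general statement on uniform smallness keeps track only of
    the radius and the control \<open>u\<close>.\<close>
  define P where "P \<rho> u r \<longleftrightarrow> (\<exists>x1 x2 u1 u2 \<sigma>. ?C \<rho> u x1 x2 u1 u2 \<sigma> \<and> r = (\<lambda>t. norm (N x1 x2 u1 u2 t) / \<sigma>))" for \<rho> u r
  obtain K where K: "0 < K" "\<forall>t\<in>{0..T}. \<forall>xr ur x1 x2 u1 u2 c1 c2. 0 \<le> c1 \<longrightarrow> 0 \<le> c2 \<longrightarrow>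
      (\<forall>\<xi>\<in>closed_segment x1 x2. norm (Fx \<xi> u1 t - Fx xr ur t) * norm (x1 - x2) \<le> c1) \<longrightarrow>
      (\<forall>\<eta>\<in>closed_segment u1 u2. norm (Fu x2 \<eta> t - Fu xr ur t) * norm (u1 - u2) \<le> c2) \<longrightarrow>
      norm (lin_error xr ur t x1 x2 u1 u2) \<le> K * (c1 + c2)"
    by (rule lin_error_bound)
  have Tge: "0 \<le> T" using T by simp
  have xrm [measurable]: "xr \<in> borel_measurable ?L"
    using xr by (intro continuous_imp_measurable_on_sets_lebesgue) auto
  have urm [measurable]: "ur \<in> borel_measurable ?L" using ur by (rule Lp_space_measurable)
  have Vm [measurable]: "V \<in> borel_measurable ?L" using V(1) by (rule Lp_space_measurable)
  have Nm: "(\<lambda>t. N x1 x2 u1 u2 t) \<in> borel_measurable ?L" if "?C \<rho> u x1 x2 u1 u2 \<sigma>" for \<rho> u x1 x2 u1 u2 \<sigma>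
  proof -
    have [measurable]: "x1 \<in> borel_measurable ?L" "x2 \<in> borel_measurable ?L" "u1 \<in> borel_measurable ?L" "u2 \<in> borel_measurable ?L"
      using that by (auto simp: control_variation_def)
    have [measurable]: "(\<lambda>t. F (x1 t) (u1 t) t) \<in> borel_measurable ?L" "(\<lambda>t. F (x2 t) (u2 t) t) \<in> borel_measurable ?L"
      "(\<lambda>t. Fx (xr t) (ur t) t) \<in> borel_measurable ?L" "(\<lambda>t. Fu (xr t) (ur t) t) \<in> borel_measurable ?L"
      using continuous_data_measurable[OF F Tge] continuous_data_measurable[OF Fx Tge xrm urm]
        continuous_data_measurable[OF Fu Tge xrm urm] by auto
    have bm: "(\<lambda>t. b (g t) (h t)) \<in> borel_measurable ?L"
      if "bounded_bilinear b" "g \<in> borel_measurable ?L" "h \<in> borel_measurable ?L"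
      for b :: "'e::euclidean_space \<Rightarrow> 'f::euclidean_space \<Rightarrow> 'k" and g h
      using that(2,3) by (rule borel_measurable_continuous_Pair)
        (intro bounded_bilinear.continuous_on[OF that(1)] continuous_intros)
    show ?thesis
      unfolding N_def lin_error_def
      by (intro borel_measurable_diff bm[OF px] bm[OF pu]) measurable
  qed
  have "\<exists>\<rho>0>0. \<forall>\<rho> u r. \<rho> \<le> \<rho>0 \<longrightarrow> P \<rho> u r \<longrightarrow> integrable ?L r \<and> (LINT t|?L. \<bar>r t\<bar>) \<le> \<delta>"
  proof (rule Lp_uniformly_small[OF q T ur \<delta>])
    fix \<rho> u r assume "P \<rho> u r"
    then obtain x1 x2 u1 u2 \<sigma> where *: "?C \<rho> u x1 x2 u1 u2 \<sigma>" "r = (\<lambda>t. norm (N x1 x2 u1 u2 t) / \<sigma>)"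
      unfolding P_def by blast
    from Nm[OF *(1)] have "r \<in> borel_measurable ?L" unfolding *(2) by measurable
    then show "0 < \<rho> \<and> u \<in> Lp_space q T \<and> Lp_norm q T (\<lambda>t. u t - ur t) \<le> \<rho> \<and> r \<in> borel_measurable ?L"
      using *(1) by (auto simp: control_variation_def)
  next
    fix W :: "real \<Rightarrow> real" assume W: "W \<in> Lp_space q T"
    have [measurable]: "W \<in> borel_measurable ?L" using W by (rule Lp_space_measurable)
    obtain R where "\<forall>y\<in>xr ` {0..T}. norm y \<le> R"
      using compact_imp_bounded[OF compact_continuous_image[OF xr compact_Icc]]
      unfolding bounded_iff by blast
    then have R: "norm (xr t) \<le> R" if "t \<in> {0..T}" for t using that by blast
    \<comment> \<open>The envelope must bound the controls near \<open>u\<close>, which differ from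
      it by at most \<open>V\<close>, the reference control, and \<open>V\<close> itself: the last
      makes \<open>V t * norm (Fu ...)\<close> at most \<open>W' t * norm (Fu ...)\<close>, the
      product that is dominated.\<close>
    define W' where "W' t = (\<bar>W t\<bar> + V t) + norm (ur t)" for t
    have "(\<lambda>t. \<bar>W t\<bar> + V t) \<in> Lp_space q T"
      by (rule Lp_space_bound[OF q W V(1), of _ 1]) (use V(2) in auto)
    then have W': "W' \<in> Lp_space q T"
      unfolding W'_def by (rule Lp_space_bound[OF q _ ur, of _ _ 1]) (use V(2) in \<open>auto simp: abs_of_nonneg\<close>)
    obtain \<omega>1 where \<omega>1: "integrable ?L \<omega>1" "AE t in ?L.
        \<forall>x u. norm x \<le> R + 1 \<longrightarrow> norm u \<le> W' t \<longrightarrow> norm (Fx x u t) \<le> \<omega>1 t"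
      using domx W' unfolding dominated_data_def by blast
    obtain \<omega>2 where \<omega>2: "integrable ?L \<omega>2" "AE t in ?L.
        \<forall>x u. norm x \<le> R + 1 \<longrightarrow> norm u \<le> W' t \<longrightarrow> W' t * norm (Fu x u t) \<le> \<omega>2 t"
      using domu W' unfolding dominated_control_data_def by blast
    show "\<exists>\<omega>. integrable ?L \<omega> \<and> (\<forall>\<rho> u r. P \<rho> u r \<longrightarrow> \<rho> \<le> 1 \<longrightarrow>
      (AE t in ?L. norm (u t) \<le> W t) \<longrightarrow> (AE t in ?L. \<bar>r t\<bar> \<le> \<omega> t))"
    proof (intro exI[of _ "\<lambda>t. K * (2 * \<omega>1 t + 2 * \<omega>2 t)"] conjI allI impI)
      show "integrable ?L (\<lambda>t. K * (2 * \<omega>1 t + 2 * \<omega>2 t))" using \<omega>1(1) \<omega>2(1) by simp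
      fix \<rho> u r assume "P \<rho> u r" "\<rho> \<le> 1" and uW: "AE t in ?L. norm (u t) \<le> W t"
      then obtain x1 x2 u1 u2 \<sigma> where C: "?C \<rho> u x1 x2 u1 u2 \<sigma>" and r: "r = (\<lambda>t. norm (N x1 x2 u1 u2 t) / \<sigma>)"
        unfolding P_def by blast
      have \<sigma>: "0 < \<sigma>" and \<rho>: "0 < \<rho>" using C by (auto simp: control_variation_def)
      have "AE t in ?L. t \<in> {0..T}" by (rule AE_I2) simp
      with uW \<omega>1(2) \<omega>2(2) show "AE t in ?L. \<bar>r t\<bar> \<le> K * (2 * \<omega>1 t + 2 * \<omega>2 t)"
      proof eventually_elim
        case (elim t)
        have *: "norm (x1 t - xr t) \<le> 1" "norm (x2 t - xr t) \<le> 1"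
          "norm (u1 t - u t) \<le> V t" "norm (u2 t - u t) \<le> V t"
          "norm (x1 t - x2 t) \<le> \<sigma>" "norm (u1 t - u2 t) \<le> \<sigma> * V t"
          using C elim(4) \<open>\<rho> \<le> 1\<close> mult_right_mono[OF \<open>\<rho> \<le> 1\<close> V(2)[of t]]
          unfolding control_variation_def by (fastforce intro: order_trans)+
        have xle: "norm \<xi> \<le> R + 1" if "norm (\<xi> - xr t) \<le> 1" for \<xi>
          using norm_le_of_near[OF that R] elim(4) by simp
        have ule: "norm \<eta> \<le> W' t" if "norm (\<eta> - u t) \<le> V t" for \<eta>
          using norm_le_of_near[OF that elim(1)] abs_ge_self[of "W t"] norm_ge_zero[of "ur t"] unfolding W'_def by linarith
        have r1: "norm (Fx (xr t) (ur t) t) \<le> \<omega>1 t" "W' t * norm (Fu (xr t) (ur t) t) \<le> \<omega>2 t"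
          using elim(2,3) R[OF elim(4)] V(2)[of t] by (auto simp: W'_def)
        have VW: "V t \<le> W' t" by (simp add: W'_def)
        have "norm (lin_error (xr t) (ur t) t (x1 t) (x2 t) (u1 t) (u2 t)) \<le> K * (2 * \<omega>1 t * \<sigma> + 2 * \<omega>2 t * \<sigma>)"
        proof (rule K(2)[rule_format, OF elim(4)])
          fix \<xi> assume \<xi>: "\<xi> \<in> closed_segment (x1 t) (x2 t)"
          have "norm (Fx \<xi> (u1 t) t) \<le> \<omega>1 t"
            using elim(2) xle[OF norm_segment_le[OF \<xi> *(1,2)]] ule[OF *(3)] by blast
          then have "norm (Fx \<xi> (u1 t) t - Fx (xr t) (ur t) t) \<le> 2 * \<omega>1 t"
            using r1(1) norm_triangle_ineq4[of "Fx \<xi> (u1 t) t" "Fx (xr t) (ur t) t"] by linarith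
          then show "norm (Fx \<xi> (u1 t) t - Fx (xr t) (ur t) t) * norm (x1 t - x2 t) \<le> 2 * \<omega>1 t * \<sigma>"
            using *(5) by (intro mult_mono') auto
        next
          fix \<eta> assume \<eta>: "\<eta> \<in> closed_segment (u1 t) (u2 t)"
          have "W' t * norm (Fu (x2 t) \<eta> t) \<le> \<omega>2 t"
            using elim(3) xle[OF *(2)] ule[OF norm_segment_le[OF \<eta> *(3,4)]] by blast
          then have b: "W' t * (norm (Fu (x2 t) \<eta> t) + norm (Fu (xr t) (ur t) t)) \<le> 2 * \<omega>2 t"
            using r1(2) by (simp add: distrib_left)
          have "norm (Fu (x2 t) \<eta> t - Fu (xr t) (ur t) t) * norm (u1 t - u2 t)
            \<le> (norm (Fu (x2 t) \<eta> t) + norm (Fu (xr t) (ur t) t)) * (\<sigma> * V t)"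
            using *(6) by (intro mult_mono' norm_triangle_ineq4) auto
          also have "\<dots> \<le> (norm (Fu (x2 t) \<eta> t) + norm (Fu (xr t) (ur t) t)) * (\<sigma> * W' t)"
            using VW \<sigma> by (intro mult_left_mono) auto
          also have "\<dots> \<le> 2 * \<omega>2 t * \<sigma>"
            using mult_right_mono[OF b, of \<sigma>] \<sigma> by (simp add: mult_ac)
          finally show "norm (Fu (x2 t) \<eta> t - Fu (xr t) (ur t) t) * norm (u1 t - u2 t) \<le> 2 * \<omega>2 t * \<sigma>" .
        next
          have "0 \<le> \<omega>1 t" using r1(1) norm_ge_zero order_trans by blast
          then show "0 \<le> 2 * \<omega>1 t * \<sigma>" using \<sigma> by simp
          have "0 \<le> W' t" using V(2)[of t] by (simp add: W'_def)
          then have "0 \<le> \<omega>2 t" using r1(2) by (meson mult_nonneg_nonneg norm_ge_zero order_trans)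
          then show "0 \<le> 2 * \<omega>2 t * \<sigma>" using \<sigma> by simp
        qed
        then show ?case
          using \<sigma> unfolding r by (simp add: N_def pos_divide_le_eq algebra_simps)
      qed
    qed
  next
    fix \<rho> :: "nat \<Rightarrow> real" and u r
    assume "\<And>n. P (\<rho> n) (u n) (r n)" and \<rho>: "\<rho> \<longlonglongrightarrow> 0" and u: "AE t in ?L. (\<lambda>n. u n t) \<longlonglongrightarrow> ur t"
    then have "\<forall>n. \<exists>x1 x2 u1 u2 \<sigma>. ?C (\<rho> n) (u n) x1 x2 u1 u2 \<sigma> \<and> r n = (\<lambda>t. norm (N x1 x2 u1 u2 t) / \<sigma>)"
      by (simp add: P_def)
    then obtain x1 x2 u1 u2 \<sigma> where C: "\<And>n. ?C (\<rho> n) (u n) (x1 n) (x2 n) (u1 n) (u2 n) (\<sigma> n)"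
      and r: "\<And>n. r n = (\<lambda>t. norm (N (x1 n) (x2 n) (u1 n) (u2 n) t) / \<sigma> n)"
      by metis
    have "AE t in ?L. t \<in> {0..T}" by (rule AE_I2) simp
    with u show "AE t in ?L. (\<lambda>n. r n t) \<longlonglongrightarrow> 0"
    proof eventually_elim
      case (elim t)
      show "(\<lambda>n. r n t) \<longlonglongrightarrow> 0"
      proof (rule tendstoI)
        fix e :: real assume "0 < e"
        \<comment> \<open>At a fixed time \<open>V t\<close> is just a number, and \<open>e'\<close>
          is chosen so that \<open>K * e' * (1 + V t) = e / 2\<close>; the summand 1 stems from the
          state and \<open>V t\<close> from the control.\<close>
        define e' where "e' = e / (2 * K * (1 + V t))"
        have V1: "0 < 1 + V t" using V(2)[of t] by simp
        have e': "0 < e'" using \<open>0 < e\<close> K(1) V1 by (simp add: e'_def)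
        obtain d1 where d1: "0 < d1" "\<forall>x u. norm (x - xr t) \<le> d1 \<longrightarrow> norm (u - ur t) \<le> d1 \<longrightarrow>
            dist (Fx x u t) (Fx (xr t) (ur t) t) \<le> e'"
          by (rule continuous_data_at[OF Fx elim(2) e'])
        obtain d2 where d2: "0 < d2" "\<forall>x u. norm (x - xr t) \<le> d2 \<longrightarrow> norm (u - ur t) \<le> d2 \<longrightarrow>
            dist (Fu x u t) (Fu (xr t) (ur t) t) \<le> e'"
          by (rule continuous_data_at[OF Fu elim(2) e'])
        define d where "d = min d1 d2"
        have "0 < d" using d1 d2 by (simp add: d_def)
        have "(\<lambda>n. norm (u n t - ur t) + \<rho> n * V t) \<longlonglongrightarrow> norm (ur t - ur t) + 0 * V t"
          using elim(1) \<rho> by (intro tendsto_intros)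
        then have "\<forall>\<^sub>F n in sequentially. norm (u n t - ur t) + \<rho> n * V t < d"
          using \<open>0 < d\<close> by (intro order_tendstoD(2)) auto
        moreover have "\<forall>\<^sub>F n in sequentially. \<rho> n < d" using \<rho> \<open>0 < d\<close> by (intro order_tendstoD(2))
        ultimately show "\<forall>\<^sub>F n in sequentially. dist (r n t) 0 < e"
        proof eventually_elim
          case (elim n)
          note Cn = C[of n, unfolded control_variation_def]
          have \<sigma>: "0 < \<sigma> n" using Cn by blast
          have *: "norm (x1 n t - xr t) \<le> \<rho> n" "norm (x2 n t - xr t) \<le> \<rho> n"
            "norm (u1 n t - u n t) \<le> \<rho> n * V t" "norm (u2 n t - u n t) \<le> \<rho> n * V t"
            "norm (x1 n t - x2 n t) \<le> \<sigma> n" "norm (u1 n t - u2 n t) \<le> \<sigma> n * V t"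
            using Cn \<open>t \<in> {0..T}\<close> by blast+
          have x: "norm (x1 n t - xr t) \<le> d" "norm (x2 n t - xr t) \<le> d" using * elim by auto
          have ud: "norm (v - ur t) \<le> d" if "norm (v - u n t) \<le> \<rho> n * V t" for v
          proof -
            have "norm (v - ur t) \<le> norm (v - u n t) + norm (u n t - ur t)"
              by (metis diff_add_cancel add_diff_eq norm_triangle_ineq)
            then show ?thesis using that elim by simp
          qed
          note u12 = ud[OF *(3)] ud[OF *(4)]
          have "norm (lin_error (xr t) (ur t) t (x1 n t) (x2 n t) (u1 n t) (u2 n t)) \<le> K * (e' * \<sigma> n + e' * (\<sigma> n * V t))"
          proof (rule K(2)[rule_format, OF \<open>t \<in> {0..T}\<close>])
            fix \<xi> assume \<xi>: "\<xi> \<in> closed_segment (x1 n t) (x2 n t)"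
            have "norm (Fx \<xi> (u1 n t) t - Fx (xr t) (ur t) t) \<le> e'"
              using d1(2) norm_segment_le[OF \<xi> x] u12 by (simp add: dist_norm d_def)
            then show "norm (Fx \<xi> (u1 n t) t - Fx (xr t) (ur t) t) * norm (x1 n t - x2 n t) \<le> e' * \<sigma> n"
              using *(5) by (intro mult_mono') auto
          next
            fix \<eta> assume \<eta>: "\<eta> \<in> closed_segment (u1 n t) (u2 n t)"
            have "norm (Fu (x2 n t) \<eta> t - Fu (xr t) (ur t) t) \<le> e'"
              using d2(2) norm_segment_le[OF \<eta> u12] x by (simp add: dist_norm d_def)
            then show "norm (Fu (x2 n t) \<eta> t - Fu (xr t) (ur t) t) * norm (u1 n t - u2 n t) \<le> e' * (\<sigma> n * V t)"
              using *(6) by (intro mult_mono') auto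
          qed (use e' \<sigma> V(2)[of t] in auto)
          also have "\<dots> = (K * e' * (1 + V t)) * \<sigma> n" by (simp add: algebra_simps)
          also have "K * e' * (1 + V t) = e / 2"
          proof -
            have "2 * K * (1 + V t) \<noteq> 0" using V1 K(1) by simp
            then have "e' * (2 * K * (1 + V t)) = e"
              unfolding e'_def by (rule nonzero_eq_divide_eq[THEN iffD1, OF _ refl])
            moreover have "e' * (2 * K * (1 + V t)) = 2 * (K * e' * (1 + V t))" by (simp only: mult_ac)
            ultimately show ?thesis by simp
          qed
          finally have "r n t \<le> e / 2" using \<sigma> by (simp add: r N_def pos_divide_le_eq)
          moreover have "0 \<le> r n t" using \<sigma> by (simp add: r)
          ultimately show ?case using \<open>0 < e\<close> by simp
        qed
      qed
    qed
  qed
  then obtain \<rho>0 where \<rho>0: "0 < \<rho>0"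
    "\<forall>\<rho> u r. \<rho> \<le> \<rho>0 \<longrightarrow> P \<rho> u r \<longrightarrow> integrable ?L r \<and> (LINT t|?L. \<bar>r t\<bar>) \<le> \<delta>"
    by blast
  have "integrable ?L (N x1 x2 u1 u2) \<and> (LINT t|?L. norm (N x1 x2 u1 u2 t)) \<le> \<delta> * \<sigma>"
    if C: "?C \<rho> u x1 x2 u1 u2 \<sigma>" and "\<rho> \<le> \<rho>0" for \<rho> u x1 x2 u1 u2 \<sigma>
  proof -
    have \<sigma>: "0 < \<sigma>" using C by (simp add: control_variation_def)
    let ?r = "\<lambda>t. norm (N x1 x2 u1 u2 t) / \<sigma>"
    have "P \<rho> u ?r" using C unfolding P_def by blast
    with \<rho>0(2) \<open>\<rho> \<le> \<rho>0\<close> have r: "integrable ?L ?r" "(LINT t|?L. \<bar>?r t\<bar>) \<le> \<delta>" by blast+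
    have "integrable ?L (\<lambda>t. norm (N x1 x2 u1 u2 t))"
      using integrable_mult_left[OF r(1), of \<sigma>] \<sigma> by simp
    then have "integrable ?L (N x1 x2 u1 u2)"
      using Nm[OF C] by (simp add: integrable_norm_iff)
    moreover have "(LINT t|?L. norm (N x1 x2 u1 u2 t)) = \<sigma> * (LINT t|?L. \<bar>?r t\<bar>)"
      using \<sigma> by simp
    moreover have "\<sigma> * (LINT t|?L. \<bar>?r t\<bar>) \<le> \<sigma> * \<delta>" using r(2) \<sigma> by (intro mult_left_mono) auto
    ultimately show ?thesis by (simp add: mult.commute)
  qed
  with \<rho>0(1) show ?thesis
    unfolding N_def[abs_def] by (intro exI[of _ \<rho>0]) blast
qed

end

lemma continuous_on_Icc_bounded:
  fixes x :: "real \<Rightarrow> 'a::real_normed_vector"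
  assumes "continuous_on {0..T} x"
  obtains R where "0 < R" "\<forall>t\<in>{0..T}. norm (x t) \<le> R"
proof -
  obtain R where "\<forall>y\<in>x ` {0..T}. norm y \<le> R"
    using compact_imp_bounded[OF compact_continuous_image[OF assms compact_Icc]]
    unfolding bounded_iff by blast
  then show thesis by (intro that[of "max 1 R"]) auto
qed

lemma continuous_Icc_measurable:
  fixes x :: "real \<Rightarrow> 'a::euclidean_space"
  assumes "continuous_on {0..T} x"
  shows "x \<in> borel_measurable (lebesgue_on {0..T})"
  using assms by (intro continuous_imp_measurable_on_sets_lebesgue) auto

lemma Lp_space_norm:
  assumes "1 \<le> q" "u \<in> Lp_space q T"
  shows "(\<lambda>t. norm (u t)) \<in> Lp_space q T"
  using assms(2) by (intro Lp_space_bound[OF assms(1) assms(2) assms(2), of _ 1]) (auto dest: Lp_space_measurable)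

lemma Lp_space_add_norm:
  fixes V :: "real \<Rightarrow> real"
  assumes "1 \<le> q" "u \<in> Lp_space q T" "V \<in> Lp_space q T"
  shows "(\<lambda>t. norm (u t) + V t) \<in> Lp_space q T"
  using assms(2,3) by (intro Lp_space_bound[OF assms(1) assms(2) assms(3), of _ 1])
    (auto dest!: Lp_space_measurable intro!: AE_I2 order_trans[OF abs_triangle_ineq])

lemma dominated_integrable:
  fixes G :: "real^'d \<Rightarrow> real^'m \<Rightarrow> real \<Rightarrow> 'k::euclidean_space"
  assumes q: "1 \<le> q" and T: "0 \<le> T" and G: "continuous_data T G" "dominated_data q T G"
    and x: "continuous_on {0..T} x" and u: "u \<in> Lp_space q T"
  shows "integrable (lebesgue_on {0..T}) (\<lambda>t. G (x t) (u t) t)"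
proof -
  let ?L = "lebesgue_on {0..T}"
  obtain R where R: "\<forall>t\<in>{0..T}. norm (x t) \<le> R" by (rule continuous_on_Icc_bounded[OF x])
  obtain \<omega> where \<omega>: "integrable ?L \<omega>"
    "AE t in ?L. \<forall>x v. norm x \<le> R \<longrightarrow> norm v \<le> norm (u t) \<longrightarrow> norm (G x v t) \<le> \<omega> t"
    using G(2) Lp_space_norm[OF q u] unfolding dominated_data_def by blast
  have "AE t in ?L. t \<in> {0..T}" by (rule AE_I2) simp
  with \<omega>(2) have ae: "AE t in ?L. norm (G (x t) (u t) t) \<le> norm (\<omega> t)"
  proof eventually_elim
    case (elim t)
    then have "norm (G (x t) (u t) t) \<le> \<omega> t" using R by blast
    then show ?case by simp
  qed
  have "(\<lambda>t. G (x t) (u t) t) \<in> borel_measurable ?L"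
    using u by (intro continuous_data_measurable[OF G(1) T] continuous_Icc_measurable[OF x] Lp_space_measurable)
  with \<omega>(1) show ?thesis using ae by (rule Bochner_Integration.integrable_bound)
qed

lemma dominated_control_integrable:
  fixes G :: "real^'d \<Rightarrow> real^'m \<Rightarrow> real \<Rightarrow> 'k::euclidean_space" and V :: "real \<Rightarrow> real"
  assumes q: "1 \<le> q" and T: "0 \<le> T" and G: "continuous_data T G" "dominated_control_data q T G"
    and x: "continuous_on {0..T} x" and u: "u \<in> Lp_space q T"
    and V: "V \<in> Lp_space q T" "\<And>t. 0 \<le> V t"
  shows "integrable (lebesgue_on {0..T}) (\<lambda>t. V t * norm (G (x t) (u t) t))"
proof -
  let ?L = "lebesgue_on {0..T}"
  obtain R where R: "\<forall>t\<in>{0..T}. norm (x t) \<le> R" by (rule continuous_on_Icc_bounded[OF x])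
  \<comment> \<open>The envelope is the sum because it has to bound the control at which
    \<open>G\<close> is evaluated and also the factor \<open>V\<close>.\<close>
  obtain \<omega> where \<omega>: "integrable ?L \<omega>"
    "AE t in ?L. \<forall>x v. norm x \<le> R \<longrightarrow> norm v \<le> norm (u t) + V t \<longrightarrow> (norm (u t) + V t) * norm (G x v t) \<le> \<omega> t"
    using G(2) Lp_space_add_norm[OF q u V(1)] unfolding dominated_control_data_def by blast
  have "AE t in ?L. t \<in> {0..T}" by (rule AE_I2) simp
  with \<omega>(2) have ae: "AE t in ?L. norm (V t * norm (G (x t) (u t) t)) \<le> norm (\<omega> t)"
  proof eventually_elim
    case (elim t)
    then have "(norm (u t) + V t) * norm (G (x t) (u t) t) \<le> \<omega> t" using R V(2)[of t] by simp
    moreover have "V t * norm (G (x t) (u t) t) \<le> (norm (u t) + V t) * norm (G (x t) (u t) t)"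
      by (intro mult_right_mono) auto
    ultimately show ?case using V(2)[of t] by simp
  qed
  have [measurable]: "(\<lambda>t. G (x t) (u t) t) \<in> borel_measurable ?L"
    using u by (intro continuous_data_measurable[OF G(1) T] continuous_Icc_measurable[OF x] Lp_space_measurable)
  have [measurable]: "V \<in> borel_measurable ?L" using V(1) by (rule Lp_space_measurable)
  have "(\<lambda>t. V t * norm (G (x t) (u t) t)) \<in> borel_measurable ?L" by measurable
  with \<omega>(1) show ?thesis using ae by (rule Bochner_Integration.integrable_bound)
qed

text \<open>The difference is the linear part at the reference plus the linearisation error. The
  error is estimated with constant 1, and the linear part integrates to at most
  \<open>K * \<sigma>\<close> times the integral of |Fx| + V |Fu| along the reference. This is
  applied to the integrand of the cost.\<close>

lemma (in smooth_data) Lipschitz_in_mean: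
  fixes xr :: "real \<Rightarrow> real^'d" and ur :: "real \<Rightarrow> real^'m" and V :: "real \<Rightarrow> real"
  assumes q: "1 \<le> q" and xr: "continuous_on {0..T} xr" and ur: "ur \<in> Lp_space q T"
    and V: "V \<in> Lp_space q T" "\<And>t. 0 \<le> V t"
    and domx: "dominated_data q T Fx" and domu: "dominated_control_data q T Fu"
  shows "\<exists>\<rho>0>0. \<exists>L\<ge>0. \<forall>\<rho> u x1 x2 u1 u2 \<sigma>. \<rho> \<le> \<rho>0 \<longrightarrow> control_variation q T xr ur V \<rho> u x1 x2 u1 u2 \<sigma> \<longrightarrow>
    (LINT t|lebesgue_on {0..T}. norm (F (x1 t) (u1 t) t - F (x2 t) (u2 t) t)) \<le> L * \<sigma>"
proof -
  let ?L = "lebesgue_on {0..T}"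
  obtain K where K: "0 < K" "\<forall>a h. norm (px a h) \<le> K * norm a * norm h"
    "\<forall>b h. norm (pu b h) \<le> K * norm b * norm h"
    by (rule lin_error_bound)
  obtain \<rho>0 where \<rho>0: "0 < \<rho>0" "\<forall>\<rho> u x1 x2 u1 u2 \<sigma>. \<rho> \<le> \<rho>0 \<longrightarrow>
      control_variation q T xr ur V \<rho> u x1 x2 u1 u2 \<sigma> \<longrightarrow>
      integrable ?L (\<lambda>t. lin_error (xr t) (ur t) t (x1 t) (x2 t) (u1 t) (u2 t)) \<and>
      (LINT t|?L. norm (lin_error (xr t) (ur t) t (x1 t) (x2 t) (u1 t) (u2 t))) \<le> 1 * \<sigma>"
    using lin_error_small_Lipschitz[OF q xr ur V domx domu zero_less_one] by blast
  have Tge: "0 \<le> T" using T by simp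
  define a b where "a t = norm (Fx (xr t) (ur t) t)" and "b t = V t * norm (Fu (xr t) (ur t) t)" for t
  have ia: "integrable ?L a"
    unfolding a_def using dominated_integrable[OF q Tge Fx domx xr ur] by (rule integrable_norm)
  have ib: "integrable ?L b"
    unfolding b_def by (rule dominated_control_integrable[OF q Tge Fu domu xr ur V])
  define L where "L = 1 + K * ((LINT t|?L. a t) + (LINT t|?L. b t))"
  have ab: "0 \<le> a t" "0 \<le> b t" for t using V(2) by (auto simp: a_def b_def)
  have "0 \<le> L"
    unfolding L_def using K(1) ab by (intro add_nonneg_nonneg mult_nonneg_nonneg Bochner_Integration.integral_nonneg) auto
  have "(LINT t|?L. norm (F (x1 t) (u1 t) t - F (x2 t) (u2 t) t)) \<le> L * \<sigma>"
    if cv: "\<rho> \<le> \<rho>0" "control_variation q T xr ur V \<rho> u x1 x2 u1 u2 \<sigma>" for \<rho> u x1 x2 u1 u2 \<sigma>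
  proof -
    have c: "\<forall>t\<in>{0..T}. norm (x1 t - x2 t) \<le> \<sigma> \<and> norm (u1 t - u2 t) \<le> \<sigma> * V t" "0 < \<sigma>"
      "x1 \<in> borel_measurable ?L" "x2 \<in> borel_measurable ?L" "u1 \<in> borel_measurable ?L" "u2 \<in> borel_measurable ?L"
      using cv(2) by (auto simp: control_variation_def)
    define N where "N t = lin_error (xr t) (ur t) t (x1 t) (x2 t) (u1 t) (u2 t)" for t
    have N: "integrable ?L N" "(LINT t|?L. norm (N t)) \<le> \<sigma>"
      using \<rho>0(2)[rule_format, OF cv] unfolding N_def[abs_def] by auto
    have bound: "norm (F (x1 t) (u1 t) t - F (x2 t) (u2 t) t) \<le> norm (N t) + K * \<sigma> * (a t + b t)"
      if t: "t \<in> {0..T}" for t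
    proof -
      have "norm (px (Fx (xr t) (ur t) t) (x1 t - x2 t)) \<le> K * a t * \<sigma>"
      proof -
        have "norm (px (Fx (xr t) (ur t) t) (x1 t - x2 t)) \<le> K * a t * norm (x1 t - x2 t)"
          using K(2) by (simp add: a_def)
        also have "\<dots> \<le> K * a t * \<sigma>" using c(1) t K(1) ab by (intro mult_left_mono) auto
        finally show ?thesis .
      qed
      moreover have "norm (pu (Fu (xr t) (ur t) t) (u1 t - u2 t)) \<le> K * b t * \<sigma>"
      proof -
        have "norm (pu (Fu (xr t) (ur t) t) (u1 t - u2 t)) \<le> K * norm (Fu (xr t) (ur t) t) * norm (u1 t - u2 t)"
          using K(3) by simp
        also have "\<dots> \<le> K * norm (Fu (xr t) (ur t) t) * (\<sigma> * V t)"
          using c(1) t K(1) by (intro mult_left_mono) auto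
        finally show ?thesis by (simp add: b_def mult_ac)
      qed
      moreover have "F (x1 t) (u1 t) t - F (x2 t) (u2 t) t
        = N t + px (Fx (xr t) (ur t) t) (x1 t - x2 t) + pu (Fu (xr t) (ur t) t) (u1 t - u2 t)"
        by (simp add: N_def lin_error_def)
      ultimately have "norm (F (x1 t) (u1 t) t - F (x2 t) (u2 t) t) \<le> norm (N t) + K * a t * \<sigma> + K * b t * \<sigma>"
        by (smt (verit) norm_triangle_ineq)
      then show ?thesis by (simp add: algebra_simps)
    qed
    have int: "integrable ?L (\<lambda>t. norm (N t) + K * \<sigma> * (a t + b t))" using N(1) ia ib by auto
    have m: "(\<lambda>t. F (x1 t) (u1 t) t - F (x2 t) (u2 t) t) \<in> borel_measurable ?L"
      using c by (intro borel_measurable_diff continuous_data_measurable[OF F Tge])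
    have AEt: "AE t in ?L. t \<in> {0..T}" by (rule AE_I2) simp
    have ae: "AE t in ?L. norm (F (x1 t) (u1 t) t - F (x2 t) (u2 t) t) \<le> norm (norm (N t) + K * \<sigma> * (a t + b t))"
      using AEt
    proof eventually_elim
      case (elim t) then show ?case using bound[OF elim] by simp
    qed
    have i: "integrable ?L (\<lambda>t. F (x1 t) (u1 t) t - F (x2 t) (u2 t) t)"
      using int m ae by (rule Bochner_Integration.integrable_bound)
    have "(LINT t|?L. norm (F (x1 t) (u1 t) t - F (x2 t) (u2 t) t)) \<le> (LINT t|?L. norm (N t) + K * \<sigma> * (a t + b t))"
    proof (rule integral_mono_AE)
      show "AE t in ?L. norm (F (x1 t) (u1 t) t - F (x2 t) (u2 t) t) \<le> norm (N t) + K * \<sigma> * (a t + b t)"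
        using AEt by eventually_elim (rule bound)
    qed (use i int in auto)
    also have "\<dots> = (LINT t|?L. norm (N t)) + K * \<sigma> * ((LINT t|?L. a t) + (LINT t|?L. b t))"
      using N(1) ia ib by simp
    also have "\<dots> \<le> L * \<sigma>" using N(2) by (simp add: L_def algebra_simps)
    finally show ?thesis .
  qed
  with \<rho>0(1) \<open>0 \<le> L\<close> show ?thesis by (intro exI[of _ \<rho>0] conjI exI[of _ L]) blast+
qed

subsection \<open>Growth conditions\<close>

lemma rpow_mono: "0 \<le> a \<Longrightarrow> a \<le> b \<Longrightarrow> 0 \<le> l \<Longrightarrow> rpow a l \<le> rpow b l"
  by (simp add: rpow_def powr_mono2)

text \<open>The order r/p is exactly such that the p-th power of |u|^(r/p) is |u|^r, which is
  integrable along an envelope in L^r. The case p = 1 covers the conditions of order (q, 1).\<close>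

lemma growth_powr_dominated:
  fixes G :: "real^'d \<Rightarrow> real^'m \<Rightarrow> real \<Rightarrow> 'k::euclidean_space"
  assumes p: "1 \<le> p" "p \<le> r" and G: "growth_condition T (r / p) (ereal p) G"
  shows "dominated_data (ereal r) T (\<lambda>x u t. norm (G x u t) powr p)"
  unfolding dominated_data_def
proof (intro allI impI)
  let ?L = "lebesgue_on {0..T}"
  fix R and W :: "real \<Rightarrow> real" assume W: "W \<in> Lp_space (ereal r) T"
  \<comment> \<open>Growth conditions concern positive radii while domination is required for all
    \<open>R\<close>, hence the maximum with 1.\<close>
  obtain C and \<omega> :: "real \<Rightarrow> real" where C: "0 < C" and \<omega>: "\<omega> \<in> Lp_space (ereal p) T"
    "AE t in ?L. \<forall>x u. norm x \<le> max 1 R \<longrightarrow> norm (G x u t) \<le> C * rpow (norm u) (r / p) + \<omega> t"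
    using G[unfolded growth_condition_def, THEN spec, of "max 1 R"] by auto
  let ?w = "\<lambda>t. 2 powr p * (C powr p * \<bar>W t\<bar> powr r + \<bar>\<omega> t\<bar> powr p)"
  show "\<exists>\<omega>. integrable ?L \<omega> \<and> (AE t in ?L. \<forall>x u. norm x \<le> R \<longrightarrow> norm u \<le> W t \<longrightarrow>
    norm (norm (G x u t) powr p) \<le> \<omega> t)"
  proof (intro exI[of _ ?w] conjI)
    show "integrable ?L ?w" using W \<omega>(1) by (auto simp: Lp_space_ereal_iff)
    show "AE t in ?L. \<forall>x u. norm x \<le> R \<longrightarrow> norm u \<le> W t \<longrightarrow> norm (norm (G x u t) powr p) \<le> ?w t"
      using \<omega>(2)
    proof eventually_elim
      case (elim t)
      show ?case
      proof (intro allI impI)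
        fix x :: "real^'d" and u :: "real^'m" assume x: "norm x \<le> R" and u: "norm u \<le> W t"
        \<comment> \<open>A positive order means that \<open>rpow\<close> is the ordinary power; the
          convention at exponent 0 does not enter.\<close>
        have rp: "0 < r / p" using p by simp
        have "norm (G x u t) \<le> C * rpow (norm u) (r / p) + \<omega> t" using elim x by auto
        also have "\<dots> \<le> C * \<bar>W t\<bar> powr (r / p) + \<bar>\<omega> t\<bar>"
          using u rp C by (intro add_mono mult_left_mono) (auto simp: rpow_def intro!: powr_mono2)
        finally have "norm (G x u t) powr p \<le> (C * \<bar>W t\<bar> powr (r / p) + \<bar>\<omega> t\<bar>) powr p"
          using p by (intro powr_mono2) auto
        also have "\<dots> \<le> 2 powr p * ((C * \<bar>W t\<bar> powr (r / p)) powr p + \<bar>\<omega> t\<bar> powr p)"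
          using C p by (intro powr_add_le) auto
        also have "(C * \<bar>W t\<bar> powr (r / p)) powr p = C powr p * \<bar>W t\<bar> powr r"
          using p by (simp add: powr_mult powr_powr)
        finally show "norm (norm (G x u t) powr p) \<le> ?w t" by simp
      qed
    qed
  qed
qed

lemma dominated_of_powr:
  fixes G :: "real^'d \<Rightarrow> real^'m \<Rightarrow> real \<Rightarrow> 'k::euclidean_space"
  assumes "1 \<le> p" "dominated_data q T (\<lambda>x u t. norm (G x u t) powr p)"
  shows "dominated_data q T G"
  unfolding dominated_data_def
proof (intro allI impI)
  let ?L = "lebesgue_on {0..T}"
  fix R and W :: "real \<Rightarrow> real" assume "W \<in> Lp_space q T"
  then obtain \<omega> where \<omega>: "integrable ?L \<omega>" "AE t in ?L. \<forall>x u. norm x \<le> R \<longrightarrow> norm u \<le> W t \<longrightarrow>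
    norm (norm (G x u t) powr p) \<le> \<omega> t"
    using assms(2) unfolding dominated_data_def by blast
  show "\<exists>\<omega>. integrable ?L \<omega> \<and> (AE t in ?L. \<forall>x u. norm x \<le> R \<longrightarrow> norm u \<le> W t \<longrightarrow> norm (G x u t) \<le> \<omega> t)"
  proof (intro exI[of _ "\<lambda>t. 1 + \<omega> t"] conjI)
    show "integrable ?L (\<lambda>t. 1 + \<omega> t)" using \<omega>(1) by auto
    show "AE t in ?L. \<forall>x u. norm x \<le> R \<longrightarrow> norm u \<le> W t \<longrightarrow> norm (G x u t) \<le> 1 + \<omega> t"
      using \<omega>(2)
    proof eventually_elim
      case (elim t)
      show ?case
      proof (intro allI impI)
        fix x :: "real^'d" and u :: "real^'m" assume "norm x \<le> R" "norm u \<le> W t"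
        then have "norm (G x u t) powr p \<le> \<omega> t" using elim by simp
        then show "norm (G x u t) \<le> 1 + \<omega> t"
          using powr_le_one_plus_powr[of "norm (G x u t)" 1 p] assms(1) by simp
      qed
    qed
  qed
qed

text \<open>Multiplication by \<open>W\<close> raises the order from \<open>l\<close> to
  \<open>l + 1 \<le> r\<close>, and the product of \<open>W\<close> with \<omega> is integrable by
  Young's inequality once \<open>s\<close> is at least the conjugate exponent. It serves both the
  control gradient of the cost, of order (q-1, q'), and the control Jacobian of the
  dynamics.\<close>

lemma growth_control_dominated:
  fixes G :: "real^'d \<Rightarrow> real^'m \<Rightarrow> real \<Rightarrow> 'k::euclidean_space"
  assumes r: "1 \<le> r" and l: "0 \<le> l" "l + 1 \<le> r" and s: "conj_exponent (ereal r) \<le> s"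
    and G: "growth_condition T l s G"
  shows "dominated_control_data (ereal r) T G"
  unfolding dominated_control_data_def
proof (intro allI impI)
  let ?L = "lebesgue_on {0..T}"
  fix R and W :: "real \<Rightarrow> real" assume W: "W \<in> Lp_space (ereal r) T"
  obtain C and \<omega> :: "real \<Rightarrow> real" where C: "0 < C" and \<omega>: "\<omega> \<in> Lp_space s T"
    "AE t in ?L. \<forall>x u. norm x \<le> max 1 R \<longrightarrow> norm (G x u t) \<le> C * rpow (norm u) l + \<omega> t"
    using G[unfolded growth_condition_def, THEN spec, of "max 1 R"] by auto
  have iW: "integrable ?L (\<lambda>t. \<bar>W t\<bar> powr r)" using W by (simp add: Lp_space_ereal_iff)
  have "\<exists>w. integrable ?L w \<and> (AE t in ?L. \<bar>W t\<bar> * \<bar>\<omega> t\<bar> \<le> w t)"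
  \<comment> \<open>This case includes \<open>r = 1\<close>, whose conjugate exponent is
    \<infinity>. Otherwise both exponents are finite and Young's inequality applies.\<close>
  proof (cases "s = \<infinity>")
    case True
    then obtain M where M: "AE t in ?L. \<bar>\<omega> t\<bar> \<le> M" using \<omega>(1) by (auto simp: Lp_space_infinity_iff)
    have iW1: "integrable ?L (\<lambda>t. \<bar>W t\<bar>)"
      using Lp_space_imp_integrable[OF _ W] r by (simp add: one_ereal_def)
    show ?thesis
    proof (intro exI[of _ "\<lambda>t. \<bar>W t\<bar> * M"] conjI)
      show "integrable ?L (\<lambda>t. \<bar>W t\<bar> * M)" using iW1 by simp
      show "AE t in ?L. \<bar>W t\<bar> * \<bar>\<omega> t\<bar> \<le> \<bar>W t\<bar> * M"
        using M by eventually_elim (auto intro: mult_left_mono)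
    qed
  next
    case False
    with s have r1: "1 < r" using r by (cases "r = 1") (auto simp: conj_exponent_def one_ereal_def)
    define r' where "r' = r / (r - 1)"
    have "ereal r' \<le> s" using s r1 by (simp add: conj_exponent_def one_ereal_def r'_def)
    then obtain s' where s': "s = ereal s'" "r' \<le> s'" using False by (cases s) auto
    have r': "1 < r'" "1 / r + 1 / r' = 1" using r1 by (auto simp: r'_def field_simps)
    have i\<omega>: "integrable ?L (\<lambda>t. \<bar>\<omega> t\<bar> powr s')" using \<omega>(1) s' by (simp add: Lp_space_ereal_iff)
    show ?thesis
    proof (intro exI[of _ "\<lambda>t. \<bar>W t\<bar> powr r + (1 + \<bar>\<omega> t\<bar> powr s')"] conjI AE_I2)
      show "integrable ?L (\<lambda>t. \<bar>W t\<bar> powr r + (1 + \<bar>\<omega> t\<bar> powr s'))" using iW i\<omega> by auto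
      fix t
      have "\<bar>W t\<bar> * \<bar>\<omega> t\<bar> \<le> \<bar>W t\<bar> powr r / r + \<bar>\<omega> t\<bar> powr r' / r'"
        using r1 r' by (intro Youngs_inequality) auto
      also have "\<dots> \<le> \<bar>W t\<bar> powr r / 1 + \<bar>\<omega> t\<bar> powr r' / 1"
        using r1 r' by (intro add_mono divide_left_mono) auto
      also have "\<dots> \<le> \<bar>W t\<bar> powr r + (1 + \<bar>\<omega> t\<bar> powr s')"
        using powr_le_one_plus_powr[of "\<bar>\<omega> t\<bar>" r' s'] r' s' by simp
      finally show "\<bar>W t\<bar> * \<bar>\<omega> t\<bar> \<le> \<bar>W t\<bar> powr r + (1 + \<bar>\<omega> t\<bar> powr s')" .
    qed
  qed
  then obtain w where w: "integrable ?L w" "AE t in ?L. \<bar>W t\<bar> * \<bar>\<omega> t\<bar> \<le> w t" by blast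
  show "\<exists>\<omega>. integrable ?L \<omega> \<and> (AE t in ?L. \<forall>x u. norm x \<le> R \<longrightarrow> norm u \<le> W t \<longrightarrow> W t * norm (G x u t) \<le> \<omega> t)"
  proof (intro exI[of _ "\<lambda>t. C * (1 + \<bar>W t\<bar> powr r) + w t"] conjI)
    show "integrable ?L (\<lambda>t. C * (1 + \<bar>W t\<bar> powr r) + w t)" using w iW by auto
    show "AE t in ?L. \<forall>x u. norm x \<le> R \<longrightarrow> norm u \<le> W t \<longrightarrow> W t * norm (G x u t) \<le> C * (1 + \<bar>W t\<bar> powr r) + w t"
      using \<omega>(2) w(2)
    proof eventually_elim
      case (elim t)
      show ?case
      proof (intro allI impI)
        fix x :: "real^'d" and u :: "real^'m" assume x: "norm x \<le> R" and u: "norm u \<le> W t"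
        have W0: "0 \<le> W t" using u norm_ge_zero order_trans by blast
        have "norm (G x u t) \<le> C * rpow (norm u) l + \<omega> t" using elim x by auto
        also have "\<dots> \<le> C * rpow (W t) l + \<bar>\<omega> t\<bar>"
          using u l C by (intro add_mono mult_left_mono rpow_mono) auto
        finally have "W t * norm (G x u t) \<le> W t * (C * rpow (W t) l + \<bar>\<omega> t\<bar>)"
          using W0 by (intro mult_left_mono)
        also have "\<dots> = C * (W t * rpow (W t) l) + \<bar>W t\<bar> * \<bar>\<omega> t\<bar>"
          using W0 by (simp add: algebra_simps)
        \<comment> \<open>For \<open>l = 0\<close> the convention \<open>rpow 0 0 = 1\<close> is
          harmless at \<open>W t = 0\<close>, as the factor \<open>W t\<close> makes both sides
          0.\<close>
        also have "W t * rpow (W t) l = W t powr (l + 1)"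
          using W0 l by (cases "W t = 0") (auto simp: rpow_def powr_add)
        also have "\<dots> \<le> 1 + \<bar>W t\<bar> powr r"
          using powr_le_one_plus_powr[OF W0, of "l + 1" r] l W0 by simp
        finally show "W t * norm (G x u t) \<le> C * (1 + \<bar>W t\<bar> powr r) + w t"
          using elim C by simp
      qed
    qed
  qed
qed

lemma continuous_data_bounded:
  fixes G :: "real^'d \<Rightarrow> real^'m \<Rightarrow> real \<Rightarrow> 'k::real_normed_vector"
  assumes "continuous_data T G"
  obtains C where "0 \<le> C" "\<forall>x u. \<forall>t\<in>{0..T}. norm x \<le> R \<longrightarrow> norm u \<le> M \<longrightarrow> norm (G x u t) \<le> C"
proof -
  let ?S = "cball (0::real^'d) R \<times> cball (0::real^'m) M \<times> {0..T}"
  have "compact ?S" by (intro compact_Times compact_cball compact_Icc)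
  moreover have "continuous_on ?S (\<lambda>(x, u, t). G x u t)"
    using assms[unfolded continuous_data_def] by (rule continuous_on_subset) auto
  ultimately have "bounded ((\<lambda>(x, u, t). G x u t) ` ?S)"
    by (intro compact_imp_bounded compact_continuous_image)
  then obtain C where C: "\<forall>y\<in>(\<lambda>(x, u, t). G x u t) ` ?S. norm y \<le> C"
    unfolding bounded_iff by blast
  show thesis
  proof (rule that[of "max 0 C"])
    show "\<forall>x u. \<forall>t\<in>{0..T}. norm x \<le> R \<longrightarrow> norm u \<le> M \<longrightarrow> norm (G x u t) \<le> max 0 C"
    proof (intro allI ballI impI)
      fix x :: "real^'d" and u :: "real^'m" and t assume "t \<in> {0..T}" "norm x \<le> R" "norm u \<le> M"
      then have "(x, u, t) \<in> ?S" by simp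
      then have "G x u t \<in> (\<lambda>(x, u, t). G x u t) ` ?S" by (metis (mono_tags, lifting) case_prod_conv image_eqI)
      then have "norm (G x u t) \<le> C" using C by blast
      then show "norm (G x u t) \<le> max 0 C" by simp
    qed
  qed simp
qed

text \<open>An essentially bounded envelope confines the arguments to a compact set for almost every
  time, and there continuity alone gives a constant bound.\<close>

lemma dominated_infinity:
  fixes G :: "real^'d \<Rightarrow> real^'m \<Rightarrow> real \<Rightarrow> 'k::euclidean_space"
  assumes "continuous_data T G"
  shows "dominated_data \<infinity> T G" "dominated_control_data \<infinity> T G"
proof -
  let ?L = "lebesgue_on {0..T}"
  have AEt: "AE t in ?L. t \<in> {0..T}" by (rule AE_I2) simp
  have "\<exists>C. 0 \<le> C \<and> (\<exists>M\<ge>0. (AE t in ?L. \<bar>W t\<bar> \<le> M) \<and>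
      (AE t in ?L. \<forall>x u. norm x \<le> R \<longrightarrow> norm u \<le> W t \<longrightarrow> norm (G x u t) \<le> C))"
    if W: "W \<in> Lp_space \<infinity> T" for R and W :: "real \<Rightarrow> real"
  proof -
    obtain M where M: "0 \<le> M" "AE t in ?L. \<bar>W t\<bar> \<le> M" using W by (auto simp: Lp_space_infinity_iff)
    obtain C where C: "0 \<le> C" "\<forall>x u. \<forall>t\<in>{0..T}. norm x \<le> R \<longrightarrow> norm u \<le> M \<longrightarrow> norm (G x u t) \<le> C"
      by (rule continuous_data_bounded[OF assms])
    have "AE t in ?L. \<forall>x u. norm x \<le> R \<longrightarrow> norm u \<le> W t \<longrightarrow> norm (G x u t) \<le> C"
      using M(2) AEt
    proof eventually_elim
      case (elim t)
      show ?case
      proof (intro allI impI)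
        fix x :: "real^'d" and u :: "real^'m" assume "norm x \<le> R" "norm u \<le> W t"
        moreover from this elim have "norm u \<le> M" by linarith
        ultimately show "norm (G x u t) \<le> C" using C(2) elim(2) by blast
      qed
    qed
    with C M show ?thesis by blast
  qed
  note * = this
  show "dominated_data \<infinity> T G"
    unfolding dominated_data_def
  proof (intro allI impI)
    fix R and W :: "real \<Rightarrow> real" assume "W \<in> Lp_space \<infinity> T"
    from *[OF this, of R] obtain C where "AE t in ?L. \<forall>x u. norm x \<le> R \<longrightarrow> norm u \<le> W t \<longrightarrow> norm (G x u t) \<le> C"
      by blast
    then show "\<exists>\<omega>. integrable ?L \<omega> \<and> (AE t in ?L. \<forall>x u. norm x \<le> R \<longrightarrow> norm u \<le> W t \<longrightarrow> norm (G x u t) \<le> \<omega> t)"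
      by (intro exI[of _ "\<lambda>_. C"]) simp
  qed
  show "dominated_control_data \<infinity> T G"
    unfolding dominated_control_data_def
  proof (intro allI impI)
    fix R and W :: "real \<Rightarrow> real" assume "W \<in> Lp_space \<infinity> T"
    from *[OF this, of R] obtain C M where C: "0 \<le> C" "0 \<le> M" "AE t in ?L. \<bar>W t\<bar> \<le> M"
      "AE t in ?L. \<forall>x u. norm x \<le> R \<longrightarrow> norm u \<le> W t \<longrightarrow> norm (G x u t) \<le> C"
      by blast
    have "AE t in ?L. \<forall>x u. norm x \<le> R \<longrightarrow> norm u \<le> W t \<longrightarrow> W t * norm (G x u t) \<le> M * C"
      using C(3,4)
    proof eventually_elim
      case (elim t)
      show ?case
      proof (intro allI impI)
        fix x :: "real^'d" and u :: "real^'m" assume x: "norm x \<le> R" "norm u \<le> W t"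
        show "W t * norm (G x u t) \<le> M * C"
          using elim x C(1,2) by (intro mult_mono) auto
      qed
    qed
    then show "\<exists>\<omega>. integrable ?L \<omega> \<and> (AE t in ?L. \<forall>x u. norm x \<le> R \<longrightarrow> norm u \<le> W t \<longrightarrow> W t * norm (G x u t) \<le> \<omega> t)"
      by (intro exI[of _ "\<lambda>_. M * C"]) simp
  qed
qed

text \<open>This is the case q = p. The control can be replaced by 0, so a bound on a compact set
  suffices, and \<open>W\<close> times a constant is integrable.\<close>

lemma control_independent_dominated:
  fixes G :: "real^'d \<Rightarrow> real^'m \<Rightarrow> real \<Rightarrow> 'k::euclidean_space"
  assumes q: "1 \<le> q" and G: "continuous_data T G" "\<And>x u v t. t \<in> {0..T} \<Longrightarrow> G x u t = G x v t"
  shows "dominated_control_data q T G"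
  unfolding dominated_control_data_def
proof (intro allI impI)
  let ?L = "lebesgue_on {0..T}"
  fix R and W :: "real \<Rightarrow> real" assume W: "W \<in> Lp_space q T"
  obtain C where C: "0 \<le> C" "\<forall>x u. \<forall>t\<in>{0..T}. norm x \<le> R \<longrightarrow> norm u \<le> 0 \<longrightarrow> norm (G x u t) \<le> C"
    by (rule continuous_data_bounded[OF G(1)])
  show "\<exists>\<omega>. integrable ?L \<omega> \<and> (AE t in ?L. \<forall>x u. norm x \<le> R \<longrightarrow> norm u \<le> W t \<longrightarrow> W t * norm (G x u t) \<le> \<omega> t)"
  proof (intro exI[of _ "\<lambda>t. W t * C"] conjI AE_I2 allI impI)
    show "integrable ?L (\<lambda>t. W t * C)" using Lp_space_imp_integrable[OF q W] by simp
    fix t x u assume t: "t \<in> space ?L" and x: "norm (x::real^'d) \<le> R" "norm (u::real^'m) \<le> W t"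
    have "G x u t = G x 0 t" using t by (intro G(2)) simp
    moreover have "norm (G x 0 t) \<le> C" using C(2) x(1) t by simp
    moreover have "0 \<le> W t" using x(2) norm_ge_zero order_trans by blast
    ultimately show "W t * norm (G x u t) \<le> W t * C" by (auto intro: mult_left_mono)
  qed
qed

section \<open>Continuity of superposition operators into L^p\<close>

text \<open>Neighbourhoods in X measure time derivatives in L^p, for which the L^1 estimates of the
  linearisation error are too weak. Continuity of the superposition operator closes the gap; it is
  dominated convergence for the p-th power of the difference.\<close>

lemma superposition_Lp_continuous_finite:
  fixes F :: "real^'d \<Rightarrow> real^'m \<Rightarrow> real \<Rightarrow> 'k::euclidean_space"
    and xr :: "real \<Rightarrow> real^'d" and ur :: "real \<Rightarrow> real^'m"
  assumes q: "1 \<le> q" and T: "0 < T" and p: "1 \<le> p"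
    and F: "continuous_data T F" "dominated_data q T (\<lambda>x u t. norm (F x u t) powr p)"
    and xr: "continuous_on {0..T} xr" and ur: "ur \<in> Lp_space q T" and \<delta>: "0 < (\<delta>::real)"
  shows "\<exists>\<rho>0>0. \<forall>u x. u \<in> Lp_space q T \<longrightarrow> Lp_norm q T (\<lambda>t. u t - ur t) \<le> \<rho>0 \<longrightarrow>
    x \<in> borel_measurable (lebesgue_on {0..T}) \<longrightarrow> (\<forall>t\<in>{0..T}. norm (x t - xr t) \<le> \<rho>0) \<longrightarrow>
    (\<lambda>t. F (x t) (u t) t - F (xr t) (ur t) t) \<in> Lp_space (ereal p) T \<and>
    Lp_norm (ereal p) T (\<lambda>t. F (x t) (u t) t - F (xr t) (ur t) t) \<le> \<delta>"
proof -
  let ?L = "lebesgue_on {0..T}"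
  define D where "D x u t = F (x t) (u t) t - F (xr t) (ur t) t" for x u t
  define P where "P \<rho> u r \<longleftrightarrow> 0 < \<rho> \<and> u \<in> Lp_space q T \<and> Lp_norm q T (\<lambda>t. u t - ur t) \<le> \<rho> \<and>
    (\<exists>x \<in> borel_measurable ?L. (\<forall>t\<in>{0..T}. norm (x t - xr t) \<le> \<rho>) \<and> r = (\<lambda>t. norm (D x u t) powr p))" for \<rho> u r
  have Tge: "0 \<le> T" using T by simp
  have AEt: "AE t in ?L. t \<in> {0..T}" by (rule AE_I2) simp
  have Dm: "D x u \<in> borel_measurable ?L" if "x \<in> borel_measurable ?L" "u \<in> Lp_space q T" for x u
    unfolding D_def[abs_def] using that ur
    by (intro borel_measurable_diff continuous_data_measurable[OF F(1) Tge] continuous_Icc_measurable[OF xr])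
      (auto dest: Lp_space_measurable)
  obtain R where R: "0 < R" "\<forall>t\<in>{0..T}. norm (xr t) \<le> R" by (rule continuous_on_Icc_bounded[OF xr])
  have "\<exists>\<rho>0>0. \<forall>\<rho> u r. \<rho> \<le> \<rho>0 \<longrightarrow> P \<rho> u r \<longrightarrow> integrable ?L r \<and> (LINT t|?L. \<bar>r t\<bar>) \<le> \<delta> powr p"
  proof (rule Lp_uniformly_small[OF q T ur])
    show "0 < \<delta> powr p" using \<delta> by simp
  next
    fix \<rho> u r assume "P \<rho> u r"
    then obtain x where *: "0 < \<rho>" "u \<in> Lp_space q T" "Lp_norm q T (\<lambda>t. u t - ur t) \<le> \<rho>" "x \<in> borel_measurable ?L"
      "r = (\<lambda>t. norm (D x u t) powr p)" unfolding P_def by blast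
    have [measurable]: "D x u \<in> borel_measurable ?L" using *(4,2) by (rule Dm)
    have "r \<in> borel_measurable ?L" unfolding *(5) by measurable
    then show "0 < \<rho> \<and> u \<in> Lp_space q T \<and> Lp_norm q T (\<lambda>t. u t - ur t) \<le> \<rho> \<and> r \<in> borel_measurable ?L"
      using * by blast
  next
    fix W :: "real \<Rightarrow> real" assume W: "W \<in> Lp_space q T"
    define W' where "W' t = norm (ur t) + \<bar>W t\<bar>" for t
    have "(\<lambda>t. \<bar>W t\<bar>) \<in> Lp_space q T" using Lp_space_norm[OF q W] by simp
    then have "W' \<in> Lp_space q T" unfolding W'_def[abs_def] by (rule Lp_space_add_norm[OF q ur])
    then obtain \<omega> where \<omega>: "integrable ?L \<omega>" "AE t in ?L. \<forall>x u. norm x \<le> R + 1 \<longrightarrow> norm u \<le> W' t \<longrightarrow>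
        norm (norm (F x u t) powr p) \<le> \<omega> t"
      using F(2) unfolding dominated_data_def by blast
    show "\<exists>\<omega>. integrable ?L \<omega> \<and> (\<forall>\<rho> u r. P \<rho> u r \<longrightarrow> \<rho> \<le> 1 \<longrightarrow>
      (AE t in ?L. norm (u t) \<le> W t) \<longrightarrow> (AE t in ?L. \<bar>r t\<bar> \<le> \<omega> t))"
    proof (intro exI[of _ "\<lambda>t. 2 powr p * (\<omega> t + \<omega> t)"] conjI allI impI)
      show "integrable ?L (\<lambda>t. 2 powr p * (\<omega> t + \<omega> t))" using \<omega>(1) by simp
      fix \<rho> u r assume "P \<rho> u r" "\<rho> \<le> 1" and uW: "AE t in ?L. norm (u t) \<le> W t"
      then obtain x where x: "\<forall>t\<in>{0..T}. norm (x t - xr t) \<le> \<rho>" and r: "r = (\<lambda>t. norm (D x u t) powr p)"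
        unfolding P_def by blast
      show "AE t in ?L. \<bar>r t\<bar> \<le> 2 powr p * (\<omega> t + \<omega> t)"
        using uW \<omega>(2) AEt
      proof eventually_elim
        case (elim t)
        have "norm (x t - xr t) \<le> 1" using x elim(3) \<open>\<rho> \<le> 1\<close> by force
        then have "norm (x t) \<le> R + 1" using norm_le_of_near R elim(3) by blast
        moreover have "norm (u t) \<le> W' t" using elim(1) norm_ge_zero[of "ur t"] abs_ge_self[of "W t"] unfolding W'_def by linarith
        ultimately have 1: "norm (F (x t) (u t) t) powr p \<le> \<omega> t" using elim(2) by simp
        have "norm (xr t) \<le> R + 1" using R elim(3) by force
        moreover have "norm (ur t) \<le> W' t" by (simp add: W'_def)
        ultimately have 2: "norm (F (xr t) (ur t) t) powr p \<le> \<omega> t" using elim(2) by simp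
        have "norm (D x u t) powr p \<le> (norm (F (x t) (u t) t) + norm (F (xr t) (ur t) t)) powr p"
          unfolding D_def using p by (intro powr_mono2 norm_triangle_ineq4) auto
        also have "\<dots> \<le> 2 powr p * (norm (F (x t) (u t) t) powr p + norm (F (xr t) (ur t) t) powr p)"
          using p by (intro powr_add_le) auto
        also have "\<dots> \<le> 2 powr p * (\<omega> t + \<omega> t)" using 1 2 by (intro mult_left_mono add_mono) auto
        finally show ?case by (simp add: r)
      qed
    qed
  next
    fix \<rho> :: "nat \<Rightarrow> real" and u r
    assume Pn: "\<And>n. P (\<rho> n) (u n) (r n)" and \<rho>: "\<rho> \<longlonglongrightarrow> 0" and u: "AE t in ?L. (\<lambda>n. u n t) \<longlonglongrightarrow> ur t"
    have "\<forall>n. \<exists>x. (\<forall>t\<in>{0..T}. norm (x t - xr t) \<le> \<rho> n) \<and> r n = (\<lambda>t. norm (D x (u n) t) powr p)"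
    proof
      fix n show "\<exists>x. (\<forall>t\<in>{0..T}. norm (x t - xr t) \<le> \<rho> n) \<and> r n = (\<lambda>t. norm (D x (u n) t) powr p)"
        using Pn[of n] unfolding P_def by blast
    qed
    from choice[OF this] obtain x where x: "\<forall>n. (\<forall>t\<in>{0..T}. norm (x n t - xr t) \<le> \<rho> n) \<and>
      r n = (\<lambda>t. norm (D (x n) (u n) t) powr p)" by blast
    show "AE t in ?L. (\<lambda>n. r n t) \<longlonglongrightarrow> 0"
      using u AEt
    proof eventually_elim
      case (elim t)
      have "(\<lambda>n. D (x n) (u n) t) \<longlonglongrightarrow> 0"
      proof (rule tendstoI)
        fix e :: real assume "0 < e"
        then have "0 < e / 2" by simp
        then obtain d where d: "0 < d" "\<forall>x u. norm (x - xr t) \<le> d \<longrightarrow> norm (u - ur t) \<le> d \<longrightarrow>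
            dist (F x u t) (F (xr t) (ur t) t) \<le> e / 2"
          by (rule continuous_data_at[OF F(1) elim(2)])
        have "\<forall>\<^sub>F n in sequentially. dist (u n t) (ur t) < d" using elim(1) d(1) by (rule tendstoD)
        moreover have "\<forall>\<^sub>F n in sequentially. \<rho> n < d" using \<rho> d(1) by (intro order_tendstoD(2))
        ultimately show "\<forall>\<^sub>F n in sequentially. dist (D (x n) (u n) t) 0 < e"
        proof eventually_elim
          case (elim n)
          have "norm (x n t - xr t) \<le> \<rho> n" using x \<open>t \<in> {0..T}\<close> by blast
          then have "norm (x n t - xr t) \<le> d" using elim by simp
          moreover have "norm (u n t - ur t) \<le> d" using elim by (simp add: dist_norm)
          ultimately have "dist (F (x n t) (u n t) t) (F (xr t) (ur t) t) \<le> e / 2" using d(2) by blast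
          then show ?case using \<open>0 < e\<close> by (simp add: D_def dist_norm)
        qed
      qed
      then have "(\<lambda>n. norm (D (x n) (u n) t)) \<longlonglongrightarrow> 0" by (rule tendsto_norm_zero)
      then have "(\<lambda>n. norm (D (x n) (u n) t) powr p) \<longlonglongrightarrow> 0 powr p"
        using p by (intro tendsto_powr2) auto
      then show ?case using x by simp
    qed
  qed
  then obtain \<rho>0 where \<rho>0: "0 < \<rho>0"
    "\<forall>\<rho> u r. \<rho> \<le> \<rho>0 \<longrightarrow> P \<rho> u r \<longrightarrow> integrable ?L r \<and> (LINT t|?L. \<bar>r t\<bar>) \<le> \<delta> powr p" by blast
  show ?thesis
  proof (intro exI[of _ \<rho>0] conjI allI impI)
    fix u x assume *: "u \<in> Lp_space q T" "Lp_norm q T (\<lambda>t. u t - ur t) \<le> \<rho>0"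
      "x \<in> borel_measurable ?L" "\<forall>t\<in>{0..T}. norm (x t - xr t) \<le> \<rho>0"
    have "P \<rho>0 u (\<lambda>t. norm (D x u t) powr p)" using * \<rho>0(1) unfolding P_def by blast
    then have i: "integrable ?L (\<lambda>t. norm (D x u t) powr p)" "(LINT t|?L. norm (D x u t) powr p) \<le> \<delta> powr p"
      using \<rho>0(2)[THEN spec, THEN spec, THEN spec, THEN mp, OF order_refl, of u "\<lambda>t. norm (D x u t) powr p"]
      by auto
    show "(\<lambda>t. F (x t) (u t) t - F (xr t) (ur t) t) \<in> Lp_space (ereal p) T"
      using i(1) Dm[OF *(3,1)] by (simp add: Lp_space_ereal_iff D_def[abs_def])
    show "Lp_norm (ereal p) T (\<lambda>t. F (x t) (u t) t - F (xr t) (ur t) t) \<le> \<delta>"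
      using i(2) p \<delta> by (simp add: Lp_norm_ereal_le_iff D_def)
  qed fact
qed

text \<open>Dominated convergence yields nothing in the essential supremum. Instead, almost all
  arguments lie in one compact set, on which \<open>F\<close> is uniformly continuous.\<close>

lemma superposition_Lp_continuous_infinity:
  fixes F :: "real^'d \<Rightarrow> real^'m \<Rightarrow> real \<Rightarrow> 'k::euclidean_space"
    and xr :: "real \<Rightarrow> real^'d" and ur :: "real \<Rightarrow> real^'m"
  assumes T: "0 < T" and F: "continuous_data T F"
    and xr: "continuous_on {0..T} xr" and ur: "ur \<in> Lp_space \<infinity> T" and \<delta>: "0 < (\<delta>::real)"
  shows "\<exists>\<rho>0>0. \<forall>u x. u \<in> Lp_space \<infinity> T \<longrightarrow> Lp_norm \<infinity> T (\<lambda>t. u t - ur t) \<le> \<rho>0 \<longrightarrow>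
    x \<in> borel_measurable (lebesgue_on {0..T}) \<longrightarrow> (\<forall>t\<in>{0..T}. norm (x t - xr t) \<le> \<rho>0) \<longrightarrow>
    (\<lambda>t. F (x t) (u t) t - F (xr t) (ur t) t) \<in> Lp_space \<infinity> T \<and>
    Lp_norm \<infinity> T (\<lambda>t. F (x t) (u t) t - F (xr t) (ur t) t) \<le> \<delta>"
proof -
  let ?L = "lebesgue_on {0..T}"
  have Tge: "0 \<le> T" using T by simp
  have AEt: "AE t in ?L. t \<in> {0..T}" by (rule AE_I2) simp
  obtain R where R: "0 < R" "\<forall>t\<in>{0..T}. norm (xr t) \<le> R" by (rule continuous_on_Icc_bounded[OF xr])
  obtain M where M: "0 \<le> M" "AE t in ?L. norm (ur t) \<le> M" using ur by (auto simp: Lp_space_infinity_iff)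
  let ?S = "cball (0::real^'d) (R + 1) \<times> cball (0::real^'m) (M + 1) \<times> {0..T}"
  have "compact ?S" by (intro compact_Times compact_cball compact_Icc)
  moreover have "continuous_on ?S (\<lambda>(x, u, t). F x u t)"
    using F[unfolded continuous_data_def] by (rule continuous_on_subset) auto
  ultimately have "uniformly_continuous_on ?S (\<lambda>(x, u, t). F x u t)"
    by (intro compact_uniformly_continuous)
  from uniformly_continuous_onE[OF this \<delta>] obtain d where d: "0 < d"
    "\<And>z z'. z \<in> ?S \<Longrightarrow> z' \<in> ?S \<Longrightarrow> dist z' z < d \<Longrightarrow>
      dist ((\<lambda>(x, u, t). F x u t) z') ((\<lambda>(x, u, t). F x u t) z) < \<delta>" by metis
  \<comment> \<open>A radius of at most 1 keeps perturbed pairs inside the compact set;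
    \<open>d / 3\<close> for the state and \<open>d / 3\<close> for the control add up to less than
    \<open>d\<close>.\<close>
  define \<rho>0 where "\<rho>0 = min 1 (d / 3)"
  have \<rho>0: "0 < \<rho>0" "\<rho>0 \<le> 1" "\<rho>0 \<le> d / 3" using d(1) by (auto simp: \<rho>0_def)
  show ?thesis
  proof (intro exI[of _ \<rho>0] conjI allI impI)
    fix u x assume *: "u \<in> Lp_space \<infinity> T" "Lp_norm \<infinity> T (\<lambda>t. u t - ur t) \<le> \<rho>0"
      "x \<in> borel_measurable ?L" "\<forall>t\<in>{0..T}. norm (x t - xr t) \<le> \<rho>0"
    have [measurable]: "u \<in> borel_measurable ?L" "ur \<in> borel_measurable ?L"
      using *(1) ur by (auto dest: Lp_space_measurable)
    have m: "(\<lambda>t. F (x t) (u t) t - F (xr t) (ur t) t) \<in> borel_measurable ?L"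
      using *(3) by (intro borel_measurable_diff continuous_data_measurable[OF F Tge] continuous_Icc_measurable[OF xr]) auto
    have dL: "(\<lambda>t. u t - ur t) \<in> Lp_space \<infinity> T"
      using * ur by (intro Lp_space_bound[OF _ *(1) ur, of _ 1]) (auto simp: norm_triangle_ineq4)
    have ae: "AE t in ?L. norm (F (x t) (u t) t - F (xr t) (ur t) t) \<le> \<delta>"
      using AE_norm_le_Lp_norm_infinity[OF T dL] M(2) AEt
    proof eventually_elim
      case (elim t)
      have du: "norm (u t - ur t) \<le> \<rho>0" using elim(1) *(2) by simp
      have dx: "norm (x t - xr t) \<le> \<rho>0" using *(4) elim(3) by blast
      have "norm (x t) \<le> R + \<rho>0" using norm_le_of_near[OF dx] R elim(3) by blast
      moreover have "norm (u t) \<le> M + \<rho>0" by (rule norm_le_of_near[OF du elim(2)])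
      ultimately have S: "(x t, u t, t) \<in> ?S" "(xr t, ur t, t) \<in> ?S"
        using elim \<rho>0(2) R(2) by (auto intro: order_trans[of _ R])
      have "dist (x t, u t, t) (xr t, ur t, t) \<le> dist (x t) (xr t) + dist (u t, t) (ur t, t)"
        by (simp add: dist_Pair_Pair sqrt_sum_squares_le_sum)
      also have "dist (u t, t) (ur t, t) = dist (u t) (ur t)" by (simp add: dist_Pair_Pair)
      also have "dist (x t) (xr t) + dist (u t) (ur t) < d"
        using du dx \<rho>0(1,3) by (simp add: dist_norm)
      finally show ?case using d(2)[OF S(2,1)] by (simp add: dist_norm)
    qed
    show "(\<lambda>t. F (x t) (u t) t - F (xr t) (ur t) t) \<in> Lp_space \<infinity> T"
      using m ae \<delta> by (auto simp: Lp_space_infinity_iff intro!: exI[of _ \<delta>])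
    show "Lp_norm \<infinity> T (\<lambda>t. F (x t) (u t) t - F (xr t) (ur t) t) \<le> \<delta>"
      by (rule Lp_norm_infinity_le[OF T m ae])
  qed fact
qed

section \<open>A perturbed linear integral equation\<close>

lemma bounded_bilinear_matrix_vector_mult:
  "bounded_bilinear ((*v) :: real^'n^'m \<Rightarrow> real^'n \<Rightarrow> real^'m)"
proof -
  have "bilinear ((*v) :: real^'n^'m \<Rightarrow> real^'n \<Rightarrow> real^'m)"
    unfolding bilinear_def
    by (auto intro!: linearI simp: matrix_vector_mult_add_rdistrib matrix_vector_right_distrib
        matrix_vector_mult_scaleR vec_eq_iff matrix_vector_mult_def sum_distrib_left mult.assoc sum.distrib distrib_right)
  then show ?thesis by (simp add: bilinear_conv_bounded_bilinear)
qed

lemma integrable_on_initial_interval: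
  fixes h :: "real \<Rightarrow> 'a::euclidean_space"
  assumes "integrable (lebesgue_on {0..T}) h" "\<tau> \<le> T"
  shows "h integrable_on {0..\<tau>}"
proof -
  have "h integrable_on {0..T}" using assms(1) by (intro integrable_on_lebesgue_on) auto
  then show ?thesis by (rule integrable_on_subinterval) (use assms(2) in auto)
qed

lemma norm_initial_integral_le:
  fixes h :: "real \<Rightarrow> 'a::euclidean_space"
  assumes h: "integrable (lebesgue_on {0..T}) h" and "\<tau> \<le> T"
  shows "norm (integral {0..\<tau>} h) \<le> (LINT t|lebesgue_on {0..T}. norm (h t))"
proof -
  have n: "integrable (lebesgue_on {0..T}) (\<lambda>t. norm (h t))" using h by simp
  have "norm (integral {0..\<tau>} h) \<le> integral {0..\<tau>} (\<lambda>t. norm (h t))"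
    using integrable_on_initial_interval[OF h \<open>\<tau> \<le> T\<close>] integrable_on_initial_interval[OF n \<open>\<tau> \<le> T\<close>]
    by (rule integral_norm_bound_integral) simp
  also have "\<dots> \<le> integral {0..T} (\<lambda>t. norm (h t))"
    using integrable_on_initial_interval[OF n \<open>\<tau> \<le> T\<close>] integrable_on_initial_interval[OF n order_refl] \<open>\<tau> \<le> T\<close>
    by (intro integral_subset_le) auto
  also have "\<dots> = (LINT t|lebesgue_on {0..T}. norm (h t))"
    using lebesgue_integral_eq_integral[OF n] by simp
  finally show ?thesis .
qed

text \<open>
  The Bielecki weight \<open>exp (\<mu> t)\<close> makes the linear part of the integral operator a contraction
  with constant \<open>a / \<mu> \<le> 1 / 4\<close>.
\<close>

lemma perturbed_linear_integral_equation:
  fixes A :: "real \<Rightarrow> real^'d^'d" and N :: "(real \<Rightarrow> real^'d) \<Rightarrow> real \<Rightarrow> real^'d"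
  assumes T: "0 < T" and A: "A \<in> borel_measurable (lebesgue_on {0..T})"
    and a: "0 \<le> a" "\<And>t y. norm (A t *v y) \<le> a * norm y" and \<mu>: "\<mu> = 4 * a + 4"
    and int: "\<And>y. continuous_on {0..T} y \<Longrightarrow> \<forall>t\<in>{0..T}. norm (y t) \<le> r0 \<Longrightarrow> integrable (lebesgue_on {0..T}) (N y)"
    and lip: "\<And>y z s. continuous_on {0..T} y \<Longrightarrow> continuous_on {0..T} z \<Longrightarrow>
      \<forall>t\<in>{0..T}. norm (y t) \<le> r0 \<Longrightarrow> \<forall>t\<in>{0..T}. norm (z t) \<le> r0 \<Longrightarrow> 0 < s \<Longrightarrow>
      \<forall>t\<in>{0..T}. norm (y t - z t) \<le> s \<Longrightarrow> (LINT t|lebesgue_on {0..T}. norm (N y t - N z t)) \<le> \<delta> * s"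
    and N0: "(LINT t|lebesgue_on {0..T}. norm (N (\<lambda>_. 0) t)) \<le> \<delta>'"
    and \<delta>: "0 \<le> \<delta>" "\<delta> * exp (\<mu> * T) \<le> 1 / 4" and \<delta>': "0 \<le> \<delta>'" "2 * exp (\<mu> * T) * \<delta>' \<le> r0"
  shows "\<exists>y. continuous_on {0..T} y \<and> (\<forall>t\<in>{0..T}. norm (y t) \<le> 2 * exp (\<mu> * T) * \<delta>') \<and>
    (\<forall>t\<in>{0..T}. y t = integral {0..t} (\<lambda>s. A s *v y s + N y s))"
proof -
  let ?L = "lebesgue_on {0..T}"
  have \<mu>0: "0 < \<mu>" using a(1) \<mu> by simp
  \<comment> \<open>Bounded continuous functions live on the whole line; clamping the time extends
    the integral operator constantly beyond the interval.\<close>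
  define c where "c t = max 0 (min T t)" for t
  have c: "c t \<in> {0..T}" "t \<in> {0..T} \<Longrightarrow> c t = t" for t using T by (auto simp: c_def)
  \<comment> \<open>The unknown of the fixed point problem is the solution divided by the weight, so
    the supremum norm of \<open>Y\<close> is the Bielecki norm of \<open>y Y\<close>.\<close>
  define y where "y Y t = exp (\<mu> * t) *\<^sub>R apply_bcontfun Y t" for Y :: "real \<Rightarrow>\<^sub>C (real^'d)" and t
  define G where "G Y s = A s *v y Y s + N (y Y) s" for Y s
  define \<Phi> where "\<Phi> Y = Bcontfun (\<lambda>t. exp (- \<mu> * c t) *\<^sub>R integral {0..c t} (G Y))" for Y
  \<comment> \<open>With contraction constant 1/2 and a start of norm at most
    \<open>\<delta>'\<close>, the ball of radius \<open>2 * \<delta>'\<close> is mapped into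
    itself.\<close>
  define B where "B = cball (0 :: real \<Rightarrow>\<^sub>C (real^'d)) (2 * \<delta>')"
  have ycont: "continuous_on {0..T} (y Y)" for Y
    unfolding y_def[abs_def] by (intro continuous_intros continuous_on_apply_bcontfun)
  have ymeas: "y Y \<in> borel_measurable ?L" for Y by (rule continuous_Icc_measurable[OF ycont])
  have expT: "exp (\<mu> * t) \<le> exp (\<mu> * T)" if "t \<in> {0..T}" for t
    using that \<mu>0 by simp
  have ydiff: "norm (y Y t - y Z t) \<le> exp (\<mu> * t) * dist Y Z" for Y Z t
  proof -
    have "y Y t - y Z t = exp (\<mu> * t) *\<^sub>R (apply_bcontfun Y t - apply_bcontfun Z t)"
      by (simp add: y_def scaleR_diff_right)
    then have "norm (y Y t - y Z t) = exp (\<mu> * t) * dist (apply_bcontfun Y t) (apply_bcontfun Z t)"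
      by (simp add: dist_norm)
    also have "\<dots> \<le> exp (\<mu> * t) * dist Y Z" by (intro mult_left_mono dist_bounded) auto
    finally show ?thesis .
  qed
  have y0: "y 0 = (\<lambda>_. 0)" by (simp add: y_def[abs_def])
  have ybound: "norm (y Y t) \<le> 2 * exp (\<mu> * T) * \<delta>'" if "Y \<in> B" "t \<in> {0..T}" for Y t
  proof -
    have "norm (y Y t) \<le> exp (\<mu> * t) * dist Y 0" using ydiff[of Y t 0] by (simp add: y0)
    also have "\<dots> \<le> exp (\<mu> * T) * (2 * \<delta>')"
      using that expT by (intro mult_mono) (auto simp: B_def dist_commute)
    finally show ?thesis by simp
  qed
  have yr0: "\<forall>t\<in>{0..T}. norm (y Y t) \<le> r0" if "Y \<in> B" for Y
    using ybound[OF that] \<delta>'(2) by fastforce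
  have intN: "integrable ?L (N (y Y))" if "Y \<in> B" for Y
    using int[OF ycont yr0[OF that]] .
  have intA: "integrable ?L (\<lambda>s. A s *v y Y s)" for Y
  proof -
    obtain R where R: "\<forall>t\<in>{0..T}. norm (y Y t) \<le> R" by (rule continuous_on_Icc_bounded[OF ycont])
    have m: "(\<lambda>s. A s *v y Y s) \<in> borel_measurable ?L"
      using A ymeas by (rule borel_measurable_continuous_Pair)
        (intro bounded_bilinear.continuous_on[OF bounded_bilinear_matrix_vector_mult] continuous_intros)
    have ae: "AE s in ?L. norm (A s *v y Y s) \<le> norm (a * R)"
    proof (rule AE_I2)
      fix s assume "s \<in> space ?L"
      then have "norm (A s *v y Y s) \<le> a * R"
        using a(2)[of s "y Y s"] mult_left_mono[of "norm (y Y s)" R a] a(1) R by fastforce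
      then show "norm (A s *v y Y s) \<le> norm (a * R)" by simp
    qed
    have "integrable ?L (\<lambda>_. a * R)" by simp
    from this m ae show ?thesis by (rule Bochner_Integration.integrable_bound)
  qed
  have intG: "integrable ?L (G Y)" if "Y \<in> B" for Y
    unfolding G_def[abs_def] using intA intN[OF that] by (rule Bochner_Integration.integrable_add)
  have \<Phi>: "apply_bcontfun (\<Phi> Y) t = exp (- \<mu> * c t) *\<^sub>R integral {0..c t} (G Y)" if "Y \<in> B" for Y t
  proof -
    have J: "continuous_on {0..T} (\<lambda>\<tau>. exp (- \<mu> * \<tau>) *\<^sub>R integral {0..\<tau>} (G Y))"
      using integrable_on_initial_interval[OF intG[OF that] order_refl]
      by (intro continuous_intros indefinite_integral_continuous_1)
    have "continuous_on UNIV (\<lambda>t. exp (- \<mu> * c t) *\<^sub>R integral {0..c t} (G Y))"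
    proof (rule continuous_on_compose2[OF J, of UNIV c])
      show "continuous_on UNIV c" unfolding c_def by (intro continuous_intros)
    qed (use c in auto)
    moreover have "bounded (range (\<lambda>t. exp (- \<mu> * c t) *\<^sub>R integral {0..c t} (G Y)))"
      using compact_imp_bounded[OF compact_continuous_image[OF J compact_Icc]]
      by (rule bounded_subset) (use c in auto)
    ultimately show ?thesis by (simp add: \<Phi>_def bcontfun_def Bcontfun_inverse)
  qed
  have \<Phi>_lip: "dist (\<Phi> Y) (\<Phi> Z) \<le> 1 / 2 * dist Y Z" if YZ: "Y \<in> B" "Z \<in> B" for Y Z
  proof (cases "Y = Z")
    case False
    define d where "d = dist Y Z"
    have d: "0 < d" using False by (simp add: d_def)
    show ?thesis
    proof (rule dist_bound)
      fix t
      let ?\<tau> = "c t"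
      have \<tau>: "0 \<le> ?\<tau>" "?\<tau> \<le> T" using c[of t] by auto
      let ?h = "\<lambda>s. N (y Y) s - N (y Z) s"
      have ih: "integrable ?L ?h" using intN YZ by simp
      have iA: "integrable ?L (\<lambda>s. A s *v y Y s - A s *v y Z s)" using intA by simp
      \<comment> \<open>The perturbation is controlled only in the mean over the whole interval and
        in the unweighted norm, so it gains nothing from the weight. Its constant
        \<open>\<delta>\<close> has to compensate the factor \<open>exp (\<mu> * T)\<close>.\<close>
      have "(LINT s|?L. norm (?h s)) \<le> \<delta> * (exp (\<mu> * T) * d)"
      proof (rule lip[OF ycont ycont yr0[OF YZ(1)] yr0[OF YZ(2)]])
        show "\<forall>t\<in>{0..T}. norm (y Y t - y Z t) \<le> exp (\<mu> * T) * d"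
          using ydiff[of Y _ Z] expT d by (auto simp: d_def intro!: order_trans[OF ydiff] mult_right_mono)
      qed (use d in simp)
      also have "\<dots> \<le> 1 / 4 * d"
        using mult_right_mono[OF \<delta>(2), of d] d by (simp add: mult.assoc)
      finally have h: "norm (integral {0..?\<tau>} ?h) \<le> d / 4"
        using norm_initial_integral_le[OF ih \<tau>(2)] by simp
      \<comment> \<open>Integrating the weight produces the factor \<open>1 / \<mu>\<close>, the
        source of the contraction of the linear part.\<close>
      have FTC: "((\<lambda>s. a * d * exp (\<mu> * s)) has_integral (a * d / \<mu> * exp (\<mu> * ?\<tau>) - a * d / \<mu> * exp (\<mu> * 0))) {0..?\<tau>}"
        using \<tau>(1)
      proof (rule fundamental_theorem_of_calculus)
        fix s :: real
        have "((\<lambda>s. a * d / \<mu> * exp (\<mu> * s)) has_real_derivative a * d / \<mu> * (exp (\<mu> * s) * \<mu>)) (at s within {0..?\<tau>})"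
          by (auto intro!: derivative_eq_intros)
        moreover have "a * d / \<mu> * (exp (\<mu> * s) * \<mu>) = a * d * exp (\<mu> * s)" using \<mu>0 by simp
        ultimately show "((\<lambda>s. a * d / \<mu> * exp (\<mu> * s)) has_vector_derivative a * d * exp (\<mu> * s)) (at s within {0..?\<tau>})"
          by (simp add: has_real_derivative_iff_has_vector_derivative)
      qed
      have "norm (integral {0..?\<tau>} (\<lambda>s. A s *v y Y s - A s *v y Z s)) \<le> integral {0..?\<tau>} (\<lambda>s. a * d * exp (\<mu> * s))"
      proof (rule integral_norm_bound_integral)
        show "(\<lambda>s. A s *v y Y s - A s *v y Z s) integrable_on {0..?\<tau>}"
          by (rule integrable_on_initial_interval[OF iA \<tau>(2)])
        show "(\<lambda>s. a * d * exp (\<mu> * s)) integrable_on {0..?\<tau>}" using FTC by blast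
        fix s
        have "norm (A s *v y Y s - A s *v y Z s) \<le> a * norm (y Y s - y Z s)"
          using a(2)[of s "y Y s - y Z s"] by (simp add: matrix_vector_mult_diff_distrib)
        also have "\<dots> \<le> a * (exp (\<mu> * s) * d)" using ydiff[of Y s Z] a(1) by (intro mult_left_mono) (auto simp: d_def)
        finally show "norm (A s *v y Y s - A s *v y Z s) \<le> a * d * exp (\<mu> * s)" by (simp add: mult_ac)
      qed
      also have "\<dots> = a * d / \<mu> * exp (\<mu> * ?\<tau>) - a * d / \<mu> * exp (\<mu> * 0)"
        using FTC by (rule integral_unique)
      also have "\<dots> \<le> a / \<mu> * (d * exp (\<mu> * ?\<tau>))"
      proof -
        have "0 \<le> a * d / \<mu> * exp (\<mu> * 0)" using a(1) d \<mu>0 by simp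
        moreover have "a / \<mu> * (d * exp (\<mu> * ?\<tau>)) = a * d / \<mu> * exp (\<mu> * ?\<tau>)"
          by (simp only: times_divide_eq_left mult.assoc)
        ultimately show ?thesis by linarith
      qed
      also have "\<dots> \<le> 1 / 4 * (d * exp (\<mu> * ?\<tau>))"
        using \<mu> a(1) d by (intro mult_right_mono) (auto simp: divide_le_eq)
      finally have A: "norm (integral {0..?\<tau>} (\<lambda>s. A s *v y Y s - A s *v y Z s)) \<le> d / 4 * exp (\<mu> * ?\<tau>)" by simp
      have "integral {0..?\<tau>} (G Y) - integral {0..?\<tau>} (G Z) = integral {0..?\<tau>} (\<lambda>s. G Y s - G Z s)"
        using integrable_on_initial_interval[OF intG \<tau>(2)] YZ by (intro integral_diff[symmetric])
      also have "\<dots> = integral {0..?\<tau>} (\<lambda>s. (A s *v y Y s - A s *v y Z s) + ?h s)"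
        by (rule arg_cong[of _ _ "integral {0..?\<tau>}"]) (simp add: G_def fun_eq_iff)
      also have "\<dots> = integral {0..?\<tau>} (\<lambda>s. A s *v y Y s - A s *v y Z s) + integral {0..?\<tau>} ?h"
        using integrable_on_initial_interval[OF iA \<tau>(2)] integrable_on_initial_interval[OF ih \<tau>(2)]
        by (rule integral_add)
      finally have eq: "integral {0..?\<tau>} (G Y) - integral {0..?\<tau>} (G Z) =
        integral {0..?\<tau>} (\<lambda>s. A s *v y Y s - A s *v y Z s) + integral {0..?\<tau>} ?h" .
      have n: "norm (integral {0..?\<tau>} (G Y) - integral {0..?\<tau>} (G Z)) \<le> d / 4 * exp (\<mu> * ?\<tau>) + d / 4"
        unfolding eq using A h by (intro norm_triangle_le add_mono)
      have "d / 4 \<le> d / 4 * exp (\<mu> * ?\<tau>)" using d \<tau>(1) \<mu>0 by simp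
      with n have "norm (integral {0..?\<tau>} (G Y) - integral {0..?\<tau>} (G Z)) \<le> d / 2 * exp (\<mu> * ?\<tau>)" by linarith
      then have "exp (- \<mu> * ?\<tau>) * norm (integral {0..?\<tau>} (G Y) - integral {0..?\<tau>} (G Z))
        \<le> exp (- \<mu> * ?\<tau>) * (d / 2 * exp (\<mu> * ?\<tau>))" by (intro mult_left_mono) auto
      also have "\<dots> = d / 2" by (simp add: exp_minus)
      finally show "dist (apply_bcontfun (\<Phi> Y) t) (apply_bcontfun (\<Phi> Z) t) \<le> 1 / 2 * dist Y Z"
        using YZ by (simp add: \<Phi> dist_norm d_def flip: scaleR_diff_right)
    qed
  qed simp
  have zB: "0 \<in> B" using \<delta>'(1) by (simp add: B_def)
  have \<Phi>0: "dist (\<Phi> 0) 0 \<le> \<delta>'"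
  proof (rule dist_bound)
    fix t
    have \<tau>: "0 \<le> c t" "c t \<le> T" using c[of t] by auto
    have "norm (integral {0..c t} (G 0)) \<le> (LINT s|?L. norm (G 0 s))"
      using norm_initial_integral_le[OF intG[OF zB] \<tau>(2)] .
    also have "\<dots> \<le> \<delta>'" using N0 by (simp add: G_def y0)
    finally have "exp (- \<mu> * c t) * norm (integral {0..c t} (G 0)) \<le> 1 * \<delta>'"
      using \<mu>0 \<tau>(1) by (intro mult_mono) auto
    then show "dist (apply_bcontfun (\<Phi> 0) t) (apply_bcontfun 0 t) \<le> \<delta>'"
      using zB by (simp add: \<Phi>)
  qed
  have "\<exists>!Y\<in>B. \<Phi> Y = Y"
  proof (rule Banach_fix[of B "1 / 2"])
    show "complete B" unfolding B_def by (intro closed_cball complete_eq_closed[THEN iffD2])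
    show "\<Phi> ` B \<subseteq> B"
    proof
      fix X assume "X \<in> \<Phi> ` B"
      then obtain Y where Y: "Y \<in> B" "X = \<Phi> Y" by blast
      have "dist (\<Phi> Y) 0 \<le> dist (\<Phi> Y) (\<Phi> 0) + dist (\<Phi> 0) 0" by (rule dist_triangle)
      also have "\<dots> \<le> 1 / 2 * dist Y 0 + \<delta>'" using \<Phi>_lip[OF Y(1) zB] \<Phi>0 by simp
      also have "\<dots> \<le> 2 * \<delta>'" using Y(1) by (simp add: B_def dist_commute)
      finally show "X \<in> B" using Y(2) by (simp add: B_def dist_commute)
    qed
  qed (use zB \<Phi>_lip in auto)
  then obtain Y where Y: "Y \<in> B" "\<Phi> Y = Y" by blast
  have "y Y t = integral {0..t} (\<lambda>s. A s *v y Y s + N (y Y) s)" if t: "t \<in> {0..T}" for t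
  proof -
    have "apply_bcontfun Y t = exp (- \<mu> * t) *\<^sub>R integral {0..t} (G Y)"
      using \<Phi>[OF Y(1), of t] c(2)[OF t] Y(2) by simp
    then show ?thesis by (simp add: y_def[of Y t] G_def[abs_def] flip: exp_add)
  qed
  then show ?thesis using ycont ybound[OF Y(1)] by blast
qed

text \<open>Lebesgue measure is complete, so a change on a null set preserves measurability. It is
  needed for time derivatives, whose formulas hold only almost everywhere.\<close>

lemma borel_measurable_lebesgue_on_AE:
  fixes f g :: "real \<Rightarrow> 'a::euclidean_space"
  assumes f: "f \<in> borel_measurable (lebesgue_on {0..T})" and ae: "AE t in lebesgue_on {0..T}. f t = g t"
  shows "g \<in> borel_measurable (lebesgue_on {0..T})"
proof -
  have "AE t in lebesgue. t \<in> {0..T} \<longrightarrow> f t = g t"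
    using ae by (subst (asm) AE_restrict_space_iff) auto
  then have "AE t in lebesgue. (if t \<in> {0..T} then f t else 0) = (if t \<in> {0..T} then g t else 0)"
    by eventually_elim auto
  moreover have "(\<lambda>t. if t \<in> {0..T} then f t else 0) \<in> borel_measurable lebesgue"
    using f by (subst borel_measurable_if) auto
  ultimately have "(\<lambda>t. if t \<in> {0..T} then g t else 0) \<in> borel_measurable lebesgue"
    by (rule borel_measurable_AE[rotated])
  then show ?thesis by (subst (asm) borel_measurable_if) auto
qed

lemma abs_continuous_on_zero: "abs_continuous_on T (\<lambda>_. 0)"
  unfolding abs_continuous_on_def by (auto intro: exI[of _ 1])

lemma abs_continuous_on_sum:
  assumes "\<And>i. i \<in> I \<Longrightarrow> abs_continuous_on T (x i)"
  shows "abs_continuous_on T (\<lambda>t. \<Sum>i\<in>I. x i t)"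
  using assms
  by (induction I rule: infinite_finite_induct) (auto intro: abs_continuous_on_add abs_continuous_on_zero)

lemma abs_continuous_on_initial_integral:
  fixes G :: "real \<Rightarrow> 'a::euclidean_space"
  assumes G: "integrable (lebesgue_on {0..T}) G" and y: "\<And>t. t \<in> {0..T} \<Longrightarrow> y t = integral {0..t} G"
  shows "abs_continuous_on T y"
    "AE t in lebesgue_on {0..T}. (y has_vector_derivative G t) (at t within {0..T})"
proof -
  show "abs_continuous_on T y"
    using abs_continuous_on_integral[OF G] by (rule abs_continuous_on_cong) (simp add: y)
  have "AE t in lebesgue_on {0..T}. t \<in> {0..T}" by (rule AE_I2) simp
  with integral_has_vector_derivative_AE[OF integrable_on_initial_interval[OF G order_refl]]
  show "AE t in lebesgue_on {0..T}. (y has_vector_derivative G t) (at t within {0..T})"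
  proof eventually_elim
    case (elim t)
    show ?case by (rule has_vector_derivative_transform[OF elim(2) _ elim(1)]) (simp add: y)
  qed
qed

section \<open>State constraints\<close>

text \<open>
  A step along \<open>h\<close> decreases every almost active constraint at a uniform rate, so a step of length
  proportional to the violation restores feasibility.
\<close>

lemma single_constraint_restoration:
  fixes g :: "real^'d \<Rightarrow> real \<Rightarrow> real" and xr h :: "real \<Rightarrow> real^'d"
  assumes T: "0 < T" and xr: "continuous_on {0..T} xr" and h: "continuous_on {0..T} h"
    and g: "continuous_on (UNIV \<times> {0..T}) (\<lambda>(x, t). g x t)"
    and diff: "\<And>x t. t \<in> {0..T} \<Longrightarrow> (\<lambda>y. g y t) differentiable (at x)"
    and grad: "continuous_on (UNIV \<times> {0..T}) (\<lambda>(x, t). gradient (\<lambda>y. g y t) x)"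
    and feas: "\<And>t. t \<in> {0..T} \<Longrightarrow> g (xr t) t \<le> 0"
    and active: "\<And>t. t \<in> {0..T} \<Longrightarrow> g (xr t) t = 0 \<Longrightarrow> inner (gradient (\<lambda>y. g y t) (xr t)) (h t) < 0"
  shows "\<exists>e>0. \<forall>t\<in>{0..T}. \<forall>x z \<epsilon>. norm (x - xr t) \<le> e \<longrightarrow> norm (x + z - xr t) \<le> e \<longrightarrow> 0 \<le> \<epsilon> \<longrightarrow>
    norm (z - \<epsilon> *\<^sub>R h t) \<le> e * \<epsilon> \<longrightarrow> g x t \<le> e * \<epsilon> \<longrightarrow> g (x + z) t \<le> 0"
proof -
  define D where "D x t = gradient (\<lambda>y. g y t) x" for x t
  have pair: "continuous_on {0..T} (\<lambda>t. (xr t, t))" using xr by (intro continuous_intros)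
  have img: "(\<lambda>t. (xr t, t)) ` {0..T} \<subseteq> UNIV \<times> {0..T}" by auto
  have gc: "continuous_on {0..T} (\<lambda>t. g (xr t) t)"
    using continuous_on_compose2[OF g pair img] by simp
  have Dc: "continuous_on {0..T} (\<lambda>t. D (xr t) t)"
    using continuous_on_compose2[OF grad pair img] by (simp add: D_def)
  obtain R where R: "0 < R" "\<forall>t\<in>{0..T}. norm (xr t) \<le> R" by (rule continuous_on_Icc_bounded[OF xr])
  obtain H where H: "0 < H" "\<forall>t\<in>{0..T}. norm (h t) \<le> H" by (rule continuous_on_Icc_bounded[OF h])
  obtain \<Gamma> where \<Gamma>: "0 < \<Gamma>" "\<forall>t\<in>{0..T}. norm (D (xr t) t) \<le> \<Gamma>" by (rule continuous_on_Icc_bounded[OF Dc])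
  \<comment> \<open>Positivity of \<open>m t\<close> says that at time \<open>t\<close> the
    constraint is inactive or strictly decreases along \<open>h\<close>. Compactness turns this
    pointwise alternative into a uniform margin \<open>2 * \<eta>\<close>.\<close>
  define m where "m t = max (- g (xr t) t) (- inner (D (xr t) t) (h t))" for t
  have "continuous_on {0..T} m"
    unfolding m_def using gc Dc h by (intro continuous_intros)
  then obtain t0 where t0: "t0 \<in> {0..T}" "\<forall>t\<in>{0..T}. m t0 \<le> m t"
    using continuous_attains_inf[of "{0..T}" m] T by auto
  define \<eta> where "\<eta> = m t0 / 2"
  have "0 < m t0"
    using feas[OF t0(1)] active[OF t0(1)] by (cases "g (xr t0) t0 = 0") (auto simp: m_def D_def less_max_iff_disj)
  then have \<eta>: "0 < \<eta>" by (simp add: \<eta>_def)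
  have alt: "g (xr t) t \<le> - 2 * \<eta> \<or> inner (D (xr t) t) (h t) \<le> - 2 * \<eta>" if "t \<in> {0..T}" for t
  proof -
    have "2 * \<eta> \<le> m t" using t0(2) that by (simp add: \<eta>_def)
    then show ?thesis unfolding m_def by linarith
  qed
  \<comment> \<open>The increment \<open>z\<close> will have norm at most
    \<open>\<epsilon> * (H + 1)\<close>, so a variation of the gradient by \<open>\<kappa>\<close>
    costs at most \<open>\<epsilon> * (\<eta> / 2)\<close>.\<close>
  define \<kappa> where "\<kappa> = \<eta> / (2 * (H + 1))"
  have \<kappa>: "0 < \<kappa>" using \<eta> H(1) by (simp add: \<kappa>_def)
  let ?S = "cball (0::real^'d) (R + 1) \<times> {0..T}"
  have S: "compact ?S" by (intro compact_Times compact_cball compact_Icc)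
  have "uniformly_continuous_on ?S (\<lambda>(x, t). g x t)"
    using S by (intro compact_uniformly_continuous continuous_on_subset[OF g]) auto
  from uniformly_continuous_onE[OF this, of "2 * \<eta>"] \<eta> obtain d1 where d1: "0 < d1"
    "\<And>z z'. z \<in> ?S \<Longrightarrow> z' \<in> ?S \<Longrightarrow> dist z' z < d1 \<Longrightarrow> dist ((\<lambda>(x, t). g x t) z') ((\<lambda>(x, t). g x t) z) < 2 * \<eta>"
    by (metis mult_pos_pos zero_less_numeral)
  have "uniformly_continuous_on ?S (\<lambda>(x, t). D x t)"
    unfolding D_def using S by (intro compact_uniformly_continuous continuous_on_subset[OF grad]) auto
  from uniformly_continuous_onE[OF this \<kappa>] obtain d2 where d2: "0 < d2"
    "\<And>z z'. z \<in> ?S \<Longrightarrow> z' \<in> ?S \<Longrightarrow> dist z' z < d2 \<Longrightarrow> dist ((\<lambda>(x, t). D x t) z') ((\<lambda>(x, t). D x t) z) < \<kappa>"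
    by metis
  \<comment> \<open>The term with \<open>\<Gamma>\<close> absorbs two losses: the initial violation
    \<open>e * \<epsilon>\<close>, and the deviation \<open>e * \<epsilon>\<close> of
    \<open>z\<close> from the step along \<open>h\<close>, multiplied by the gradient bound.
    Together they are at most \<open>\<epsilon> * \<eta>\<close>.\<close>
  define e where "e = min (min 1 (min (d1 / 2) (d2 / 2))) (\<eta> / (1 + \<Gamma>))"
  have e: "0 < e" "e \<le> 1" "e < d1" "e < d2" "e * (1 + \<Gamma>) \<le> \<eta>"
  proof -
    show "0 < e" using \<eta> d1(1) d2(1) \<Gamma>(1) by (simp add: e_def)
    have "e \<le> 1" "e \<le> d1 / 2" "e \<le> d2 / 2" unfolding e_def by linarith+
    then show "e \<le> 1" "e < d1" "e < d2" using d1(1) d2(1) by auto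
    have "e \<le> \<eta> / (1 + \<Gamma>)" by (simp add: e_def)
    then show "e * (1 + \<Gamma>) \<le> \<eta>" using \<Gamma>(1) by (simp add: pos_le_divide_eq)
  qed
  have near: "(x, t) \<in> ?S \<and> (xr t, t) \<in> ?S \<and> dist (x, t) (xr t, t) = norm (x - xr t)"
    if "t \<in> {0..T}" "norm (x - xr t) \<le> e" for x t
  proof -
    have "norm x \<le> R + e" using norm_le_of_near[OF that(2)] R(2) that(1) by blast
    moreover have "norm (xr t) \<le> R + 1" using R(2) that(1) by fastforce
    ultimately show ?thesis using that e(2) by (simp add: dist_Pair_Pair dist_norm)
  qed
  show ?thesis
  proof (intro exI[of _ e] conjI ballI allI impI)
    fix t x z and \<epsilon> :: real
    assume t: "t \<in> {0..T}" and x: "norm (x - xr t) \<le> e" and xz: "norm (x + z - xr t) \<le> e" and \<epsilon>: "0 \<le> \<epsilon>"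
      and z: "norm (z - \<epsilon> *\<^sub>R h t) \<le> e * \<epsilon>" and gx: "g x t \<le> e * \<epsilon>"
    consider "g (xr t) t \<le> - 2 * \<eta>" | "inner (D (xr t) t) (h t) \<le> - 2 * \<eta>" using alt[OF t] by blast
    then show "g (x + z) t \<le> 0"
    proof cases
      case 1
      \<comment> \<open>Where the constraint has the margin \<open>2 * \<eta>\<close> at the
        reference, uniform continuity suffices and no descent along \<open>h\<close> is
        needed.\<close>
      have "dist (g (x + z) t) (g (xr t) t) < 2 * \<eta>"
        using d1(2)[of "(xr t, t)" "(x + z, t)"] near[OF t xz] xz e(3) by simp
      with 1 show ?thesis by (simp add: dist_real_def)
    next
      case 2
      have zle: "norm z \<le> \<epsilon> * (H + 1)"
      proof -
        have "norm z \<le> norm (\<epsilon> *\<^sub>R h t) + e * \<epsilon>" by (rule norm_le_of_near[OF z order_refl])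
        also have "\<dots> \<le> \<epsilon> * H + 1 * \<epsilon>" using \<epsilon> H(2) t e(2) by (intro add_mono mult_right_mono) (auto intro: mult_left_mono)
        finally show ?thesis by (simp add: algebra_simps)
      qed
      have "norm (g (x + z) t - g x t - inner (D (xr t) t) (x + z - x)) \<le> 1 * (\<kappa> * norm z)"
      proof (rule linearization_error_bound[where D = "\<lambda>\<xi>. D \<xi> t" and f = "\<lambda>y. g y t" and pr = inner])
        fix \<xi> assume \<xi>: "\<xi> \<in> closed_segment (x + z) x"
        have "GDERIV (\<lambda>y. g y t) \<xi> :> D \<xi> t" unfolding D_def by (rule gradient_works[OF diff[OF t]])
        then show "((\<lambda>y. g y t) has_derivative inner (D \<xi> t)) (at \<xi>)"
          by (simp add: gderiv_def inner_commute[of _ "D \<xi> t"])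
        have "norm (\<xi> - xr t) \<le> e" by (rule norm_segment_le[OF \<xi> xz x])
        then have "dist (D \<xi> t) (D (xr t) t) < \<kappa>"
          using d2(2)[of "(xr t, t)" "(\<xi>, t)"] near[OF t] e(4) by auto
        then show "norm (D \<xi> t - D (xr t) t) * norm (x + z - x) \<le> \<kappa> * norm z"
          by (intro mult_mono') (auto simp: dist_norm)
      qed (use \<kappa> in \<open>auto simp: bounded_bilinear_inner Cauchy_Schwarz_ineq2\<close>)
      then have 3: "g (x + z) t \<le> g x t + inner (D (xr t) t) z + \<kappa> * norm z" by (simp add: abs_le_iff)
      have "inner (D (xr t) t) z = \<epsilon> * inner (D (xr t) t) (h t) + inner (D (xr t) t) (z - \<epsilon> *\<^sub>R h t)"
        by (simp add: inner_diff_right)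
      also have "\<epsilon> * inner (D (xr t) t) (h t) \<le> \<epsilon> * (- 2 * \<eta>)" using 2 \<epsilon> by (intro mult_left_mono) auto
      also have "inner (D (xr t) t) (z - \<epsilon> *\<^sub>R h t) \<le> \<Gamma> * (e * \<epsilon>)"
      proof -
        have "inner (D (xr t) t) (z - \<epsilon> *\<^sub>R h t) \<le> norm (D (xr t) t) * norm (z - \<epsilon> *\<^sub>R h t)"
          by (rule norm_cauchy_schwarz)
        also have "\<dots> \<le> \<Gamma> * (e * \<epsilon>)" using \<Gamma> t z by (intro mult_mono) auto
        finally show ?thesis .
      qed
      finally have 4: "inner (D (xr t) t) z \<le> \<epsilon> * (- 2 * \<eta>) + \<Gamma> * (e * \<epsilon>)" by simp
      have "\<kappa> * norm z \<le> \<kappa> * (\<epsilon> * (H + 1))" using zle \<kappa> by (intro mult_left_mono) auto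
      also have "\<dots> = \<epsilon> * (\<eta> / 2)" using H(1) by (simp add: \<kappa>_def field_simps)
      finally have 5: "\<kappa> * norm z \<le> \<epsilon> * (\<eta> / 2)" .
      have "e * \<epsilon> + \<Gamma> * (e * \<epsilon>) = \<epsilon> * (e * (1 + \<Gamma>))" by (simp add: algebra_simps)
      also have "\<dots> \<le> \<epsilon> * \<eta>" using e(5) \<epsilon> by (intro mult_left_mono)
      finally have 6: "e * \<epsilon> + \<Gamma> * (e * \<epsilon>) \<le> \<epsilon> * \<eta>" .
      \<comment> \<open>The gain \<open>2 * (\<epsilon> * \<eta>)\<close> of the descent exceeds the
        losses, which are \<open>\<epsilon> * \<eta>\<close> by fact \<open>6\<close> and half of
        that by fact \<open>5\<close>.\<close>
      have "0 \<le> \<epsilon> * \<eta>" using \<epsilon> \<eta> by simp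
      moreover have "\<epsilon> * (- 2 * \<eta>) = - 2 * (\<epsilon> * \<eta>)" "\<epsilon> * (\<eta> / 2) = (\<epsilon> * \<eta>) / 2" by auto
      ultimately show ?thesis using 3 4 5 6 gx by linarith
    qed
  qed fact
qed

lemma finite_uniform_radius:
  assumes "finite J" "\<And>j. j \<in> J \<Longrightarrow> \<exists>e>0. Q j (e::real)" "\<And>j e e'. Q j e \<Longrightarrow> 0 < e' \<Longrightarrow> e' \<le> e \<Longrightarrow> Q j e'"
  shows "\<exists>e>0. \<forall>j\<in>J. Q j e"
  using assms(1,2)
proof (induction J)
  case empty show ?case by (auto intro: exI[of _ 1])
next
  case (insert j J)
  then obtain e1 e2 where e: "0 < e1" "Q j e1" "0 < e2" "\<forall>j\<in>J. Q j e2" by (metis insertCI)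
  show ?case
  proof (intro exI[of _ "min e1 e2"] conjI ballI)
    fix k assume "k \<in> insert j J"
    then show "Q k (min e1 e2)" using e by (auto intro: assms(3))
  qed (use e in auto)
qed

lemma constraints_restoration:
  fixes g :: "nat \<Rightarrow> real^'d \<Rightarrow> real \<Rightarrow> real" and xr h :: "real \<Rightarrow> real^'d"
  assumes T: "0 < T" and J: "finite J" and xr: "continuous_on {0..T} xr" and h: "continuous_on {0..T} h"
    and g: "\<And>j. j \<in> J \<Longrightarrow> continuous_on (UNIV \<times> {0..T}) (\<lambda>(x, t). g j x t)"
    and diff: "\<And>j x t. j \<in> J \<Longrightarrow> t \<in> {0..T} \<Longrightarrow> (\<lambda>y. g j y t) differentiable (at x)"
    and grad: "\<And>j. j \<in> J \<Longrightarrow> continuous_on (UNIV \<times> {0..T}) (\<lambda>(x, t). gradient (\<lambda>y. g j y t) x)"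
    and feas: "\<And>j t. j \<in> J \<Longrightarrow> t \<in> {0..T} \<Longrightarrow> g j (xr t) t \<le> 0"
    and active: "\<And>j t. j \<in> J \<Longrightarrow> t \<in> {0..T} \<Longrightarrow> g j (xr t) t = 0 \<Longrightarrow>
      inner (gradient (\<lambda>y. g j y t) (xr t)) (h t) < 0"
  shows "\<exists>e>0. \<forall>j\<in>J. \<forall>t\<in>{0..T}. \<forall>x z \<epsilon>. norm (x - xr t) \<le> e \<longrightarrow> norm (x + z - xr t) \<le> e \<longrightarrow> 0 \<le> \<epsilon> \<longrightarrow>
    norm (z - \<epsilon> *\<^sub>R h t) \<le> e * \<epsilon> \<longrightarrow> g j x t \<le> e * \<epsilon> \<longrightarrow> g j (x + z) t \<le> 0"
proof (rule finite_uniform_radius[OF J])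
  show "\<exists>e>0. \<forall>t\<in>{0..T}. \<forall>x z \<epsilon>. norm (x - xr t) \<le> e \<longrightarrow> norm (x + z - xr t) \<le> e \<longrightarrow> 0 \<le> \<epsilon> \<longrightarrow>
    norm (z - \<epsilon> *\<^sub>R h t) \<le> e * \<epsilon> \<longrightarrow> g j x t \<le> e * \<epsilon> \<longrightarrow> g j (x + z) t \<le> 0" if "j \<in> J" for j
    using single_constraint_restoration[OF T xr h g[OF that] diff[OF that] grad[OF that] feas[OF that] active[OF that]]
    by blast
next
  fix j and e e' :: real
  assume Q: "\<forall>t\<in>{0..T}. \<forall>x z \<epsilon>. norm (x - xr t) \<le> e \<longrightarrow> norm (x + z - xr t) \<le> e \<longrightarrow> 0 \<le> \<epsilon> \<longrightarrow>
    norm (z - \<epsilon> *\<^sub>R h t) \<le> e * \<epsilon> \<longrightarrow> g j x t \<le> e * \<epsilon> \<longrightarrow> g j (x + z) t \<le> 0" and e': "0 < e'" "e' \<le> e"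
  show "\<forall>t\<in>{0..T}. \<forall>x z \<epsilon>. norm (x - xr t) \<le> e' \<longrightarrow> norm (x + z - xr t) \<le> e' \<longrightarrow> 0 \<le> \<epsilon> \<longrightarrow>
    norm (z - \<epsilon> *\<^sub>R h t) \<le> e' * \<epsilon> \<longrightarrow> g j x t \<le> e' * \<epsilon> \<longrightarrow> g j (x + z) t \<le> 0"
  proof (intro ballI allI impI)
    fix t x z and \<epsilon> :: real
    assume *: "t \<in> {0..T}" "norm (x - xr t) \<le> e'" "norm (x + z - xr t) \<le> e'" "0 \<le> \<epsilon>"
      "norm (z - \<epsilon> *\<^sub>R h t) \<le> e' * \<epsilon>" "g j x t \<le> e' * \<epsilon>"
    have "e' * \<epsilon> \<le> e * \<epsilon>" using e'(2) *(4) by (intro mult_right_mono)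
    then show "g j (x + z) t \<le> 0"
      using * e'(2) by (intro Q[rule_format, of t x z \<epsilon>]) auto
  qed
qed

text \<open>The step that restores the constraints is proportional to the violation, so the
  violation must be small before the step falls into the range in which corrections exist.\<close>

lemma constraints_nearly_satisfied:
  fixes g :: "nat \<Rightarrow> real^'d \<Rightarrow> real \<Rightarrow> real" and xr :: "real \<Rightarrow> real^'d"
  assumes J: "finite J" and xr: "continuous_on {0..T} xr"
    and g: "\<And>j. j \<in> J \<Longrightarrow> continuous_on (UNIV \<times> {0..T}) (\<lambda>(x, t). g j x t)"
    and feas: "\<And>j t. j \<in> J \<Longrightarrow> t \<in> {0..T} \<Longrightarrow> g j (xr t) t \<le> 0" and s: "0 < (s::real)"
  shows "\<exists>e>0. \<forall>j\<in>J. \<forall>t\<in>{0..T}. \<forall>x. norm (x - xr t) \<le> e \<longrightarrow> g j x t \<le> s"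
proof (rule finite_uniform_radius[OF J])
  fix j assume j: "j \<in> J"
  obtain R where R: "0 < R" "\<forall>t\<in>{0..T}. norm (xr t) \<le> R" by (rule continuous_on_Icc_bounded[OF xr])
  let ?S = "cball (0::real^'d) (R + 1) \<times> {0..T}"
  have S: "compact ?S" by (intro compact_Times compact_cball compact_Icc)
  have "uniformly_continuous_on ?S (\<lambda>(x, t). g j x t)"
    using S by (intro compact_uniformly_continuous continuous_on_subset[OF g[OF j]]) auto
  from uniformly_continuous_onE[OF this s] obtain d where d: "0 < d"
    "\<And>z z'. z \<in> ?S \<Longrightarrow> z' \<in> ?S \<Longrightarrow> dist z' z < d \<Longrightarrow> dist ((\<lambda>(x, t). g j x t) z') ((\<lambda>(x, t). g j x t) z) < s"
    by metis
  show "\<exists>e>0. \<forall>t\<in>{0..T}. \<forall>x. norm (x - xr t) \<le> e \<longrightarrow> g j x t \<le> s"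
  proof (intro exI[of _ "min 1 (d / 2)"] conjI ballI allI impI)
    fix t x assume t: "t \<in> {0..T}" and x: "norm (x - xr t) \<le> min 1 (d / 2)"
    have "norm (x - xr t) \<le> 1" using x by simp
    then have "norm x \<le> R + 1" using norm_le_of_near R(2) t by blast
    moreover have "norm (xr t) \<le> R + 1" using R(2) t by fastforce
    moreover have "dist (x, t) (xr t, t) < d" using x d(1) by (simp add: dist_Pair_Pair dist_norm)
    ultimately have "dist (g j x t) (g j (xr t) t) < s"
      using d(2)[of "(xr t, t)" "(x, t)"] t by simp
    then show "g j x t \<le> s" using feas[OF j t] by (simp add: dist_real_def)
  qed (use d in auto)
qed (meson order_trans)

section \<open>Correction of trajectories\<close>

lemma Lp_norm_scale_le:
  fixes V :: "real \<Rightarrow> real"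
  assumes q: "1 \<le> q" and T: "0 < T" and V: "V \<in> Lp_space q T" and c: "0 \<le> c"
  shows "Lp_norm q T (\<lambda>t. c * V t) \<le> c * Lp_norm q T V"
  using q
proof (cases rule: exponent_cases)
  case (fin r)
  have N: "0 \<le> Lp_norm q T V" by (rule Lp_norm_nonneg[OF T])
  have "(LINT t|lebesgue_on {0..T}. norm (c * V t) powr r) = c powr r * (LINT t|lebesgue_on {0..T}. norm (V t) powr r)"
    using c by (simp add: abs_mult powr_mult)
  also have "\<dots> \<le> c powr r * Lp_norm q T V powr r"
    using Lp_norm_ereal_le_iff[OF fin(2) N, of T V] fin by (intro mult_left_mono) auto
  also have "\<dots> = (c * Lp_norm q T V) powr r" using c N by (simp add: powr_mult)
  finally show ?thesis using fin c N Lp_norm_ereal_le_iff[OF fin(2), of "c * Lp_norm q T V" T "\<lambda>t. c * V t"] by simp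
next
  case inf
  have ae: "AE t in lebesgue_on {0..T}. norm (V t) \<le> Lp_norm q T V"
    using AE_norm_le_Lp_norm_infinity[OF T V[unfolded inf]] inf by simp
  have ae': "AE t in lebesgue_on {0..T}. norm (c * V t) \<le> c * Lp_norm q T V"
    using ae
  proof eventually_elim
    case (elim t) then show ?case using c by (auto simp: abs_mult intro: mult_left_mono)
  qed
  have "(\<lambda>t. c * V t) \<in> borel_measurable (lebesgue_on {0..T})"
    using Lp_space_measurable[OF V] by measurable
  from Lp_norm_infinity_le[OF T this ae'] show ?thesis by (simp add: inf)
qed

text \<open>The sharp factor T^(1/q) is replaced by \<open>1 + T\<close>, which is valid for every
  exponent, infinity included.\<close>

lemma Lp_norm_le_sup:
  fixes x :: "real \<Rightarrow> 'a::euclidean_space"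
  assumes q: "1 \<le> q" and T: "0 < T" and x: "x \<in> borel_measurable (lebesgue_on {0..T})"
    and s: "\<And>t. t \<in> {0..T} \<Longrightarrow> norm (x t) \<le> s"
  shows "Lp_norm q T x \<le> s * (1 + T)"
proof -
  have "norm (x 0) \<le> s" using T by (intro s) simp
  then have s0: "0 \<le> s" using norm_ge_zero[of "x 0"] by linarith
  show ?thesis
    using q
  proof (cases rule: exponent_cases)
    case (fin r)
    have "(LINT t|lebesgue_on {0..T}. norm (x t) powr r) \<le> s powr r * T"
    \<comment> \<open>Without integrability the integral has the default value 0, so the bound holds
      in either case.\<close>
    proof (cases "integrable (lebesgue_on {0..T}) (\<lambda>t. norm (x t) powr r)")
      case True
      have "(LINT t|lebesgue_on {0..T}. norm (x t) powr r) \<le> (LINT t|lebesgue_on {0..T}. s powr r)"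
        using True s fin by (intro integral_mono) (auto intro!: powr_mono2)
      then show ?thesis using T by (simp add: measure_restrict_space mult.commute)
    qed (use T in \<open>simp add: not_integrable_integral_eq\<close>)
    also have "\<dots> \<le> s powr r * (1 + T) powr r"
    proof (intro mult_left_mono)
      have "(1 + T) powr 1 \<le> (1 + T) powr r" using T fin by (intro powr_mono) auto
      then show "T \<le> (1 + T) powr r" using T by simp
    qed simp
    also have "\<dots> = (s * (1 + T)) powr r" using s0 T by (simp add: powr_mult)
    finally show ?thesis using fin s0 T Lp_norm_ereal_le_iff[OF fin(2), of "s * (1 + T)" T x] by simp
  next
    case inf
    have "AE t in lebesgue_on {0..T}. norm (x t) \<le> s * (1 + T)"
    proof (rule AE_I2)
      fix t assume "t \<in> space (lebesgue_on {0..T})"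
      then have "norm (x t) \<le> s" by (intro s) simp
      also have "s \<le> s * (1 + T)" using s0 T by (simp add: algebra_simps)
      finally show "norm (x t) \<le> s * (1 + T)" .
    qed
    then show ?thesis unfolding inf by (intro Lp_norm_infinity_le[OF T x])
  qed
qed

lemma Lp_norm_mono_AE:
  fixes u :: "real \<Rightarrow> 'a::euclidean_space" and v :: "real \<Rightarrow> 'b::euclidean_space"
  assumes q: "1 \<le> q" and T: "0 < T" and u: "u \<in> borel_measurable (lebesgue_on {0..T})" and v: "v \<in> Lp_space q T"
    and le: "AE t in lebesgue_on {0..T}. norm (u t) \<le> norm (v t)"
  shows "u \<in> Lp_space q T" "Lp_norm q T u \<le> Lp_norm q T v"
proof -
  have "AE t in lebesgue_on {0..T}. norm (u t) \<le> 1 * (norm (v t) + norm (v t))"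
    using le
  proof eventually_elim
    case (elim t) then show ?case using norm_ge_zero[of "v t"] unfolding mult_1 by linarith
  qed
  then show uL: "u \<in> Lp_space q T" by (rule Lp_space_bound[OF q v v u zero_le_one])
  have N: "0 \<le> Lp_norm q T v" by (rule Lp_norm_nonneg[OF T])
  show "Lp_norm q T u \<le> Lp_norm q T v"
    using q
  proof (cases rule: exponent_cases)
    case (fin r)
    have "(LINT t|lebesgue_on {0..T}. norm (u t) powr r) \<le> (LINT t|lebesgue_on {0..T}. norm (v t) powr r)"
    proof (rule integral_mono_AE)
      show "AE t in lebesgue_on {0..T}. norm (u t) powr r \<le> norm (v t) powr r"
        using le by eventually_elim (use fin in \<open>auto intro: powr_mono2\<close>)
    qed (use uL v fin in \<open>auto simp: Lp_space_ereal_iff\<close>)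
    also have "\<dots> \<le> Lp_norm q T v powr r"
      using Lp_norm_ereal_le_iff[OF fin(2) N, of T v] fin by simp
    finally show ?thesis using fin Lp_norm_ereal_le_iff[OF fin(2) N, of T u] by simp
  next
    case inf
    have "AE t in lebesgue_on {0..T}. norm (u t) \<le> Lp_norm q T v"
      using le AE_norm_le_Lp_norm_infinity[OF T v[unfolded inf]] by eventually_elim (simp add: inf)
    then show ?thesis unfolding inf by (intro Lp_norm_infinity_le[OF T u])
  qed
qed

text \<open>Here \<open>z\<close> and \<open>w\<close> are increments, and the equation is the one
  for increments: \<open>x\<close> is any continuous function, and adding \<open>z\<close> to a
  trajectory again gives a trajectory with the same endpoints. The envelope \<open>V\<close> is
  later chosen before \<open>\<kappa>\<close>; only the radius \<open>\<rho>0\<close> shrinks with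
  the required precision.\<close>

definition correctable ::
  "ereal \<Rightarrow> real \<Rightarrow> (real^'d \<Rightarrow> real^'m \<Rightarrow> real \<Rightarrow> real^'d) \<Rightarrow> (real \<Rightarrow> real^'d) \<Rightarrow> (real \<Rightarrow> real^'m)
    \<Rightarrow> (real \<Rightarrow> real^'d) \<Rightarrow> (real \<Rightarrow> real) \<Rightarrow> real \<Rightarrow> real \<Rightarrow> bool" where
  "correctable q T f xr ur h V \<kappa> \<rho>0 \<longleftrightarrow> (\<forall>x u \<epsilon>.
    continuous_on {0..T} x \<longrightarrow> u \<in> Lp_space q T \<longrightarrow> (\<forall>t\<in>{0..T}. norm (x t - xr t) \<le> \<rho>0) \<longrightarrow>
    Lp_norm q T (\<lambda>t. u t - ur t) \<le> \<rho>0 \<longrightarrow> 0 < \<epsilon> \<longrightarrow> \<epsilon> \<le> \<rho>0 \<longrightarrow>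
    (\<exists>z w. abs_continuous_on T z \<and> w \<in> borel_measurable (lebesgue_on {0..T}) \<and> z 0 = 0 \<and> z T = 0 \<and>
      (\<forall>t\<in>{0..T}. norm (z t - \<epsilon> *\<^sub>R h t) \<le> \<kappa> * \<epsilon>) \<and> (\<forall>t. norm (w t) \<le> 2 * \<epsilon> * V t) \<and>
      (AE t in lebesgue_on {0..T}. (z has_vector_derivative f (x t + z t) (u t + w t) t - f (x t) (u t) t)
        (at t within {0..T}))))"

text \<open>
  The correction is \<open>w = \<epsilon> v + \<Sum>\<^sub>i c\<^sub>i v\<^sub>i\<close>, where the controls \<open>v\<^sub>i\<close> steer the linearised system from
  \<open>0\<close> to the unit vectors.  Writing \<open>z = \<epsilon> h + \<Sum>\<^sub>i c\<^sub>i h\<^sub>i + y\<close>, the equation for \<open>z\<close> becomes an equation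
  for \<open>y\<close> driven by the linearisation error, and \<open>z T = 0\<close> holds exactly if \<open>c\<^sub>i = - y\<^sub>i T\<close>.
\<close>

lemma trajectory_correction:
  fixes f :: "real^'d \<Rightarrow> real^'m \<Rightarrow> real \<Rightarrow> real^'d"
    and fx :: "real^'d \<Rightarrow> real^'m \<Rightarrow> real \<Rightarrow> real^'d^'d" and fu :: "real^'d \<Rightarrow> real^'m \<Rightarrow> real \<Rightarrow> real^'m^'d"
    and xr h :: "real \<Rightarrow> real^'d" and ur v :: "real \<Rightarrow> real^'m"
  assumes sd: "smooth_data T f fx fu (*v) (*v)" and q: "1 \<le> q"
    and xr: "continuous_on {0..T} xr" and ur: "ur \<in> Lp_space q T"
    and domx: "dominated_data q T fx" and domu: "dominated_control_data q T fu"
    and A_def: "A = (\<lambda>t. fx (xr t) (ur t) t)" and B_def: "B = (\<lambda>t. fu (xr t) (ur t) t)"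
    and ctrl: "completely_controllable q T A B" and Abd: "A \<in> Lp_space \<infinity> T"
    and v: "v \<in> Lp_space q T" and lin: "linear_solution T A B v h" and h0: "h 0 = 0" "h T = 0"
  shows "\<exists>V::real\<Rightarrow>real. V \<in> Lp_space q T \<and> (\<forall>t. 0 \<le> V t) \<and> (\<forall>\<kappa>>0. \<exists>\<rho>0>0. correctable q T f xr ur h V \<kappa> \<rho>0)"
proof -
  interpret smooth_data T f fx fu "(*v)" "(*v)" by (rule sd)
  let ?L = "lebesgue_on {0..T}"
  have "\<forall>i::'d. \<exists>vi hi. vi \<in> Lp_space q T \<and> linear_solution T A B vi hi \<and> hi 0 = 0 \<and> hi T = axis i (1::real)"
    using ctrl unfolding completely_controllable_def by blast
  then obtain vi hi where vh: "\<And>i. vi i \<in> Lp_space q T" "\<And>i. linear_solution T A B (vi i) (hi i)"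
    "\<And>i. hi i 0 = 0" "\<And>i. hi i T = axis i (1::real)"
    by metis
  have hAC: "abs_continuous_on T h" "AE t in ?L. (h has_vector_derivative A t *v h t + B t *v v t) (at t within {0..T})"
    using lin by (auto simp: linear_solution_def)
  have hiAC: "abs_continuous_on T (hi i)"
    "AE t in ?L. (hi i has_vector_derivative A t *v hi i t + B t *v vi i t) (at t within {0..T})" for i
    using vh(2)[of i] by (auto simp: linear_solution_def)
  have hc: "continuous_on {0..T} h" by (rule abs_continuous_imp_continuous[OF hAC(1)])
  have hic: "continuous_on {0..T} (hi i)" for i by (rule abs_continuous_imp_continuous[OF hiAC(1)])
  have vim [measurable]: "vi i \<in> borel_measurable ?L" for i using vh(1) by (rule Lp_space_measurable)
  have vm [measurable]: "v \<in> borel_measurable ?L" using v by (rule Lp_space_measurable)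
  define V where "V t = norm (v t) + (\<Sum>i\<in>UNIV. norm (vi i t))" for t
  have Vi: "(\<lambda>t. \<Sum>i\<in>I. norm (vi i t)) \<in> Lp_space q T" if "finite I" for I
    using that
  proof (induction I)
    case empty
    show ?case using q by (cases rule: exponent_cases) (auto simp: Lp_space_ereal_iff Lp_space_infinity_iff)
  next
    case (insert i I)
    then show ?case using Lp_space_add_norm[OF q vh(1)[of i] insert.IH] by simp
  qed
  have V: "V \<in> Lp_space q T" unfolding V_def[abs_def] by (rule Lp_space_add_norm[OF q v Vi]) simp
  have V0: "0 \<le> V t" for t by (simp add: V_def sum_nonneg)
  obtain H0 where H0: "0 < H0" "\<forall>t\<in>{0..T}. norm (h t) \<le> H0" by (rule continuous_on_Icc_bounded[OF hc])
  have "\<forall>i. \<exists>R>0. \<forall>t\<in>{0..T}. norm (hi i t) \<le> R" using continuous_on_Icc_bounded[OF hic] by metis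
  then obtain Hi where Hi: "\<And>i. 0 < Hi i" "\<And>i. \<forall>t\<in>{0..T}. norm (hi i t) \<le> Hi i" by metis
  define H where "H = 1 + H0 + (\<Sum>i\<in>UNIV. Hi i)"
  have H: "1 \<le> H" "\<forall>t\<in>{0..T}. norm (h t) \<le> H" "\<forall>t\<in>{0..T}. (\<Sum>i\<in>UNIV. norm (hi i t)) \<le> H"
  proof -
    have S: "0 \<le> (\<Sum>i\<in>UNIV. Hi i)" using Hi(1) by (intro sum_nonneg) (simp add: less_imp_le)
    show "1 \<le> H" using S H0(1) by (simp add: H_def)
    show "\<forall>t\<in>{0..T}. norm (h t) \<le> H" using S H0 by (auto simp: H_def intro: order_trans)
    show "\<forall>t\<in>{0..T}. (\<Sum>i\<in>UNIV. norm (hi i t)) \<le> H"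
    proof
      fix t assume "t \<in> {0..T}"
      then have "(\<Sum>i\<in>UNIV. norm (hi i t)) \<le> (\<Sum>i\<in>UNIV. Hi i)" using Hi(2) by (intro sum_mono) auto
      then show "(\<Sum>i\<in>UNIV. norm (hi i t)) \<le> H" using H0(1) by (simp add: H_def)
    qed
  qed
  \<comment> \<open>Cancelling the end value of \<open>y\<close> adds multiples of the
    \<open>hi i\<close>, with coefficients bounded by the size of \<open>y\<close>. \<open>K\<close>
    is the factor by which this enlarges a deviation.\<close>
  define K where "K = 1 + H"
  have K: "2 \<le> K" using H(1) by (simp add: K_def)
  have comb: "norm (y + (\<Sum>i\<in>UNIV. - (b $ i) *\<^sub>R hi i t)) \<le> K * s"
    if "norm y \<le> s" "norm b \<le> s" "t \<in> {0..T}" for y b :: "real^'d" and s t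
  proof -
    have s: "0 \<le> s" using that(1) norm_ge_zero order_trans by blast
    have "norm (\<Sum>i\<in>UNIV. - (b $ i) *\<^sub>R hi i t) \<le> (\<Sum>i\<in>UNIV. s * norm (hi i t))"
    proof (intro sum_norm_le)
      fix i
      have "\<bar>b $ i\<bar> \<le> s" using component_le_norm_cart[of b i] that(2) by simp
      then show "norm (- (b $ i) *\<^sub>R hi i t) \<le> s * norm (hi i t)" by (simp add: mult_right_mono)
    qed
    also have "\<dots> \<le> s * H" using H(3) that(3) s by (auto simp flip: sum_distrib_left intro!: mult_left_mono)
    finally have "norm (y + (\<Sum>i\<in>UNIV. - (b $ i) *\<^sub>R hi i t)) \<le> s + s * H"
      using that(1) by (intro norm_triangle_le add_mono)
    then show ?thesis by (simp add: K_def algebra_simps)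
  qed
  have combv: "norm (\<Sum>i\<in>UNIV. - (b $ i) *\<^sub>R vi i t) \<le> s * (\<Sum>i\<in>UNIV. norm (vi i t))"
    if "norm b \<le> s" for b :: "real^'d" and s t
    unfolding sum_distrib_left
  proof (intro sum_norm_le)
    fix i
    have "\<bar>b $ i\<bar> \<le> s" using component_le_norm_cart[of b i] that by simp
    then show "norm (- (b $ i) *\<^sub>R vi i t) \<le> s * norm (vi i t)" by (simp add: mult_right_mono)
  qed
  obtain M where M: "0 \<le> M" "AE t in ?L. norm (A t) \<le> M" using Abd by (auto simp: Lp_space_infinity_iff)
  obtain K0 where K0: "0 < K0" "\<And>(a::real^'d^'d) y. norm (a *v y) \<le> norm a * norm y * K0"
    using bounded_bilinear.pos_bounded[OF bounded_bilinear_matrix_vector_mult] by blast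
  \<comment> \<open>\<open>A\<close> is bounded only almost everywhere, while the integral equation
    asks for a bound at every time. Truncation provides it and changes \<open>A\<close> on a null
    set only.\<close>
  define A' where "A' t = (if norm (A t) \<le> M then A t else 0)" for t
  define a where "a = M * K0"
  have a0: "0 \<le> a" using M K0 by (simp add: a_def)
  have A'bd: "norm (A' t *v y) \<le> a * norm y" for t y
  proof -
    have "norm (A' t *v y) \<le> norm (A' t) * norm y * K0" by (rule K0(2))
    also have "\<dots> \<le> M * norm y * K0" using M(1) K0(1) by (intro mult_right_mono) (auto simp: A'_def)
    finally show ?thesis by (simp add: a_def mult_ac)
  qed
  have [measurable]: "A \<in> borel_measurable ?L" using Abd by (rule Lp_space_measurable)
  have A'm: "A' \<in> borel_measurable ?L" unfolding A'_def[abs_def] by measurable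
  have A'A: "AE t in ?L. A' t = A t" using M(2) by eventually_elim (simp add: A'_def)
  define \<mu> where "\<mu> = 4 * a + 4"
  define E where "E = exp (\<mu> * T)"
  have E: "0 < E" by (simp add: E_def)
  show ?thesis
  proof (intro exI[of _ V] conjI allI impI)
    fix \<kappa> :: real assume \<kappa>: "0 < \<kappa>"
    \<comment> \<open>Three demands are met by
      \<open>\<delta>N * (4 * E * K * H) = min 1 \<kappa>\<close>: the contraction condition with
      bound 1/4, \<open>y\<close> of size at most \<open>\<epsilon>\<close>, and \<open>K\<close>
      times that size at most \<open>\<kappa> * \<epsilon>\<close>. They follow since
      \<open>H\<close> and \<open>K\<close> are at least 1.\<close>
    define \<delta>N where "\<delta>N = min 1 \<kappa> / (4 * E * K * H)"
    have EKH: "0 < 4 * E * K * H" using E K H(1) by simp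
    have \<delta>N: "0 < \<delta>N" using EKH \<kappa> by (simp add: \<delta>N_def)
    have \<delta>NE: "\<delta>N * (4 * E * K * H) = min 1 \<kappa>"
      unfolding \<delta>N_def
      by (rule nonzero_eq_divide_eq[THEN iffD1, OF dual_order.strict_implies_not_eq[OF EKH] refl])
    obtain \<rho>N where \<rho>N: "0 < \<rho>N" and N: "\<forall>\<rho> u x1 x2 u1 u2 \<sigma>. \<rho> \<le> \<rho>N \<longrightarrow>
      control_variation q T xr ur V \<rho> u x1 x2 u1 u2 \<sigma> \<longrightarrow>
      integrable ?L (\<lambda>t. lin_error (xr t) (ur t) t (x1 t) (x2 t) (u1 t) (u2 t)) \<and>
      (LINT t|?L. norm (lin_error (xr t) (ur t) t (x1 t) (x2 t) (u1 t) (u2 t))) \<le> \<delta>N * \<sigma>"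
      using lin_error_small_Lipschitz[OF q xr ur V V0 domx domu \<delta>N] by blast
    \<comment> \<open>From within \<open>\<rho>0\<close> of the reference, a step with
      \<open>\<epsilon> \<le> \<rho>0\<close> displaces the state by at most
      \<open>\<epsilon> * (H + K)\<close>; the total stays within \<open>\<rho>N\<close>.\<close>
    define \<rho>0 where "\<rho>0 = \<rho>N / (1 + H + K)"
    have \<rho>0: "0 < \<rho>0" "\<rho>0 * (1 + H + K) = \<rho>N" using \<rho>N H(1) K by (auto simp: \<rho>0_def)
    show "\<exists>\<rho>0>0. correctable q T f xr ur h V \<kappa> \<rho>0"
      unfolding correctable_def
    proof (intro exI[of _ \<rho>0] conjI allI impI)
      fix x :: "real \<Rightarrow> real^'d" and u :: "real \<Rightarrow> real^'m" and \<epsilon> :: real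
      assume x: "continuous_on {0..T} x" and u: "u \<in> Lp_space q T"
        and xn: "\<forall>t\<in>{0..T}. norm (x t - xr t) \<le> \<rho>0" and un: "Lp_norm q T (\<lambda>t. u t - ur t) \<le> \<rho>0"
        and \<epsilon>: "0 < \<epsilon>" "\<epsilon> \<le> \<rho>0"
      have [measurable]: "u \<in> borel_measurable ?L" using u by (rule Lp_space_measurable)
      have le\<rho>: "\<rho>0 + \<epsilon> * (H + K) \<le> \<rho>N" "2 * \<epsilon> \<le> \<rho>N" "\<rho>0 \<le> \<rho>N"
      proof -
        have "\<epsilon> * (H + K) \<le> \<rho>0 * (H + K)" using \<epsilon> H(1) K by (intro mult_right_mono) auto
        moreover have e: "\<rho>0 + \<rho>0 * (H + K) = \<rho>N" using \<rho>0(2) by (simp add: algebra_simps)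
        ultimately show "\<rho>0 + \<epsilon> * (H + K) \<le> \<rho>N" by linarith
        have "\<rho>0 * 2 \<le> \<rho>0 * (H + K)" using \<rho>0(1) H(1) K by (intro mult_left_mono) auto
        then show "2 * \<epsilon> \<le> \<rho>N" "\<rho>0 \<le> \<rho>N" using e \<epsilon> \<rho>0(1) by linarith+
      qed
      have un': "Lp_norm q T (\<lambda>t. u t - ur t) \<le> \<rho>N" using un le\<rho> by simp
      define z where "z y t = (y t + (\<Sum>i\<in>UNIV. - (y T $ i) *\<^sub>R hi i t)) + \<epsilon> *\<^sub>R h t" for y :: "real \<Rightarrow> real^'d" and t
      define w where "w y t = (\<Sum>i\<in>UNIV. - (y T $ i) *\<^sub>R vi i t) + \<epsilon> *\<^sub>R v t" for y :: "real \<Rightarrow> real^'d" and t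
      define Ny where "Ny y t = lin_error (xr t) (ur t) t (x t + z y t) (x t) (u t + w y t) (u t)" for y t
      have zc: "continuous_on {0..T} (z y)" if "continuous_on {0..T} y" for y
        unfolding z_def[abs_def] using that hc hic by (intro continuous_intros)
      have xm [measurable]: "x \<in> borel_measurable ?L" by (rule continuous_Icc_measurable[OF x])
      have xzm: "(\<lambda>t. x t + z y t) \<in> borel_measurable ?L" if "continuous_on {0..T} y" for y
        using x zc[OF that] by (intro continuous_Icc_measurable continuous_intros)
      have wm: "w y \<in> borel_measurable ?L" for y unfolding w_def[abs_def] by measurable
      have uwm: "(\<lambda>t. u t + w y t) \<in> borel_measurable ?L" for y using wm[of y] by measurable
      have zdiff: "norm (z y t - \<epsilon> *\<^sub>R h t) \<le> K * s" if "\<forall>t\<in>{0..T}. norm (y t) \<le> s" "t \<in> {0..T}" for y s t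
        using comb[of "y t" s "y T" t] that T by (simp add: z_def)
      have zle: "norm (z y t) \<le> \<epsilon> * (H + K)" if "\<forall>t\<in>{0..T}. norm (y t) \<le> \<epsilon>" "t \<in> {0..T}" for y t
      proof -
        have "norm (z y t) \<le> norm (\<epsilon> *\<^sub>R h t) + K * \<epsilon>" by (rule norm_le_of_near[OF zdiff[OF that] order_refl])
        also have "norm (\<epsilon> *\<^sub>R h t) \<le> \<epsilon> * H" using H(2) that(2) \<epsilon> by (auto intro: mult_left_mono)
        finally show ?thesis by (simp add: algebra_simps)
      qed
      have wle: "norm (w y t) \<le> 2 * \<epsilon> * V t" if "norm (y T) \<le> \<epsilon>" for y t
      proof -
        have "norm (w y t) \<le> \<epsilon> * (\<Sum>i\<in>UNIV. norm (vi i t)) + \<epsilon> * norm (v t)"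
          unfolding w_def using combv[OF that] \<epsilon> by (intro norm_triangle_le add_mono) auto
        also have "\<dots> = \<epsilon> * V t" by (simp add: V_def algebra_simps)
        also have "\<dots> \<le> 2 * \<epsilon> * V t" using \<epsilon> V0[of t] by simp
        finally show ?thesis .
      qed
      have zd: "norm ((x t + z y t) - (x t + z y' t)) \<le> K * s"
        if "\<forall>t\<in>{0..T}. norm (y t - y' t) \<le> s" "t \<in> {0..T}" for y y' s t
      proof -
        have "(x t + z y t) - (x t + z y' t) = (y t - y' t) + (\<Sum>i\<in>UNIV. - ((y T - y' T) $ i) *\<^sub>R hi i t)"
          by (simp add: z_def algebra_simps sum_negf flip: sum.distrib)
        then show ?thesis using comb[of "y t - y' t" s "y T - y' T" t] that T by simp
      qed
      have wd: "norm ((u t + w y t) - (u t + w y' t)) \<le> K * s * V t"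
        if "\<forall>t\<in>{0..T}. norm (y t - y' t) \<le> s" for y y' s t
      proof -
        have yT: "norm (y T - y' T) \<le> s" using that T by simp
        have s: "0 \<le> s" using yT norm_ge_zero order_trans by blast
        have "(u t + w y t) - (u t + w y' t) = (\<Sum>i\<in>UNIV. - ((y T - y' T) $ i) *\<^sub>R vi i t)"
          by (simp add: w_def algebra_simps sum_negf flip: sum.distrib)
        then have "norm ((u t + w y t) - (u t + w y' t)) \<le> s * (\<Sum>i\<in>UNIV. norm (vi i t))"
          using combv[OF yT] by simp
        also have "\<dots> \<le> s * V t" using s by (intro mult_left_mono) (simp_all add: V_def)
        also have "\<dots> \<le> K * s * V t"
        proof -
          have "1 * (s * V t) \<le> K * (s * V t)" using K s V0[of t] by (intro mult_right_mono) auto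
          then show ?thesis by (simp add: mult.assoc)
        qed
        finally show ?thesis .
      qed
      have near: "norm (x t + z y t - xr t) \<le> \<rho>N \<and> norm ((u t + w y t) - u t) \<le> \<rho>N * V t"
        if "\<forall>t\<in>{0..T}. norm (y t) \<le> \<epsilon>" "t \<in> {0..T}" for y t
      proof
        have "norm (x t + z y t - xr t) \<le> norm (x t - xr t) + norm (z y t)"
          by (metis add_diff_eq add.commute norm_triangle_ineq)
        also have "\<dots> \<le> \<rho>N" using xn that(2) zle[OF that] le\<rho>(1) by fastforce
        finally show "norm (x t + z y t - xr t) \<le> \<rho>N" .
        have "norm (w y t) \<le> 2 * \<epsilon> * V t" using that(1) T by (intro wle) simp
        also have "\<dots> \<le> \<rho>N * V t" using le\<rho>(2) V0 by (intro mult_right_mono)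
        finally show "norm ((u t + w y t) - u t) \<le> \<rho>N * V t" by simp
      qed
      have near0: "norm (x t - xr t) \<le> \<rho>N" if "t \<in> {0..T}" for t using xn le\<rho>(3) that by fastforce
      have Nint: "integrable ?L (Ny y)" if "continuous_on {0..T} y" "\<forall>t\<in>{0..T}. norm (y t) \<le> \<epsilon>" for y
      proof -
        have "integrable ?L (\<lambda>t. lin_error (xr t) (ur t) t (x t + z y t) (x t) (u t + w y t) (u t))"
        proof (rule N[rule_format, OF order_refl control_variationI[OF \<rho>N \<rho>N u un' xzm[OF that(1)] xm uwm], THEN conjunct1])
          fix t assume t: "t \<in> {0..T}"
          have "norm ((x t + z y t) - x t) \<le> \<rho>N" using zle[OF that(2) t] le\<rho>(1) \<rho>0(1) by simp
          then show "norm (x t + z y t - xr t) \<le> \<rho>N \<and> norm (x t - xr t) \<le> \<rho>N \<and>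
            norm (u t + w y t - u t) \<le> \<rho>N * V t \<and> norm (u t - u t) \<le> \<rho>N * V t \<and>
            norm (x t + z y t - x t) \<le> \<rho>N \<and> norm (u t + w y t - u t) \<le> \<rho>N * V t"
            using near[OF that(2) t] near0[OF t] \<rho>N V0[of t] by simp
        qed measurable
        then show ?thesis by (simp add: Ny_def[abs_def])
      qed
      have Nlip: "(LINT t|?L. norm (Ny y t - Ny y' t)) \<le> (\<delta>N * K) * s"
        if y: "continuous_on {0..T} y" "continuous_on {0..T} y'"
          "\<forall>t\<in>{0..T}. norm (y t) \<le> \<epsilon>" "\<forall>t\<in>{0..T}. norm (y' t) \<le> \<epsilon>" and s: "0 < s"
          "\<forall>t\<in>{0..T}. norm (y t - y' t) \<le> s" for y y' s
      proof -
        have "Ny y t - Ny y' t = lin_error (xr t) (ur t) t (x t + z y t) (x t + z y' t) (u t + w y t) (u t + w y' t)" for t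
          by (simp add: Ny_def lin_error_def matrix_vector_mult_diff_distrib matrix_vector_right_distrib)
        moreover have "(LINT t|?L. norm (lin_error (xr t) (ur t) t (x t + z y t) (x t + z y' t) (u t + w y t) (u t + w y' t))) \<le> \<delta>N * (K * s)"
        proof (rule N[rule_format, OF order_refl control_variationI[OF \<rho>N _ u un' xzm[OF y(1)] xzm[OF y(2)] uwm uwm], THEN conjunct2])
          show "0 < K * s" using K s(1) by simp
          fix t assume t: "t \<in> {0..T}"
          show "norm (x t + z y t - xr t) \<le> \<rho>N \<and> norm (x t + z y' t - xr t) \<le> \<rho>N \<and>
            norm (u t + w y t - u t) \<le> \<rho>N * V t \<and> norm (u t + w y' t - u t) \<le> \<rho>N * V t \<and>
            norm (x t + z y t - (x t + z y' t)) \<le> K * s \<and> norm (u t + w y t - (u t + w y' t)) \<le> K * s * V t"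
            using near[OF y(3) t] near[OF y(4) t] zd[OF s(2) t] wd[OF s(2), of t] by blast
        qed
        ultimately show ?thesis by (simp add: mult.assoc)
      qed
      \<comment> \<open>At \<open>y = 0\<close> the variation is \<open>\<epsilon>\<close> times the
        pair \<open>h\<close>, \<open>v\<close>, hence of size \<open>\<epsilon> * H\<close>; the
        control part is bounded by \<open>\<epsilon> * V t\<close>, which is why
        \<open>1 \<le> H\<close> was arranged.\<close>
      have N0: "(LINT t|?L. norm (Ny (\<lambda>_. 0) t)) \<le> \<delta>N * (\<epsilon> * H)"
      proof -
        have z0: "z (\<lambda>_. 0) t = \<epsilon> *\<^sub>R h t" and w0: "w (\<lambda>_. 0) t = \<epsilon> *\<^sub>R v t" for t
          by (simp_all add: z_def w_def)
        have c0: "continuous_on {0..T} (\<lambda>_. 0 :: real^'d)" by simp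
        have b0: "\<forall>t\<in>{0..T}. norm (0 :: real^'d) \<le> \<epsilon>" using \<epsilon> by simp
        show ?thesis
          unfolding Ny_def
        proof (rule N[rule_format, OF order_refl control_variationI[OF \<rho>N _ u un' xzm[OF c0] xm uwm], THEN conjunct2])
          show "0 < \<epsilon> * H" using \<epsilon> H(1) by simp
          fix t assume t: "t \<in> {0..T}"
          have "norm (x t + z (\<lambda>_. 0) t - x t) \<le> \<epsilon> * H" using H(2) t \<epsilon> by (simp add: z0)
          moreover have "norm (u t + w (\<lambda>_. 0) t - u t) \<le> \<epsilon> * H * V t"
          proof -
            have "norm (v t) \<le> V t" by (simp add: V_def sum_nonneg)
            also have "1 * V t \<le> H * V t" using H(1) V0 by (intro mult_right_mono)
            finally show ?thesis using \<epsilon> by (simp add: w0 mult.assoc)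
          qed
          ultimately show "norm (x t + z (\<lambda>_. 0) t - xr t) \<le> \<rho>N \<and> norm (x t - xr t) \<le> \<rho>N \<and>
            norm (u t + w (\<lambda>_. 0) t - u t) \<le> \<rho>N * V t \<and> norm (u t - u t) \<le> \<rho>N * V t \<and>
            norm (x t + z (\<lambda>_. 0) t - x t) \<le> \<epsilon> * H \<and> norm (u t + w (\<lambda>_. 0) t - u t) \<le> \<epsilon> * H * V t"
            using near[OF b0 t] near0[OF t] \<rho>N V0[of t] by simp
        qed measurable
      qed
      have \<delta>c: "(\<delta>N * K) * E \<le> 1 / 4" "K * (2 * E * (\<delta>N * (\<epsilon> * H))) \<le> \<kappa> * \<epsilon>" "2 * E * (\<delta>N * (\<epsilon> * H)) \<le> \<epsilon>"
      proof -
        have pos: "0 \<le> \<delta>N * K * E" using \<delta>N K E by simp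
        have "\<delta>N * K * E * 1 \<le> \<delta>N * K * E * H" using pos H(1) by (intro mult_left_mono)
        also have "\<dots> = min 1 \<kappa> / 4" using \<delta>NE by (simp add: mult_ac)
        finally show "(\<delta>N * K) * E \<le> 1 / 4" by (simp add: min_def split: if_splits)
        have 1: "K * (2 * E * (\<delta>N * (\<epsilon> * H))) = min 1 \<kappa> / 2 * \<epsilon>"
        proof -
          have "K * (2 * E * (\<delta>N * (\<epsilon> * H))) = \<delta>N * (4 * E * K * H) / 2 * \<epsilon>" by (simp add: mult_ac)
          then show ?thesis unfolding \<delta>NE .
        qed
        also have "\<dots> \<le> \<kappa> * \<epsilon>" using \<kappa> \<epsilon> by (intro mult_right_mono) auto
        finally show "K * (2 * E * (\<delta>N * (\<epsilon> * H))) \<le> \<kappa> * \<epsilon>" .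
        have "0 \<le> 2 * E * (\<delta>N * (\<epsilon> * H))" using E \<delta>N \<epsilon> H(1) by simp
        then have "1 * (2 * E * (\<delta>N * (\<epsilon> * H))) \<le> K * (2 * E * (\<delta>N * (\<epsilon> * H)))"
          using K by (intro mult_right_mono) auto
        also have "\<dots> \<le> 1 * \<epsilon>" unfolding 1 using \<epsilon> by (intro mult_right_mono) auto
        finally show "2 * E * (\<delta>N * (\<epsilon> * H)) \<le> \<epsilon>" by simp
      qed
      \<comment> \<open>The remainder is sought in the ball of radius \<open>\<epsilon>\<close>,
        where the variation estimates for \<open>Ny\<close> are available.\<close>
      have "\<exists>y. continuous_on {0..T} y \<and> (\<forall>t\<in>{0..T}. norm (y t) \<le> 2 * exp (\<mu> * T) * (\<delta>N * (\<epsilon> * H))) \<and>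
        (\<forall>t\<in>{0..T}. y t = integral {0..t} (\<lambda>s. A' s *v y s + Ny y s))"
      proof (rule perturbed_linear_integral_equation[where a = a and ?r0.0 = \<epsilon> and \<delta> = "\<delta>N * K"])
        show "0 \<le> \<delta>N * K" using \<delta>N K by simp
        show "0 \<le> \<delta>N * (\<epsilon> * H)" using \<delta>N \<epsilon> H(1) by simp
        show "\<delta>N * K * exp (\<mu> * T) \<le> 1 / 4" "2 * exp (\<mu> * T) * (\<delta>N * (\<epsilon> * H)) \<le> \<epsilon>"
          using \<delta>c(1,3) by (simp_all only: E_def)
      qed (fact T A'm a0 A'bd \<mu>_def Nint Nlip N0)+
      then obtain y where yc: "continuous_on {0..T} y"
        and yb: "\<forall>t\<in>{0..T}. norm (y t) \<le> 2 * exp (\<mu> * T) * (\<delta>N * (\<epsilon> * H))"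
        and ye: "\<forall>t\<in>{0..T}. y t = integral {0..t} (\<lambda>s. A' s *v y s + Ny y s)"
        by blast
      have y\<epsilon>: "\<forall>t\<in>{0..T}. norm (y t) \<le> \<epsilon>" using yb \<delta>c(3) by (fastforce simp: E_def)
      have intG: "integrable ?L (\<lambda>s. A' s *v y s + Ny y s)"
      proof (rule Bochner_Integration.integrable_add)
        show "integrable ?L (Ny y)" by (rule Nint[OF yc y\<epsilon>])
        have m: "(\<lambda>s. A' s *v y s) \<in> borel_measurable ?L"
          using A'm continuous_Icc_measurable[OF yc] by (rule borel_measurable_continuous_Pair)
            (intro bounded_bilinear.continuous_on[OF bounded_bilinear_matrix_vector_mult] continuous_intros)
        have ae: "AE s in ?L. norm (A' s *v y s) \<le> norm (a * \<epsilon>)"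
        proof (rule AE_I2)
          fix s assume "s \<in> space ?L"
          then have "a * norm (y s) \<le> a * \<epsilon>" using y\<epsilon> a0 by (intro mult_left_mono) auto
          then show "norm (A' s *v y s) \<le> norm (a * \<epsilon>)" using A'bd[of s "y s"] by simp
        qed
        have "integrable ?L (\<lambda>_. a * \<epsilon>)" by simp
        from this m ae show "integrable ?L (\<lambda>s. A' s *v y s)" by (rule Bochner_Integration.integrable_bound)
      qed
      have yAC: "abs_continuous_on T y" "AE t in ?L. (y has_vector_derivative A' t *v y t + Ny y t) (at t within {0..T})"
        using abs_continuous_on_initial_integral[OF intG, of y] ye by auto
      have y0: "y 0 = 0" using ye T by simp
      show "\<exists>z w. abs_continuous_on T z \<and> w \<in> borel_measurable ?L \<and> z 0 = 0 \<and> z T = 0 \<and>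
        (\<forall>t\<in>{0..T}. norm (z t - \<epsilon> *\<^sub>R h t) \<le> \<kappa> * \<epsilon>) \<and> (\<forall>t. norm (w t) \<le> 2 * \<epsilon> * V t) \<and>
        (AE t in ?L. (z has_vector_derivative f (x t + z t) (u t + w t) t - f (x t) (u t) t) (at t within {0..T}))"
      proof (intro exI[of _ "z y"] exI[of _ "w y"] conjI)
        show "abs_continuous_on T (z y)"
          unfolding z_def[abs_def] using yAC(1) hAC(1) hiAC(1)
          by (intro abs_continuous_on_add abs_continuous_on_sum abs_continuous_on_scaleR)
        show "w y \<in> borel_measurable ?L" by (rule wm)
        show "z y 0 = 0" by (simp add: z_def y0 h0 vh)
        have "(\<Sum>i\<in>UNIV. - (y T $ i) *\<^sub>R axis i (1::real)) = - y T"
          by (simp add: vec_eq_iff axis_def sum_negf if_distrib[of "\<lambda>c. _ * c"] cong: if_cong)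
        then show "z y T = 0" by (simp add: z_def h0 vh)
        show "\<forall>t\<in>{0..T}. norm (z y t - \<epsilon> *\<^sub>R h t) \<le> \<kappa> * \<epsilon>"
        proof
          fix t assume "t \<in> {0..T}"
          from order_trans[OF zdiff[OF yb this] \<delta>c(2)[unfolded E_def]]
          show "norm (z y t - \<epsilon> *\<^sub>R h t) \<le> \<kappa> * \<epsilon>" .
        qed
        show "\<forall>t. norm (w y t) \<le> 2 * \<epsilon> * V t" using wle y\<epsilon> T by simp
        have "AE t in ?L. \<forall>i. (hi i has_vector_derivative A t *v hi i t + B t *v vi i t) (at t within {0..T})"
          using hiAC(2) by (simp add: AE_all_countable)
        with yAC(2) hAC(2) A'A
        show "AE t in ?L. (z y has_vector_derivative f (x t + z y t) (u t + w y t) t - f (x t) (u t) t) (at t within {0..T})"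
        proof eventually_elim
          case (elim t)
          have sc: "((\<lambda>s. c *\<^sub>R F s) has_vector_derivative c *\<^sub>R D) net"
            if "(F has_vector_derivative D) net" for c net D and F :: "real \<Rightarrow> real^'d"
            using that by (rule bounded_linear.has_vector_derivative[OF bounded_linear_scaleR_right])
          have "(z y has_vector_derivative ((A' t *v y t + Ny y t) +
              (\<Sum>i\<in>UNIV. - (y T $ i) *\<^sub>R (A t *v hi i t + B t *v vi i t))) + \<epsilon> *\<^sub>R (A t *v h t + B t *v v t)) (at t within {0..T})"
            unfolding z_def[abs_def] using elim
            by (intro has_vector_derivative_add has_vector_derivative_sum sc) auto
          \<comment> \<open>The linear terms reassemble to the linearised right-hand side at
            \<open>z\<close> and \<open>w\<close>; adding the linearisation error turns this into
            the exact increment of \<open>f\<close>.\<close>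
          moreover have "((A' t *v y t + Ny y t) + (\<Sum>i\<in>UNIV. - (y T $ i) *\<^sub>R (A t *v hi i t + B t *v vi i t)))
              + \<epsilon> *\<^sub>R (A t *v h t + B t *v v t) = A t *v z y t + B t *v w y t + Ny y t"
          proof -
            have s: "M *v (\<Sum>i\<in>UNIV. - (y T $ i) *\<^sub>R r i) = (\<Sum>i\<in>UNIV. - (y T $ i) *\<^sub>R (M *v r i))"
              for M :: "real^'e^'d" and r :: "'d \<Rightarrow> real^'e"
              unfolding linear_sum[OF matrix_vector_mul_linear, of M] matrix_vector_mult_scaleR ..
            show ?thesis
              using elim(3) by (simp add: z_def w_def matrix_vector_right_distrib s matrix_vector_mult_scaleR
                  scaleR_add_right sum.distrib del: scaleR_minus_left)
          qed
          moreover have "\<dots> = f (x t + z y t) (u t + w y t) t - f (x t) (u t) t"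
            by (simp add: Ny_def lin_error_def A_def B_def)
          ultimately show ?case by simp
        qed
      qed
    qed (rule \<rho>0(1))
  qed (use V V0 in auto)
qed

section \<open>Exactness of the penalty function\<close>

text \<open>After this translation the exponents of the growth conditions are no longer needed: all
  later estimates use domination only. The last claim keeps the p-th power, which continuity into
  L^p requires.\<close>

lemma growth_imp_dominated:
  fixes \<theta> :: "real^'d \<Rightarrow> real^'m \<Rightarrow> real \<Rightarrow> real" and f :: "real^'d \<Rightarrow> real^'m \<Rightarrow> real \<Rightarrow> real^'d"
  assumes exponents: "1 \<le> p" "p \<le> q"
    and theta: "continuous_data T \<theta>" "continuous_data T (grad_x \<theta>)" "continuous_data T (grad_u \<theta>)"
    and f: "continuous_data T f" "continuous_data T (jac_x f)" "continuous_data T (jac_u f)"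
    and growth: "q = \<infinity> \<or>
      (let q' = real_of_ereal q; p' = real_of_ereal p in
        growth_condition T q' 1 \<theta> \<and> growth_condition T q' 1 (grad_x \<theta>) \<and>
        growth_condition T (q' - 1) (conj_exponent q) (grad_u \<theta>) \<and>
        growth_condition T (q' / p') p f \<and> growth_condition T (q' / p') p (jac_x f) \<and>
        (p < q \<longrightarrow> (let s = q' * p' / (q' - p') in
          growth_condition T (q' / s) (ereal s) (jac_u f))) \<and>
        (q = p \<longrightarrow> (\<forall>x u v. \<forall>t\<in>{0..T}. jac_u f x u t = jac_u f x v t)))"
  shows "dominated_data q T \<theta>" "dominated_data q T (grad_x \<theta>)" "dominated_control_data q T (grad_u \<theta>)"
    "dominated_data q T (jac_x f)" "dominated_control_data q T (jac_u f)"
    "p = ereal p' \<Longrightarrow> dominated_data q T (\<lambda>x u t. norm (f x u t) powr p')"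
proof -
  have "dominated_data q T \<theta> \<and> dominated_data q T (grad_x \<theta>) \<and> dominated_control_data q T (grad_u \<theta>) \<and>
    dominated_data q T (jac_x f) \<and> dominated_control_data q T (jac_u f) \<and>
    (\<forall>p'. p = ereal p' \<longrightarrow> dominated_data q T (\<lambda>x u t. norm (f x u t) powr p'))"
  proof (cases "q = \<infinity>")
    case True
    have "continuous_data T (\<lambda>x u t. norm (f x u t) powr p')" if "p = ereal p'" for p'
    proof -
      have "1 \<le> p'" using exponents(1) that by simp
      then show ?thesis
        using f(1) unfolding continuous_data_def case_prod_beta
        by (intro continuous_on_powr' continuous_intros) auto
    qed
    then show ?thesis
      using theta f(2,3) by (auto simp: True intro: dominated_infinity)
  next
    case False
    obtain r where r: "q = ereal r" using exponents False by (cases q) auto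
    obtain P where P: "p = ereal P" using exponents r by (cases p) auto
    have P1: "1 \<le> P" "P \<le> r" and r1: "1 \<le> r" using exponents r P by auto
    have G: "growth_condition T r 1 \<theta>" "growth_condition T r 1 (grad_x \<theta>)"
      "growth_condition T (r - 1) (conj_exponent q) (grad_u \<theta>)"
      "growth_condition T (r / P) p f" "growth_condition T (r / P) p (jac_x f)"
      "p < q \<Longrightarrow> growth_condition T (r / (r * P / (r - P))) (ereal (r * P / (r - P))) (jac_u f)"
      "q = p \<Longrightarrow> \<forall>x u v. \<forall>t\<in>{0..T}. jac_u f x u t = jac_u f x v t"
      using growth False by (auto simp: r P Let_def)
    have one: "dominated_data q T G" if "growth_condition T r 1 G" for G :: "real^'d \<Rightarrow> real^'m \<Rightarrow> real \<Rightarrow> 'k::euclidean_space"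
    proof -
      have "dominated_data (ereal r) T (\<lambda>x u t. norm (G x u t) powr 1)"
        using growth_powr_dominated[of 1 r T G] r1 that by (simp add: one_ereal_def)
      then show ?thesis unfolding r by (rule dominated_of_powr[rotated]) simp
    qed
    have fp: "dominated_data q T (\<lambda>x u t. norm (f x u t) powr P)"
      unfolding r by (rule growth_powr_dominated[OF P1 G(4)[unfolded P]])
    have fx: "dominated_data q T (jac_x f)"
      unfolding r by (rule dominated_of_powr[OF P1(1) growth_powr_dominated[OF P1 G(5)[unfolded P]]])
    have tu: "dominated_control_data q T (grad_u \<theta>)"
      unfolding r by (rule growth_control_dominated[OF r1 _ _ order_refl G(3)[unfolded r]]) (use r1 in auto)
    have fu: "dominated_control_data q T (jac_u f)"
    proof (cases "p < q")
      case True
      then have Pr: "P < r" by (simp add: r P)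
      \<comment> \<open>This exponent satisfies 1/s = 1/p - 1/q. Then q/s + 1 = q/p is at most q,
        and s is at least q' because q - p \<le> p (q - 1); both reduce to p \<ge> 1.\<close>
      define s where "s = r * P / (r - P)"
      have rs: "r / s = (r - P) / P" using Pr P1 by (simp add: s_def)
      have c1: "conj_exponent (ereal r) \<le> ereal s"
      proof -
        have "1 < r" using Pr P1 by simp
        have "r / (r - 1) \<le> s"
        proof -
          have "r - P \<le> P * (r - 1)" using mult_left_mono[of 1 P r] P1 r1 by (simp add: algebra_simps)
          then have "r * (r - P) \<le> r * (P * (r - 1))" using r1 by (intro mult_left_mono) auto
          then show ?thesis using Pr \<open>1 < r\<close> by (simp add: s_def divide_le_eq le_divide_eq mult_ac)
        qed
        then show ?thesis using \<open>1 < r\<close> by (simp add: conj_exponent_def one_ereal_def)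
      qed
      have c2: "(r - P) / P + 1 \<le> r"
      proof -
        have "(r - P) / P + 1 = r / P" using P1 by (simp add: field_simps)
        also have "\<dots> \<le> r / 1" using P1 r1 by (intro divide_left_mono) auto
        finally show ?thesis by simp
      qed
      have c3: "0 \<le> (r - P) / P" using Pr P1 by simp
      have c4: "growth_condition T ((r - P) / P) (ereal s) (jac_u f)"
        using G(6)[OF True] unfolding s_def[symmetric] rs .
      show ?thesis unfolding r by (rule growth_control_dominated[OF r1 c3 c2 c1 c4])
    next
      case False
      then have "q = p" using exponents by simp
      then show ?thesis using G(7) exponents by (intro control_independent_dominated f) auto
    qed
    show ?thesis using one[OF G(1)] one[OF G(2)] fp fx tu fu P by simp
  qed
  then show "dominated_data q T \<theta>" "dominated_data q T (grad_x \<theta>)" "dominated_control_data q T (grad_u \<theta>)"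
    "dominated_data q T (jac_x f)" "dominated_control_data q T (jac_u f)"
    "p = ereal p' \<Longrightarrow> dominated_data q T (\<lambda>x u t. norm (f x u t) powr p')"
    by blast+
qed

section \<open>Distances between trajectories and size of the violation\<close>

text \<open>Derivatives within a nondegenerate interval are unique, so the chosen derivative in the
  Sobolev norm can be replaced by the right-hand side of the differential equation.\<close>

lemma time_deriv_AE_eq:
  fixes x :: "real \<Rightarrow> 'a::euclidean_space"
  assumes T: "0 < T" and d: "AE t in lebesgue_on {0..T}. (x has_vector_derivative F t) (at t within {0..T})"
  shows "AE t in lebesgue_on {0..T}. time_deriv T x t = F t"
proof -
  have "AE t in lebesgue_on {0..T}. t \<in> {0..T}" by (rule AE_I2) simp
  with d show ?thesis
    by eventually_elim (rule vector_derivative_within_closed_interval[OF T])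
qed

lemma Lp_space_add:
  fixes u v :: "real \<Rightarrow> 'a::euclidean_space"
  assumes "1 \<le> q" "u \<in> Lp_space q T" "v \<in> Lp_space q T"
  shows "(\<lambda>t. u t + v t) \<in> Lp_space q T"
  by (rule Lp_space_bound[OF assms(1,2,3), of _ 1])
    (use assms in \<open>auto dest!: Lp_space_measurable intro!: AE_I2 norm_triangle_ineq\<close>)

lemma Lp_space_diff:
  fixes u v :: "real \<Rightarrow> 'a::euclidean_space"
  assumes "1 \<le> q" "u \<in> Lp_space q T" "v \<in> Lp_space q T"
  shows "(\<lambda>t. u t - v t) \<in> Lp_space q T"
  by (rule Lp_space_bound[OF assms(1,2,3), of _ 1])
    (use assms in \<open>auto dest!: Lp_space_measurable intro!: AE_I2 norm_triangle_ineq4\<close>)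

lemma Lp_cong_AE:
  fixes u v :: "real \<Rightarrow> 'a::euclidean_space"
  assumes q: "1 \<le> q" and T: "0 < T" and v: "v \<in> Lp_space q T" and eq: "AE t in lebesgue_on {0..T}. u t = v t"
  shows "u \<in> Lp_space q T" "Lp_norm q T u \<le> Lp_norm q T v"
proof -
  have "AE t in lebesgue_on {0..T}. v t = u t" using eq by eventually_elim simp
  from borel_measurable_lebesgue_on_AE[OF Lp_space_measurable[OF v] this]
  have u: "u \<in> borel_measurable (lebesgue_on {0..T})" .
  have le: "AE t in lebesgue_on {0..T}. norm (u t) \<le> norm (v t)" using eq by eventually_elim simp
  show "u \<in> Lp_space q T" "Lp_norm q T u \<le> Lp_norm q T v" by (rule Lp_norm_mono_AE[OF q T u v le])+
qed

text \<open>Both states start at \<open>x0\<close>, so their difference is the integral of its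
  derivative, and the L^1 norm of that is at most \<open>T + 1\<close> times an L^p bound. Closeness
  in X thus gives uniform closeness of the states.\<close>

lemma near_trajectory:
  fixes x xr :: "real \<Rightarrow> real^'d" and u ur :: "real \<Rightarrow> real^'m"
  assumes p: "1 \<le> p" and T: "0 < T"
    and x: "(x, u) \<in> trajectories p q T f x0 xT" and xr: "(xr, ur) \<in> trajectories p q T f x0 xT"
    and \<rho>: "X_dist p q T (x, u) (xr, ur) < \<rho>"
  shows "Lp_norm q T (\<lambda>t. u t - ur t) \<le> \<rho>" "\<forall>t\<in>{0..T}. norm (x t - xr t) \<le> \<rho> * (T + 1)"
proof -
  let ?L = "lebesgue_on {0..T}" and ?D = "\<lambda>t. x t - xr t"
  have ac: "abs_continuous_on T ?D"
    using x xr by (intro abs_continuous_on_diff) (auto simp: trajectories_def X_space_def W1p_space_def)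
  have start: "?D 0 = 0" using x xr by (simp add: trajectories_def)
  have dx: "AE t in ?L. (x has_vector_derivative f (x t) (u t) t) (at t within {0..T})"
    "AE t in ?L. (xr has_vector_derivative f (xr t) (ur t) t) (at t within {0..T})"
    using x xr by (auto simp: trajectories_def)
  then have dD: "AE t in ?L. (?D has_vector_derivative f (x t) (u t) t - f (xr t) (ur t) t) (at t within {0..T})"
    by eventually_elim (rule has_vector_derivative_diff)
  have eq: "AE t in ?L. time_deriv T ?D t = time_deriv T x t - time_deriv T xr t"
    using time_deriv_AE_eq[OF T dD] time_deriv_AE_eq[OF T dx(1)] time_deriv_AE_eq[OF T dx(2)]
    by eventually_elim simp
  have "(\<lambda>t. time_deriv T x t - time_deriv T xr t) \<in> Lp_space p T"
    using x xr by (intro Lp_space_diff[OF p]) (auto simp: trajectories_def X_space_def W1p_space_def)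
  from Lp_cong_AE(1)[OF p T this eq] have DL: "time_deriv T ?D \<in> Lp_space p T" .
  have norms: "0 \<le> Lp_norm p T ?D" "0 \<le> Lp_norm p T (time_deriv T ?D)" "0 \<le> Lp_norm q T (\<lambda>t. u t - ur t)"
    by (rule Lp_norm_nonneg[OF T])+
  have X: "Lp_norm p T ?D + Lp_norm p T (time_deriv T ?D) + Lp_norm q T (\<lambda>t. u t - ur t) < \<rho>"
    using \<rho> by (simp add: X_dist_def W1p_norm_def)
  show "Lp_norm q T (\<lambda>t. u t - ur t) \<le> \<rho>" using X norms by linarith
  have \<rho>0: "0 < \<rho>" and D\<rho>: "Lp_norm p T (time_deriv T ?D) \<le> \<rho>" using X norms by linarith+
  have der: "AE t in ?L. (?D has_vector_derivative time_deriv T ?D t) (at t within {0..T})"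
    using dD time_deriv_AE_eq[OF T dD] by eventually_elim simp
  show "\<forall>t\<in>{0..T}. norm (x t - xr t) \<le> \<rho> * (T + 1)"
  proof
    fix t assume t: "t \<in> {0..T}"
    have "(time_deriv T ?D has_integral ?D t - ?D 0) {0..t}"
      by (rule abs_continuous_has_integral_upto[OF _ _ ac der]) (use t in auto)
    then have "?D t = integral {0..t} (time_deriv T ?D)" using start by (simp add: integral_unique)
    then have "norm (?D t) \<le> (LINT s|?L. norm (time_deriv T ?D s))"
      using norm_initial_integral_le[OF Lp_space_imp_integrable[OF p DL], of t] t by simp
    also have "\<dots> \<le> \<rho> * (T + 1)" by (rule integral_norm_le_Lp_norm[OF p T DL \<rho>0 D\<rho>])
    finally show "norm (x t - xr t) \<le> \<rho> * (T + 1)" .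
  qed
qed

text \<open>A real supremum has its order properties only for sets bounded above. The bound comes
  from continuity on the compact interval; summing the bounds of the single constraints also covers
  the case without constraints.\<close>

lemma state_violation_bounds:
  fixes g :: "nat \<Rightarrow> real^'d \<Rightarrow> real \<Rightarrow> real" and x :: "real \<Rightarrow> real^'d"
  assumes T: "0 < T" and x: "continuous_on {0..T} x"
    and g: "\<And>j. j \<in> {1..l} \<Longrightarrow> continuous_on (UNIV \<times> {0..T}) (\<lambda>(x, t). g j x t)"
    and \<phi>: "\<phi> = (SUP t\<in>{0..T}. Max (insert 0 ((\<lambda>j. g j (x t) t) ` {1..l})))"
  shows "0 \<le> \<phi>" "\<And>j t. j \<in> {1..l} \<Longrightarrow> t \<in> {0..T} \<Longrightarrow> g j (x t) t \<le> \<phi>"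
    "\<And>s. 0 \<le> s \<Longrightarrow> \<forall>t\<in>{0..T}. \<forall>j\<in>{1..l}. g j (x t) t \<le> s \<Longrightarrow> \<phi> \<le> s"
proof -
  define m where "m t = Max (insert 0 ((\<lambda>j. g j (x t) t) ` {1..l}))" for t
  have m_le: "m t \<le> s" if "0 \<le> s" "\<forall>j\<in>{1..l}. g j (x t) t \<le> s" for t s
    unfolding m_def using that by (intro Max.boundedI) auto
  have le_m: "0 \<le> m t" "j \<in> {1..l} \<Longrightarrow> g j (x t) t \<le> m t" for j t
    unfolding m_def by (intro Max_ge; simp)+
  have pair: "continuous_on {0..T} (\<lambda>t. (x t, t))" using x by (intro continuous_intros)
  have "\<exists>R>0. \<forall>t\<in>{0..T}. norm (g j (x t) t) \<le> R" if "j \<in> {1..l}" for j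
  proof -
    have "(\<lambda>t. (x t, t)) ` {0..T} \<subseteq> UNIV \<times> {0..T}" by auto
    from continuous_on_compose2[OF g[OF that] pair this]
    have "continuous_on {0..T} (\<lambda>t. g j (x t) t)" by simp
    from continuous_on_Icc_bounded[OF this] show ?thesis by metis
  qed
  then obtain R where R: "\<And>j. j \<in> {1..l} \<Longrightarrow> 0 < R j" "\<And>j t. j \<in> {1..l} \<Longrightarrow> t \<in> {0..T} \<Longrightarrow> norm (g j (x t) t) \<le> R j"
    by metis
  have bdd: "bdd_above (m ` {0..T})"
  proof (rule bdd_aboveI2)
    fix t assume t: "t \<in> {0..T}"
    show "m t \<le> (\<Sum>j\<in>{1..l}. R j)"
    proof (rule m_le)
      show "0 \<le> (\<Sum>j\<in>{1..l}. R j)" using R(1) by (intro sum_nonneg less_imp_le)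
      show "\<forall>j\<in>{1..l}. g j (x t) t \<le> (\<Sum>j\<in>{1..l}. R j)"
      proof
        fix j assume j: "j \<in> {1..l}"
        have "g j (x t) t \<le> R j" using R(2)[OF j t] by simp
        also have "\<dots> \<le> (\<Sum>j\<in>{1..l}. R j)" using j R(1) by (intro member_le_sum) (auto intro: less_imp_le)
        finally show "g j (x t) t \<le> (\<Sum>j\<in>{1..l}. R j)" .
      qed
    qed
  qed
  have \<phi>m: "\<phi> = (SUP t\<in>{0..T}. m t)" by (simp add: \<phi> m_def)
  have up: "m t \<le> \<phi>" if "t \<in> {0..T}" for t unfolding \<phi>m using that bdd by (rule cSUP_upper)
  show "0 \<le> \<phi>" using up[of 0] le_m(1)[of 0] T by simp
  show "g j (x t) t \<le> \<phi>" if "j \<in> {1..l}" "t \<in> {0..T}" for j t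
    using up[OF that(2)] le_m(2)[OF that(1), of t] by linarith
  show "\<phi> \<le> s" if "0 \<le> s" "\<forall>t\<in>{0..T}. \<forall>j\<in>{1..l}. g j (x t) t \<le> s" for s
    unfolding \<phi>m using that T by (intro cSUP_least m_le) auto
qed

text \<open>Almost everywhere the derivative of the new state is \<open>f\<close> along the new
  pair, so membership in W_{1,p} and the distance in X reduce to the L^p estimate for the difference
  of the right-hand sides.\<close>

lemma corrected_trajectory:
  fixes f :: "real^'d \<Rightarrow> real^'m \<Rightarrow> real \<Rightarrow> real^'d"
  assumes p: "1 \<le> p" and q: "1 \<le> q" and T: "0 < T"
    and x: "(x, u) \<in> trajectories p q T f x0 xT" and xr: "(xr, ur) \<in> trajectories p q T f x0 xT"
    and z: "abs_continuous_on T z" "z 0 = 0" "z T = 0"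
    and w: "(\<lambda>t. u t + w t) \<in> Lp_space q T"
    and der: "AE t in lebesgue_on {0..T}. (z has_vector_derivative f (x t + z t) (u t + w t) t - f (x t) (u t) t)
      (at t within {0..T})"
    and D: "(\<lambda>t. f (x t + z t) (u t + w t) t - f (xr t) (ur t) t) \<in> Lp_space p T"
      "Lp_norm p T (\<lambda>t. f (x t + z t) (u t + w t) t - f (xr t) (ur t) t) \<le> \<delta>"
    and s: "\<forall>t\<in>{0..T}. norm (x t + z t - xr t) \<le> s"
    and \<eta>: "Lp_norm q T (\<lambda>t. (u t + w t) - ur t) \<le> \<eta>"
  shows "(\<lambda>t. x t + z t, \<lambda>t. u t + w t) \<in> trajectories p q T f x0 xT"
    "X_dist p q T (\<lambda>t. x t + z t, \<lambda>t. u t + w t) (xr, ur) \<le> s * (1 + T) + \<delta> + \<eta>"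
proof -
  let ?L = "lebesgue_on {0..T}" and ?x = "\<lambda>t. x t + z t" and ?u = "\<lambda>t. u t + w t"
  have acx: "abs_continuous_on T x" "abs_continuous_on T xr" and Lxr: "time_deriv T xr \<in> Lp_space p T"
    using x xr by (auto simp: trajectories_def X_space_def W1p_space_def)
  have dx: "AE t in ?L. (x has_vector_derivative f (x t) (u t) t) (at t within {0..T})"
    "AE t in ?L. (xr has_vector_derivative f (xr t) (ur t) t) (at t within {0..T})"
    using x xr by (auto simp: trajectories_def)
  have ac: "abs_continuous_on T ?x" using acx(1) z(1) by (rule abs_continuous_on_add)
  have d: "AE t in ?L. (?x has_vector_derivative f (?x t) (?u t) t) (at t within {0..T})"
    using dx(1) der
  proof eventually_elim
    case (elim t)
    from has_vector_derivative_add[OF this] show ?case by simp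
  qed
  have dd: "AE t in ?L. ((\<lambda>t. ?x t - xr t) has_vector_derivative f (?x t) (?u t) t - f (xr t) (ur t) t) (at t within {0..T})"
    using d dx(2) by eventually_elim (rule has_vector_derivative_diff)
  have "AE t in ?L. time_deriv T ?x t = (f (?x t) (?u t) t - f (xr t) (ur t) t) + time_deriv T xr t"
    using time_deriv_AE_eq[OF T d] time_deriv_AE_eq[OF T dx(2)] by eventually_elim simp
  from Lp_cong_AE(1)[OF p T Lp_space_add[OF p D(1) Lxr] this] have "time_deriv T ?x \<in> Lp_space p T" .
  then show "(?x, ?u) \<in> trajectories p q T f x0 xT"
    using ac w d z(2,3) x by (auto simp: trajectories_def X_space_def W1p_space_def)
  have "Lp_norm p T (time_deriv T (\<lambda>t. ?x t - xr t)) \<le> \<delta>"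
    using Lp_cong_AE(2)[OF p T D(1) time_deriv_AE_eq[OF T dd]] D(2) by linarith
  moreover have "Lp_norm p T (\<lambda>t. ?x t - xr t) \<le> s * (1 + T)"
    using s acx z(1)[THEN abs_continuous_imp_continuous] acx[THEN abs_continuous_imp_continuous]
    by (intro Lp_norm_le_sup[OF p T] continuous_Icc_measurable continuous_intros) auto
  ultimately show "X_dist p q T (?x, ?u) (xr, ur) \<le> s * (1 + T) + \<delta> + \<eta>"
    using \<eta> by (simp add: X_dist_def W1p_norm_def)
qed

theorem theorem16:
  fixes p q :: ereal and T :: real and l :: nat
    and x0 xT :: "real^'d"
    and \<theta> :: "real^'d \<Rightarrow> real^'m \<Rightarrow> real \<Rightarrow> real"
    and f :: "real^'d \<Rightarrow> real^'m \<Rightarrow> real \<Rightarrow> real^'d"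
    and g :: "nat \<Rightarrow> real^'d \<Rightarrow> real \<Rightarrow> real"
    and x_opt :: "real \<Rightarrow> real^'d" and u_opt :: "real \<Rightarrow> real^'m"
    and A :: "real \<Rightarrow> real^'d^'d" and B :: "real \<Rightarrow> real^'m^'d"
  assumes exponents: "1 \<le> p" "p \<le> q" and T_pos: "0 < T"
    and optimal: "locally_optimal p q T (cost T \<theta>)
      (trajectories p q T f x0 xT \<inter> state_feasible T l g) (x_opt, u_opt)"
    and theta_smooth: "continuous_data T \<theta>" "differentiable_xu T \<theta>"
      "continuous_data T (grad_x \<theta>)" "continuous_data T (grad_u \<theta>)"
    and f_smooth: "continuous_data T f" "differentiable_xu T f"
      "continuous_data T (jac_x f)" "continuous_data T (jac_u f)"
    and growth: "q = \<infinity> \<or>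
      (let q' = real_of_ereal q; p' = real_of_ereal p in
        growth_condition T q' 1 \<theta> \<and> growth_condition T q' 1 (grad_x \<theta>) \<and>
        growth_condition T (q' - 1) (conj_exponent q) (grad_u \<theta>) \<and>
        growth_condition T (q' / p') p f \<and> growth_condition T (q' / p') p (jac_x f) \<and>
        (p < q \<longrightarrow> (let s = q' * p' / (q' - p') in
          growth_condition T (q' / s) (ereal s) (jac_u f))) \<and>
        (q = p \<longrightarrow> (\<forall>x u v. \<forall>t\<in>{0..T}. jac_u f x u t = jac_u f x v t)))"
    and g_smooth: "\<And>j. j \<in> {1..l} \<Longrightarrow> continuous_on (UNIV \<times> {0..T}) (\<lambda>(x, t). g j x t)"
      "\<And>j x t. j \<in> {1..l} \<Longrightarrow> t \<in> {0..T} \<Longrightarrow> (\<lambda>y. g j y t) differentiable (at x)"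
      "\<And>j. j \<in> {1..l} \<Longrightarrow>
        continuous_on (UNIV \<times> {0..T}) (\<lambda>(x, t). gradient (\<lambda>y. g j y t) x)"
    and A_def: "A = (\<lambda>t. jac_x f (x_opt t) (u_opt t) t)"
    and B_def: "B = (\<lambda>t. jac_u f (x_opt t) (u_opt t) t)"
    and controllable: "completely_controllable q T A B"
    and A_bounded: "A \<in> Lp_space \<infinity> T"
    and direction: "\<exists>v\<in>Lp_space q T. \<exists>h. linear_solution T A B v h \<and> h 0 = 0 \<and> h T = 0 \<and>
      (\<forall>j\<in>{1..l}. \<forall>t\<in>{0..T}. g j (x_opt t) t = 0 \<longrightarrow>
        inner (gradient (\<lambda>y. g j y t) (x_opt t)) (h t) < 0)"
  shows "\<exists>c0\<ge>0. \<forall>c\<ge>c0. locally_optimal p q T (penalty_function T \<theta> l g c)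
    (trajectories p q T f x0 xT) (x_opt, u_opt)"
proof -
  have q: "1 \<le> q" using exponents by (rule order_trans)
  note T = T_pos
  have Tge: "0 \<le> T" using T by simp
  have traj: "(x_opt, u_opt) \<in> trajectories p q T f x0 xT"
    and feas: "\<And>j t. j \<in> {1..l} \<Longrightarrow> t \<in> {0..T} \<Longrightarrow> g j (x_opt t) t \<le> 0"
    using optimal by (auto simp: locally_optimal_def state_feasible_def)
  obtain r where r: "0 < r" and opt: "\<forall>z\<in>trajectories p q T f x0 xT \<inter> state_feasible T l g.
      X_dist p q T z (x_opt, u_opt) < r \<longrightarrow> cost T \<theta> (x_opt, u_opt) \<le> cost T \<theta> z"
    using optimal unfolding locally_optimal_def by blast
  have xr: "continuous_on {0..T} x_opt" and ur: "u_opt \<in> Lp_space q T"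
    using traj by (auto simp: trajectories_def X_space_def W1p_space_def intro: abs_continuous_imp_continuous)
  note dom = growth_imp_dominated[OF exponents theta_smooth(1,3,4) f_smooth(1,3,4) growth]
  have sdf: "smooth_data T f (jac_x f) (jac_u f) (*v) (*v)"
  proof (rule smooth_data.intro)
    fix x :: "real^'d" and u :: "real^'m" and t assume "t \<in> {0..T}"
    then have "(\<lambda>y. f y u t) differentiable (at x)" "(\<lambda>v. f x v t) differentiable (at u)"
      using f_smooth(2) by (auto simp: differentiable_xu_def)
    then show "((\<lambda>y. f y u t) has_derivative (*v) (jac_x f x u t)) (at x)"
      "((\<lambda>v. f x v t) has_derivative (*v) (jac_u f x u t)) (at u)"
      by (auto simp: jac_x_def jac_u_def jacobian_works[THEN iffD1])
  qed (fact T f_smooth bounded_bilinear_matrix_vector_mult)+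
  have sd\<theta>: "smooth_data T \<theta> (grad_x \<theta>) (grad_u \<theta>) inner inner"
  proof (rule smooth_data.intro)
    fix x :: "real^'d" and u :: "real^'m" and t assume "t \<in> {0..T}"
    then have "(\<lambda>y. \<theta> y u t) differentiable (at x)" "(\<lambda>v. \<theta> x v t) differentiable (at u)"
      using theta_smooth(2) by (auto simp: differentiable_xu_def)
    from gradient_works[OF this(1)] gradient_works[OF this(2)]
    show "((\<lambda>y. \<theta> y u t) has_derivative inner (grad_x \<theta> x u t)) (at x)"
      "((\<lambda>v. \<theta> x v t) has_derivative inner (grad_u \<theta> x u t)) (at u)"
      by (simp_all add: gderiv_def grad_x_def grad_u_def inner_commute[of _ "gradient \<phi> y" for \<phi> y])
  qed (fact T theta_smooth bounded_bilinear_inner)+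
  obtain v h where v: "v \<in> Lp_space q T" and lin: "linear_solution T A B v h" and h0: "h 0 = 0" "h T = 0"
    and act: "\<And>j t. j \<in> {1..l} \<Longrightarrow> t \<in> {0..T} \<Longrightarrow> g j (x_opt t) t = 0 \<Longrightarrow>
      inner (gradient (\<lambda>y. g j y t) (x_opt t)) (h t) < 0"
    using direction by blast
  have hc: "continuous_on {0..T} h"
    using lin by (auto simp: linear_solution_def intro: abs_continuous_imp_continuous)
  obtain H where H: "0 < H" "\<forall>t\<in>{0..T}. norm (h t) \<le> H" by (rule continuous_on_Icc_bounded[OF hc])
  have "\<exists>e>0. \<forall>j\<in>{1..l}. \<forall>t\<in>{0..T}. \<forall>x z \<epsilon>. norm (x - x_opt t) \<le> e \<longrightarrow>
      norm (x + z - x_opt t) \<le> e \<longrightarrow> 0 \<le> \<epsilon> \<longrightarrow> norm (z - \<epsilon> *\<^sub>R h t) \<le> e * \<epsilon> \<longrightarrow> g j x t \<le> e * \<epsilon> \<longrightarrow> g j (x + z) t \<le> 0"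
    by (rule constraints_restoration[OF T finite_atLeastAtMost xr hc]) (fact g_smooth feas act)+
  then obtain e where e: "0 < e" and restore: "\<forall>j\<in>{1..l}. \<forall>t\<in>{0..T}. \<forall>x z \<epsilon>. norm (x - x_opt t) \<le> e \<longrightarrow>
      norm (x + z - x_opt t) \<le> e \<longrightarrow> 0 \<le> \<epsilon> \<longrightarrow> norm (z - \<epsilon> *\<^sub>R h t) \<le> e * \<epsilon> \<longrightarrow> g j x t \<le> e * \<epsilon> \<longrightarrow> g j (x + z) t \<le> 0"
    by blast
  obtain V :: "real \<Rightarrow> real" where V: "V \<in> Lp_space q T" and V0: "\<forall>t. 0 \<le> V t"
    and corr: "\<forall>\<kappa>>0. \<exists>\<rho>0>0. correctable q T f x_opt u_opt h V \<kappa> \<rho>0"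
    using trajectory_correction[OF sdf q xr ur dom(4,5) A_def B_def controllable A_bounded v lin h0] by blast
  \<comment> \<open>The precision \<open>e\<close> is what restoring the constraints tolerates; the
    bound 1 gives the new increment the size \<open>(H + 1) * \<epsilon>\<close>.\<close>
  have "0 < min 1 e" using e by simp
  with corr obtain \<rho>1 where \<rho>1: "0 < \<rho>1" and corr1: "correctable q T f x_opt u_opt h V (min 1 e) \<rho>1"
    by blast
  obtain \<rho>L L where \<rho>L: "0 < \<rho>L" and L: "0 \<le> L" and Lip: "\<forall>\<rho> u x1 x2 u1 u2 \<sigma>. \<rho> \<le> \<rho>L \<longrightarrow>
      control_variation q T x_opt u_opt V \<rho> u x1 x2 u1 u2 \<sigma> \<longrightarrow>
      (LINT t|lebesgue_on {0..T}. norm (\<theta> (x1 t) (u1 t) t - \<theta> (x2 t) (u2 t) t)) \<le> L * \<sigma>"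
    using smooth_data.Lipschitz_in_mean[OF sd\<theta> q xr ur V V0[rule_format] dom(2,3)] by blast
  have r4: "0 < r / 4" using r by simp
  have "\<exists>\<rho>0>0. \<forall>u x. u \<in> Lp_space q T \<longrightarrow> Lp_norm q T (\<lambda>t. u t - u_opt t) \<le> \<rho>0 \<longrightarrow>
    x \<in> borel_measurable (lebesgue_on {0..T}) \<longrightarrow> (\<forall>t\<in>{0..T}. norm (x t - x_opt t) \<le> \<rho>0) \<longrightarrow>
    (\<lambda>t. f (x t) (u t) t - f (x_opt t) (u_opt t) t) \<in> Lp_space p T \<and>
    Lp_norm p T (\<lambda>t. f (x t) (u t) t - f (x_opt t) (u_opt t) t) \<le> r / 4"
    using exponents(1)
  proof (cases rule: exponent_cases)
    case (fin p')
    show ?thesis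
      using superposition_Lp_continuous_finite[OF q T fin(2) f_smooth(1) dom(6)[OF fin(1)] xr ur r4]
      unfolding fin(1) .
  next
    case inf
    then have "q = \<infinity>" using exponents by simp
    then show ?thesis
      using superposition_Lp_continuous_infinity[OF T f_smooth(1) xr _ r4] ur inf by simp
  qed
  then obtain \<rho>S where \<rho>S: "0 < \<rho>S" and sup: "\<forall>u x. u \<in> Lp_space q T \<longrightarrow> Lp_norm q T (\<lambda>t. u t - u_opt t) \<le> \<rho>S \<longrightarrow>
    x \<in> borel_measurable (lebesgue_on {0..T}) \<longrightarrow> (\<forall>t\<in>{0..T}. norm (x t - x_opt t) \<le> \<rho>S) \<longrightarrow>
    (\<lambda>t. f (x t) (u t) t - f (x_opt t) (u_opt t) t) \<in> Lp_space p T \<and>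
    Lp_norm p T (\<lambda>t. f (x t) (u t) t - f (x_opt t) (u_opt t) t) \<le> r / 4"
    by blast
  \<comment> \<open>\<open>m\<close> will bound the change of the state uniformly and that of the
    control in L^q. The distance in X is then at most r/8 for the state, r/4 for its derivative and
    r/8 for the control.\<close>
  define m where "m = min (min \<rho>1 (min e (min \<rho>L \<rho>S))) (r / (8 * (1 + T)))"
  have m: "0 < m" "m \<le> \<rho>1" "m \<le> e" "m \<le> \<rho>L" "m \<le> \<rho>S" "m * (1 + T) \<le> r / 8" "m \<le> r / 8"
  proof -
    show "0 < m" using \<rho>1 e \<rho>L \<rho>S r T by (simp add: m_def)
    show "m \<le> \<rho>1" "m \<le> e" "m \<le> \<rho>L" "m \<le> \<rho>S" by (auto simp: m_def)
    have "m \<le> r / (8 * (1 + T))" by (simp add: m_def)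
    then show mr: "m * (1 + T) \<le> r / 8" using T by (simp add: pos_le_divide_eq mult_ac)
    have "m * 1 \<le> m * (1 + T)" using \<open>0 < m\<close> T by (intro mult_left_mono) auto
    then show "m \<le> r / 8" using mr by simp
  qed
  define NV where "NV = Lp_norm q T V"
  have NV: "0 \<le> NV" unfolding NV_def by (rule Lp_norm_nonneg[OF T])
  \<comment> \<open>\<open>b\<close> bounds both the distance of the given pair and the step length.
    The state then moves away by at most \<open>b * (H + 2)\<close>. For the control, the factor 8
    combines the 4 of the norm estimate with the 2 in the bound for \<open>w\<close>.\<close>
  define b where "b = m / (8 * (H + 2 + NV))"
  have b8: "b * (8 * (H + 2 + NV)) = m" using H(1) NV by (simp add: b_def)
  have b: "0 < b" using m(1) H(1) NV by (simp add: b_def)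
  have b_le: "b * (H + 2) \<le> m" "2 * b \<le> m" "4 * 1 * (2 * b * (1 + NV)) \<le> m"
  proof -
    have eq: "m = 8 * (b * H) + 16 * b + 8 * (b * NV)" using b8 by (simp add: algebra_simps)
    have "0 \<le> b * H" "0 \<le> b * NV" using b H(1) NV by auto
    then show "b * (H + 2) \<le> m" "2 * b \<le> m" "4 * 1 * (2 * b * (1 + NV)) \<le> m"
      using b unfolding eq by (simp_all add: algebra_simps)
  qed
  \<comment> \<open>A violation of at most \<open>e * b\<close> makes the step length, which is the
    violation divided by \<open>e\<close>, at most \<open>b\<close>.\<close>
  have eb: "0 < e * b" using e b by simp
  obtain \<rho>C where \<rho>C: "0 < \<rho>C"
    and nearly: "\<forall>j\<in>{1..l}. \<forall>t\<in>{0..T}. \<forall>x. norm (x - x_opt t) \<le> \<rho>C \<longrightarrow> g j x t \<le> e * b"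
    using constraints_nearly_satisfied[where g = g and J = "{1..l}", OF finite_atLeastAtMost xr g_smooth(1) feas eb] by blast
  \<comment> \<open>Distance less than \<open>\<rho>\<close> in X means uniform distance at most
    \<open>\<rho> * (T + 1)\<close> of the states.\<close>
  define \<rho> where "\<rho> = min b \<rho>C / (T + 1)"
  have \<rho>: "0 < \<rho>" "\<rho> * (T + 1) \<le> b" "\<rho> * (T + 1) \<le> \<rho>C" "\<rho> \<le> b"
  proof -
    show "0 < \<rho>" using b \<rho>C T by (simp add: \<rho>_def)
    have eq: "\<rho> * (T + 1) = min b \<rho>C" using T by (simp add: \<rho>_def)
    then show 1: "\<rho> * (T + 1) \<le> b" "\<rho> * (T + 1) \<le> \<rho>C" by auto
    have "\<rho> * 1 \<le> \<rho> * (T + 1)" using \<open>0 < \<rho>\<close> T by (intro mult_left_mono) auto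
    then show "\<rho> \<le> b" using 1(1) by simp
  qed
  define viol where "viol x = (SUP t\<in>{0..T}. Max (insert 0 ((\<lambda>j. g j (x t) t) ` {1..l})))" for x :: "real \<Rightarrow> real^'d"
  have pen: "penalty_function T \<theta> l g c (x, u) = cost T \<theta> (x, u) + c * viol x" for c x u
    by (simp add: penalty_function_def viol_def)
  have viol_opt: "viol x_opt = 0"
  proof (rule antisym)
    show "viol x_opt \<le> 0"
      by (rule state_violation_bounds(3)[where g = g and l = l, OF T xr g_smooth(1) viol_def]) (use feas in auto)
    show "0 \<le> viol x_opt" by (rule state_violation_bounds(1)[where g = g and l = l, OF T xr g_smooth(1) viol_def])
  qed
  \<comment> \<open>The correction raises the cost by at most \<open>L * (H + 2)\<close> times the
    step length, and the step length is the violation divided by \<open>e\<close>.\<close>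
  define c0 where "c0 = L * (H + 2) / e"
  have c0: "0 \<le> c0" using L H(1) e by (simp add: c0_def)
  have main: "cost T \<theta> (x_opt, u_opt) \<le> cost T \<theta> (x, u) + c0 * viol x"
    if xu: "(x, u) \<in> trajectories p q T f x0 xT" and dist: "X_dist p q T (x, u) (x_opt, u_opt) < \<rho>" for x u
  proof -
    have xc: "continuous_on {0..T} x" and u: "u \<in> Lp_space q T"
      using xu by (auto simp: trajectories_def X_space_def W1p_space_def intro: abs_continuous_imp_continuous)
    note near = near_trajectory[OF exponents(1) T xu traj dist]
    have xn: "\<forall>t\<in>{0..T}. norm (x t - x_opt t) \<le> b" "\<forall>t\<in>{0..T}. norm (x t - x_opt t) \<le> \<rho>C"
      using near(2) \<rho>(2,3) by (auto intro: order_trans)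
    have un: "Lp_norm q T (\<lambda>t. u t - u_opt t) \<le> b" using near(1) \<rho>(4) by linarith
    note sv = state_violation_bounds[where g = g and l = l, OF T xc _ viol_def]
    have vb1: "0 \<le> viol x" by (rule sv(1)) (fact g_smooth(1))
    have vb2: "g j (x t) t \<le> viol x" if "j \<in> {1..l}" "t \<in> {0..T}" for j t
      by (rule sv(2)[OF _ that]) (fact g_smooth(1))
    have vb3: "viol x \<le> s" if "0 \<le> s" "\<forall>t\<in>{0..T}. \<forall>j\<in>{1..l}. g j (x t) t \<le> s" for s
      by (rule sv(3)[OF _ that]) (fact g_smooth(1))
    show ?thesis
    \<comment> \<open>Without violation the pair is feasible itself and competes directly;
      corrections exist only for positive step length.\<close>
    proof (cases "viol x = 0")
      case True
      have "(x, u) \<in> state_feasible T l g"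
        using vb2 True by (auto simp: state_feasible_def)
      moreover have "\<rho> \<le> r" using \<rho>(4) b_le(2) m(7) b r by linarith
      ultimately have "cost T \<theta> (x_opt, u_opt) \<le> cost T \<theta> (x, u)" using opt xu dist by force
      then show ?thesis using True by simp
    next
      case False
      then have vpos: "0 < viol x" using vb1 by simp
      define \<epsilon> where "\<epsilon> = viol x / e"
      have \<epsilon>: "0 < \<epsilon>" "e * \<epsilon> = viol x" using vpos e by (auto simp: \<epsilon>_def)
      have "viol x \<le> e * b" using nearly xn(2) eb by (intro vb3) auto
      then have \<epsilon>b: "\<epsilon> \<le> b" using e by (simp add: \<epsilon>_def pos_divide_le_eq mult.commute)
      have b\<rho>1: "b \<le> \<rho>1" using b_le(2) m(2) b by linarith
      have "\<exists>z w. abs_continuous_on T z \<and> w \<in> borel_measurable (lebesgue_on {0..T}) \<and> z 0 = 0 \<and> z T = 0 \<and>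
        (\<forall>t\<in>{0..T}. norm (z t - \<epsilon> *\<^sub>R h t) \<le> min 1 e * \<epsilon>) \<and> (\<forall>t. norm (w t) \<le> 2 * \<epsilon> * V t) \<and>
        (AE t in lebesgue_on {0..T}. (z has_vector_derivative f (x t + z t) (u t + w t) t - f (x t) (u t) t)
          (at t within {0..T}))"
        by (rule corr1[unfolded correctable_def, rule_format, OF xc u _ _ \<epsilon>(1)]) (use xn(1) un \<epsilon>b b\<rho>1 in \<open>auto intro: order_trans\<close>)
      then obtain z w where z: "abs_continuous_on T z" "z 0 = 0" "z T = 0"
        and wm: "w \<in> borel_measurable (lebesgue_on {0..T})"
        and zh: "\<forall>t\<in>{0..T}. norm (z t - \<epsilon> *\<^sub>R h t) \<le> min 1 e * \<epsilon>" and w: "\<forall>t. norm (w t) \<le> 2 * \<epsilon> * V t"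
        and der: "AE t in lebesgue_on {0..T}. (z has_vector_derivative f (x t + z t) (u t + w t) t - f (x t) (u t) t)
          (at t within {0..T})"
        by blast
      have zc: "continuous_on {0..T} z" by (rule abs_continuous_imp_continuous[OF z(1)])
      have xzc: "continuous_on {0..T} (\<lambda>t. x t + z t)" using xc zc by (intro continuous_intros)
      have zle: "norm (z t) \<le> (H + 1) * \<epsilon>" if t: "t \<in> {0..T}" for t
      proof -
        have "norm (z t) \<le> norm (\<epsilon> *\<^sub>R h t) + min 1 e * \<epsilon>"
          using zh t by (intro norm_le_of_near[OF _ order_refl]) simp
        also have "norm (\<epsilon> *\<^sub>R h t) \<le> H * \<epsilon>" using H(2) t \<epsilon>(1) by simp
        also have "min 1 e * \<epsilon> \<le> 1 * \<epsilon>" using \<epsilon>(1) by (intro mult_right_mono) auto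
        finally show ?thesis by (simp add: algebra_simps)
      qed
      have xzn: "norm (x t + z t - x_opt t) \<le> m" if t: "t \<in> {0..T}" for t
      proof -
        have "norm (x t + z t - x_opt t) \<le> norm (x t - x_opt t) + norm (z t)"
          by (metis add_diff_eq add.commute norm_triangle_ineq)
        also have "\<dots> \<le> b + (H + 1) * b"
        proof (rule add_mono)
          show "norm (x t - x_opt t) \<le> b" using xn(1) t by blast
          have "(H + 1) * \<epsilon> \<le> (H + 1) * b" using \<epsilon>b H(1) by (intro mult_left_mono) auto
          then show "norm (z t) \<le> (H + 1) * b" using zle[OF t] by linarith
        qed
        also have "\<dots> = b * (H + 2)" by (simp add: algebra_simps)
        finally show ?thesis using b_le(1) by linarith
      qed
      have xm: "norm (x t - x_opt t) \<le> m" if "t \<in> {0..T}" for t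
        using xn(1) that b_le(2) b by fastforce
      have um [measurable]: "u \<in> borel_measurable (lebesgue_on {0..T})" using u by (rule Lp_space_measurable)
      have uwm: "(\<lambda>t. u t + w t) \<in> borel_measurable (lebesgue_on {0..T})" using wm by measurable
      have V2: "(\<lambda>t. 2 * \<epsilon> * V t) \<in> Lp_space q T"
        by (rule Lp_space_bound[OF q V V, of _ "2 * \<epsilon>"])
          (use \<epsilon>(1) V in \<open>auto simp: abs_mult dest: Lp_space_measurable intro!: AE_I2 mult_left_mono\<close>)
      have uw: "(\<lambda>t. u t + w t) \<in> Lp_space q T"
      proof (rule Lp_space_bound[OF q u V2 uwm zero_le_one])
        show "AE t in lebesgue_on {0..T}. norm (u t + w t) \<le> 1 * (norm (u t) + norm (2 * \<epsilon> * V t))"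
        proof (rule AE_I2)
          fix t
          have "norm (u t + w t) \<le> norm (u t) + norm (w t)" by (rule norm_triangle_ineq)
          also have "norm (w t) \<le> norm (2 * \<epsilon> * V t)" using w abs_ge_self[of "2 * \<epsilon> * V t"] by (metis order_trans real_norm_def)
          finally show "norm (u t + w t) \<le> 1 * (norm (u t) + norm (2 * \<epsilon> * V t))" by simp
        qed
      qed
      have uwn: "Lp_norm q T (\<lambda>t. (u t + w t) - u_opt t) \<le> m"
      proof -
        have 1: "Lp_norm q T (\<lambda>t. u t - u_opt t) \<le> 2 * b * (1 + NV)"
        proof -
          have "b \<le> 2 * b * (1 + NV)" using b NV by (simp add: algebra_simps)
          then show ?thesis using un by linarith
        qed
        have 2: "Lp_norm q T (\<lambda>t. 2 * \<epsilon> * V t) \<le> 2 * b * (1 + NV)"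
        proof -
          have "Lp_norm q T (\<lambda>t. 2 * \<epsilon> * V t) \<le> 2 * \<epsilon> * NV"
            unfolding NV_def using \<epsilon>(1) by (intro Lp_norm_scale_le[OF q T V]) auto
          also have "\<dots> \<le> 2 * b * (1 + NV)" using \<epsilon>b \<epsilon>(1) NV by (intro mult_mono) auto
          finally show ?thesis .
        qed
        have "Lp_norm q T (\<lambda>t. (u t + w t) - u_opt t) \<le> 4 * 1 * (2 * b * (1 + NV))"
        proof (rule Lp_norm_bound[OF q T Lp_space_diff[OF q u ur] V2 _ zero_le_one _ _ 1 2])
          show "(\<lambda>t. u t + w t - u_opt t) \<in> borel_measurable (lebesgue_on {0..T})"
            using uwm Lp_space_measurable[OF ur] by (rule borel_measurable_diff)
          show "0 \<le> 2 * b * (1 + NV)" using b NV by simp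
          show "AE t in lebesgue_on {0..T}. norm (u t + w t - u_opt t) \<le> 1 * (norm (u t - u_opt t) + norm (2 * \<epsilon> * V t))"
          proof (rule AE_I2)
            fix t
            have "u t + w t - u_opt t = (u t - u_opt t) + w t" by simp
            then have "norm (u t + w t - u_opt t) \<le> norm (u t - u_opt t) + norm (w t)"
              by (metis norm_triangle_ineq)
            also have "norm (w t) \<le> norm (2 * \<epsilon> * V t)" using w abs_ge_self[of "2 * \<epsilon> * V t"] by (metis order_trans real_norm_def)
            finally show "norm (u t + w t - u_opt t) \<le> 1 * (norm (u t - u_opt t) + norm (2 * \<epsilon> * V t))" by simp
          qed
        qed
        then show ?thesis using b_le(3) by linarith
      qed
      have "Lp_norm q T (\<lambda>t. (u t + w t) - u_opt t) \<le> \<rho>S" using uwn m(5) by linarith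
      moreover have "\<forall>t\<in>{0..T}. norm (x t + z t - x_opt t) \<le> \<rho>S"
        using order_trans[OF xzn m(5)] by blast
      ultimately have D: "(\<lambda>t. f (x t + z t) (u t + w t) t - f (x_opt t) (u_opt t) t) \<in> Lp_space p T"
        "Lp_norm p T (\<lambda>t. f (x t + z t) (u t + w t) t - f (x_opt t) (u_opt t) t) \<le> r / 4"
        using sup[rule_format, OF uw _ continuous_Icc_measurable[OF xzc]] by auto
      have xzm: "\<forall>t\<in>{0..T}. norm (x t + z t - x_opt t) \<le> m" using xzn by blast
      note new = corrected_trajectory[OF exponents(1) q T xu traj z uw der D xzm uwn]
      have "X_dist p q T (\<lambda>t. x t + z t, \<lambda>t. u t + w t) (x_opt, u_opt) < r"
        using new(2) m(6,7) r by linarith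
      moreover have "(\<lambda>t. x t + z t, \<lambda>t. u t + w t) \<in> state_feasible T l g"
      proof -
        have "g j (x t + z t) t \<le> 0" if jt: "j \<in> {1..l}" "t \<in> {0..T}" for j t
        proof (rule restore[rule_format, OF jt, of "x t" "z t" \<epsilon>])
          show "norm (x t - x_opt t) \<le> e" "norm (x t + z t - x_opt t) \<le> e"
            using xm[OF jt(2)] xzn[OF jt(2)] m(3) by linarith+
          have "min 1 e * \<epsilon> \<le> e * \<epsilon>" using \<epsilon>(1) by (intro mult_right_mono) auto
          then show "norm (z t - \<epsilon> *\<^sub>R h t) \<le> e * \<epsilon>" using zh jt(2) by fastforce
          show "g j (x t) t \<le> e * \<epsilon>" unfolding \<epsilon>(2) by (rule vb2[OF jt])
        qed (use \<epsilon>(1) in simp)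
        then show ?thesis by (auto simp: state_feasible_def)
      qed
      ultimately have 1: "cost T \<theta> (x_opt, u_opt) \<le> cost T \<theta> (\<lambda>t. x t + z t, \<lambda>t. u t + w t)"
        using opt new(1) by blast
      have i1: "integrable (lebesgue_on {0..T}) (\<lambda>t. \<theta> (x t + z t) (u t + w t) t)"
        by (rule dominated_integrable[OF q Tge theta_smooth(1) dom(1) xzc uw])
      have i2: "integrable (lebesgue_on {0..T}) (\<lambda>t. \<theta> (x t) (u t) t)"
        by (rule dominated_integrable[OF q Tge theta_smooth(1) dom(1) xc u])
      \<comment> \<open>The size \<open>(H + 2) * \<epsilon>\<close> covers the state increment, at
        most \<open>(H + 1) * \<epsilon>\<close>, and the control increment, at most
        \<open>2 * \<epsilon> * V t\<close>.\<close>
      have "(LINT t|lebesgue_on {0..T}. norm (\<theta> (x t + z t) (u t + w t) t - \<theta> (x t) (u t) t)) \<le> L * ((H + 2) * \<epsilon>)"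
      proof (rule Lip[rule_format, OF order_refl control_variationI[OF \<rho>L _ u _ continuous_Icc_measurable[OF xzc] continuous_Icc_measurable[OF xc] uwm um]])
        show "0 < (H + 2) * \<epsilon>" using H(1) \<epsilon>(1) by simp
        show "Lp_norm q T (\<lambda>t. u t - u_opt t) \<le> \<rho>L" using un b_le(2) m(4) b by linarith
        fix t assume t: "t \<in> {0..T}"
        have Vt: "0 \<le> V t" using V0 by blast
        have "norm (w t) \<le> 2 * \<epsilon> * V t" using w by blast
        moreover have "2 * \<epsilon> * V t \<le> \<rho>L * V t"
          using \<epsilon>b b_le(2) m(4) Vt by (intro mult_right_mono) auto
        moreover have "2 * \<epsilon> * V t \<le> (H + 2) * \<epsilon> * V t"
          using H(1) \<epsilon>(1) Vt by (intro mult_right_mono) auto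
        moreover have "norm (z t) \<le> (H + 2) * \<epsilon>"
          using zle[OF t] \<epsilon>(1) by (simp add: algebra_simps)
        moreover have "norm (x t + z t - x_opt t) \<le> \<rho>L" "norm (x t - x_opt t) \<le> \<rho>L"
          using xzn[OF t] xm[OF t] m(4) by linarith+
        ultimately show "norm (x t + z t - x_opt t) \<le> \<rho>L \<and> norm (x t - x_opt t) \<le> \<rho>L \<and>
          norm (u t + w t - u t) \<le> \<rho>L * V t \<and> norm (u t - u t) \<le> \<rho>L * V t \<and>
          norm (x t + z t - x t) \<le> (H + 2) * \<epsilon> \<and> norm (u t + w t - u t) \<le> (H + 2) * \<epsilon> * V t"
          using \<rho>L Vt by simp
      qed
      moreover have "L * ((H + 2) * \<epsilon>) = c0 * viol x"
        by (simp add: c0_def \<epsilon>_def)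
      moreover have "cost T \<theta> (\<lambda>t. x t + z t, \<lambda>t. u t + w t) - cost T \<theta> (x, u)
        \<le> (LINT t|lebesgue_on {0..T}. norm (\<theta> (x t + z t) (u t + w t) t - \<theta> (x t) (u t) t))"
      proof -
        have "cost T \<theta> (\<lambda>t. x t + z t, \<lambda>t. u t + w t) - cost T \<theta> (x, u)
          = (LINT t|lebesgue_on {0..T}. \<theta> (x t + z t) (u t + w t) t - \<theta> (x t) (u t) t)"
          using i1 i2 by (simp add: cost_def)
        also have "\<dots> \<le> (LINT t|lebesgue_on {0..T}. norm (\<theta> (x t + z t) (u t + w t) t - \<theta> (x t) (u t) t))"
          using i1 i2 by (intro integral_mono) auto
        finally show ?thesis .
      qed
      ultimately show ?thesis using 1 by linarith
    qed
  qed
  show ?thesis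
  proof (intro exI[of _ c0] conjI allI impI c0)
    fix c assume c: "c0 \<le> c"
    show "locally_optimal p q T (penalty_function T \<theta> l g c) (trajectories p q T f x0 xT) (x_opt, u_opt)"
      unfolding locally_optimal_def
    \<comment> \<open>The radius \<open>\<rho>\<close> is the same for all penalty parameters, since
      a larger parameter only increases the penalty of competitors while the optimal pair has
      none.\<close>
    proof (intro conjI exI[of _ \<rho>] ballI impI)
      fix s assume s: "s \<in> trajectories p q T f x0 xT" "X_dist p q T s (x_opt, u_opt) < \<rho>"
      obtain x u where xu: "s = (x, u)" by (cases s)
      have xc: "continuous_on {0..T} x"
        using s(1) xu by (auto simp: trajectories_def X_space_def W1p_space_def intro: abs_continuous_imp_continuous)
      have "0 \<le> viol x" by (rule state_violation_bounds(1)[where g = g and l = l, OF T xc g_smooth(1) viol_def])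
      then have "c0 * viol x \<le> c * viol x" using c by (intro mult_right_mono)
      then show "penalty_function T \<theta> l g c (x_opt, u_opt) \<le> penalty_function T \<theta> l g c s"
        using main[of x u] s unfolding xu pen viol_opt by simp
    qed (use traj \<rho>(1) in auto)
  qed
qed

end
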